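(* Let $(X,d)$ be an $N$-doubling, $C$-bounded turning metric tree. Then for any $M\in\mathbb{N}$ sufficiently large, any $K_1>0$ sufficiently small, and any $K_2\in[\frac12,1)$, there exist (1) an alphabet $A=\{1,\dots,M\}$, (2) combinatorial data $\mathscr{C}=(A,(T_k)_{k\in\mathbb{N}})$ with each $T_k$ a combinatorial tree, (3) a diameter function $\Delta\in\mathscr{D}(A,K_1,K_2)$ such that $(\mathcal{A},d_{\mathscr{C},\Delta})$ is bi-Lipschitz equivalent to $X$. The sufficient condition on $M$ depends only on $N$ and $C$. The sufficient condition on $K_1$ depends only on $M$, $N$, and $C$. The bi-Lipschitz constant depends only on $N$, $C$, $K_2/K_1$, and $\operatorname{diam}(X)$. Moreover, $(\mathscr{C},\Delta)$ satisfies the following conditions for some $N',n_0\in\mathbb{N}$, $c>1$ and $\delta_1,\delta_2\in(0,1)$: (P1) $\operatorname{card}A\le N'$. (P2) Every vertex of every $T_k$ has at most $n_0$ neighbors in $T_k$. (P3) For all $w\in A^*$ and $i\in A$, $\delta_1\Delta(w)\le\Delta(wi)\le\delta_2\Delta(w)$. (P4) If $k\in\mathbb{N}$, $u,u_1,u_2\in A^k$ are distinct, $A^{\mathbb{N}}_u\wedge_{\mathscr{C}}A^{\mathbb{N}}_{u_i}\neq\emptyset$ for $i=1,2$, and $w_i\in A^{\mathbb{N}}_u\wedge_{\mathscr{C}}A^{\mathbb{N}}_{u_i}$ for $i=1,2$, then $d_{\mathscr{C},\Delta}([w_1],[w_2])\ge c^{-1}\Delta(u)$.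
   Context: Metric notions. A metric tree is a compact, connected, locally connected metric space in which each pair of distinct points forms the endpoints of a unique arc. A metric space is $N$-doubling if every ball can be covered by $N$ balls of half the radius. It is $C$-bounded turning if each pair of points $x,y$ can be joined by a continuum (compact connected set) of diameter at most $C\,d(x,y)$. A map $f$ is $L$-bi-Lipschitz if $L^{-1}d(x,y)\le d(f(x),f(y))\le L\,d(x,y)$ for all $x,y$; two spaces are bi-Lipschitz equivalent if there is a surjective bi-Lipschitz map between them. Words. For $A=\{1,\dots,M\}$, $M\ge2$: $A^k$ is the set of words of length $k$ ($A^0=\{\varepsilon\}$, the empty word), $A^*=\bigcup_{k\ge0}A^k$, $A^{\mathbb{N}}$ is the set of infinite words, $|w|$ is the length of $w$, $w(n)$ is the initial subword of $w$ of length $n$; for $u\in A^*$, $A^{\mathbb{N}}_u$ (resp. $A^n_u$, $n\ge|u|$) is the set of infinite words (resp. words of length $n$) beginning with $u$. Graphs. A combinatorial tree is a graph in which any two distinct vertices are joined by a unique simple path. Combinatorial data. $\mathscr{C}=(A,(G_k)_{k\in\mathbb{N}})$ where, for each $k\in\mathbb{N}$, $G_k=(A^k,E_k)$ is a connected graph such that (a) for each $w\in A^k$ the subgraph of $G_{k+1}$ induced by $\{wi:i\in A\}$ is connected; (b) if $\{w,u\}\in E_k$ then there is $(i,j)\in A\times A$ with $\{wi,uj\}\in E_{k+1}$. (Here $G_k=T_k$.) Combinatorial intersection. For $u_1,u_2\in A^*$, $A^{\mathbb{N}}_{u_1}\wedge_{\mathscr{C}}A^{\mathbb{N}}_{u_2}$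 is the set of all $w$ such that either $w\in A^{\mathbb{N}}_{u_1}$ and for every $n>\max\{|u_1|,|u_2|\}$ there is $u\in A^n_{u_2}$ with $\{w(n),u\}\in E_n$, or $w\in A^{\mathbb{N}}_{u_2}$ and for every $n>\max\{|u_1|,|u_2|\}$ there is $u\in A^n_{u_1}$ with $\{w(n),u\}\in E_n$. A chain joining $w,w'\in A^{\mathbb{N}}$ is a finite sequence $A^{\mathbb{N}}_{w_1},\dots,A^{\mathbb{N}}_{w_n}$ with $w\in A^{\mathbb{N}}_{w_1}$, $w'\in A^{\mathbb{N}}_{w_n}$ and $A^{\mathbb{N}}_{w_i}\wedge_{\mathscr{C}}A^{\mathbb{N}}_{w_{i+1}}\ne\emptyset$ for all $i<n$. Diameter functions. For $0<\delta_1\le\delta_2\le1$, $\mathscr{D}(A,\delta_1,\delta_2)$ is the set of $\Delta:A^*\to[0,1]$ with $\Delta(\varepsilon)=1$, $\lim_{n\to\infty}\max\{\Delta(w):w\in A^n\}=0$, and for all $w\in A^*$, $i,j\in A$: $\Delta(wi)=\Delta(wj)$ and $\Delta(wi)/\Delta(w)\in\{\delta_1,\delta_2\}$. The space. $D_{\mathscr{C},\Delta}(w,u)=\inf\sum_i\Delta(v_i)$ over all chains $\{A^{\mathbb{N}}_{v_i}\}$ joining $w,u\in A^{\mathbb{N}}$. This is a pseudometric; $\mathcal{A}=A^{\mathbb{N}}/\!\sim$ where $w\sim w'$ iff $D_{\mathscr{C},\Delta}(w,w')=0$, and $d_{\mathscr{C},\Delta}([w],[v])=D_{\mathscr{C}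,\Delta}(w,v)$.
   Formalization: (P4) is claimed only if X has at least two points; for one-point X it fails, as all distances are 0 but Δ(u)>0. The bounds on M, K1 and the bi-Lipschitz constant are fixed per underlying set of points; real numbers as points suffice, since every metric tree has an isometric copy there. *)

theory Defs
  imports "HOL-Analysis.Analysis" "Graph_Theory.Digraph_Component"
begin

text \<open>A metric space is a carrier \<open>X\<close> with a distance function \<open>d\<close>, as in the locale
  \<^locale>\<open>Metric_space\<close>.\<close>

definition is_arc :: "'a topology \<Rightarrow> 'a \<Rightarrow> 'a \<Rightarrow> 'a set \<Rightarrow> bool" where
  "is_arc T x y S \<longleftrightarrow>
     (\<exists>g :: real \<Rightarrow> 'a. embedding_map (top_of_set {0..1}) T g \<and> g 0 = x \<and> g 1 = y \<and> S = g ` {0..1})"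

text \<open>Connected spaces are nonempty by convention, whereas \<^const>\<open>connected_space\<close> admits the empty
  space. One-point trees are allowed.\<close>

definition metric_tree :: "'a set \<Rightarrow> ('a \<Rightarrow> 'a \<Rightarrow> real) \<Rightarrow> bool" where
  "metric_tree X d \<longleftrightarrow>
     Metric_space X d \<and> X \<noteq> {} \<and>
     compact_space (Metric_space.mtopology X d) \<and>
     connected_space (Metric_space.mtopology X d) \<and>
     locally_connected_space (Metric_space.mtopology X d) \<and>
     (\<forall>x\<in>X. \<forall>y\<in>X. x \<noteq> y \<longrightarrow> (\<exists>!S. is_arc (Metric_space.mtopology X d) x y S))"

definition doubling :: "nat \<Rightarrow> 'a set \<Rightarrow> ('a \<Rightarrow> 'a \<Rightarrow> real) \<Rightarrow> bool" where
  "doubling N X d \<longleftrightarrow>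
     (\<forall>x\<in>X. \<forall>r>0. \<exists>F. finite F \<and> card F \<le> N \<and> F \<subseteq> X \<and>
        Metric_space.mball X d x r \<subseteq> (\<Union>y\<in>F. Metric_space.mball X d y (r / 2)))"

text \<open>The analogue of \<^const>\<open>diameter\<close> for an explicit distance function; like there, it is
  only meaningful for bounded sets.\<close>

definition diam_wrt :: "('a \<Rightarrow> 'a \<Rightarrow> real) \<Rightarrow> 'a set \<Rightarrow> real" where
  "diam_wrt d S = (if S = {} then 0 else (SUP (x, y)\<in>S \<times> S. d x y))"

definition bounded_turning :: "real \<Rightarrow> 'a set \<Rightarrow> ('a \<Rightarrow> 'a \<Rightarrow> real) \<Rightarrow> bool" where
  "bounded_turning C X d \<longleftrightarrow>
     (\<forall>x\<in>X. \<forall>y\<in>X. \<exists>K. x \<in> K \<and> y \<in> K \<and>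
        compactin (Metric_space.mtopology X d) K \<and>
        connectedin (Metric_space.mtopology X d) K \<and>
        diam_wrt d K \<le> C * d x y)"

definition bilipschitz_map ::
  "real \<Rightarrow> 'a set \<Rightarrow> ('a \<Rightarrow> 'a \<Rightarrow> real) \<Rightarrow> ('b \<Rightarrow> 'b \<Rightarrow> real) \<Rightarrow> ('a \<Rightarrow> 'b) \<Rightarrow> bool" where
  "bilipschitz_map L X d e f \<longleftrightarrow>
     1 \<le> L \<and> (\<forall>x\<in>X. \<forall>y\<in>X. inverse L * d x y \<le> e (f x) (f y) \<and> e (f x) (f y) \<le> L * d x y)"

definition bilipschitz_equivalent ::
  "real \<Rightarrow> 'a set \<Rightarrow> ('a \<Rightarrow> 'a \<Rightarrow> real) \<Rightarrow> 'b set \<Rightarrow> ('b \<Rightarrow> 'b \<Rightarrow> real) \<Rightarrow> bool" where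
  "bilipschitz_equivalent L X d Y e \<longleftrightarrow> (\<exists>f. f ` X = Y \<and> bilipschitz_map L X d e f)"

text \<open>The alphabet is \<open>{1, \<dots>, M}\<close>. Finite words are lists, infinite words are functions on \<^typ>\<open>nat\<close>; the letters of an
  infinite word \<open>w\<close> are \<open>w 0, w 1, \<dots>\<close>, so that its initial subword of length \<open>n\<close>
  is \<open>[w 0, \<dots>, w (n - 1)]\<close>.\<close>

abbreviation alphabet :: "nat \<Rightarrow> nat set" where
  "alphabet M \<equiv> {1..M}"

definition words :: "nat \<Rightarrow> nat \<Rightarrow> nat list set" where
  "words M k = {w \<in> lists (alphabet M). length w = k}"

definition inf_words :: "nat \<Rightarrow> (nat \<Rightarrow> nat) set" where
  "inf_words M = {w. \<forall>n. w n \<in> alphabet M}"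

definition initial :: "(nat \<Rightarrow> nat) \<Rightarrow> nat \<Rightarrow> nat list" where
  "initial w n = map w [0..<n]"

definition inf_words_from :: "nat \<Rightarrow> nat list \<Rightarrow> (nat \<Rightarrow> nat) set" where
  "inf_words_from M u = {w \<in> inf_words M. initial w (length u) = u}"

definition words_from :: "nat \<Rightarrow> nat list \<Rightarrow> nat \<Rightarrow> nat list set" where
  "words_from M u n = {w \<in> words M n. take (length u) w = u}"

text \<open>Simple graphs are given by \<^locale>\<open>pair_graph\<close>, i.e.\ finite, loop-free, symmetric
  pair digraphs: an edge \<open>{u, v}\<close> is the pair of arcs \<open>(u, v)\<close>, \<open>(v, u)\<close>.\<close>

definition combinatorial_tree :: "'v pair_pre_digraph \<Rightarrow> bool" where
  "combinatorial_tree G \<longleftrightarrow>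
     pair_graph G \<and>
     (\<forall>u\<in>pverts G. \<forall>v\<in>pverts G. u \<noteq> v \<longrightarrow> (\<exists>!p. pre_digraph.apath (with_proj G) u p v))"

definition combinatorial_data :: "nat \<Rightarrow> (nat \<Rightarrow> nat list pair_pre_digraph) \<Rightarrow> bool" where
  "combinatorial_data M G \<longleftrightarrow>
     2 \<le> M \<and>
     (\<forall>k. pair_graph (G k) \<and> pverts (G k) = words M k \<and>
        Digraph_Component.connected (with_proj (G k)) \<and>
        (\<forall>w\<in>words M k. Digraph_Component.connected
           (induce_subgraph (with_proj (G (Suc k))) {w @ [i] | i. i \<in> alphabet M})) \<and>
        (\<forall>w u. (w, u) \<in> parcs (G k) \<longrightarrow>
           (\<exists>i\<in>alphabet M. \<exists>j\<in>alphabet M. (w @ [i], u @ [j]) \<in> parcs (G (Suc k)))))"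

definition comb_inter ::
  "nat \<Rightarrow> (nat \<Rightarrow> nat list pair_pre_digraph) \<Rightarrow> nat list \<Rightarrow> nat list \<Rightarrow> (nat \<Rightarrow> nat) set" where
  "comb_inter M G u1 u2 =
     {w. (w \<in> inf_words_from M u1 \<and>
          (\<forall>n > max (length u1) (length u2). \<exists>u\<in>words_from M u2 n. (initial w n, u) \<in> parcs (G n)))
       \<or> (w \<in> inf_words_from M u2 \<and>
          (\<forall>n > max (length u1) (length u2). \<exists>u\<in>words_from M u1 n. (initial w n, u) \<in> parcs (G n)))}"

text \<open>A chain of cylinders is represented by the list of the words defining them.\<close>

definition chain_joining ::
  "nat \<Rightarrow> (nat \<Rightarrow> nat list pair_pre_digraph) \<Rightarrow> (nat \<Rightarrow> nat) \<Rightarrow> (nat \<Rightarrow> nat) \<Rightarrow> nat list list \<Rightarrow> bool" where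
  "chain_joining M G w w' vs \<longleftrightarrow>
     vs \<noteq> [] \<and> set vs \<subseteq> lists (alphabet M) \<and>
     w \<in> inf_words_from M (hd vs) \<and> w' \<in> inf_words_from M (last vs) \<and>
     (\<forall>i. Suc i < length vs \<longrightarrow> comb_inter M G (vs ! i) (vs ! Suc i) \<noteq> {})"

definition diameter_functions :: "nat \<Rightarrow> real \<Rightarrow> real \<Rightarrow> (nat list \<Rightarrow> real) set" where
  "diameter_functions M \<delta>1 \<delta>2 =
     {\<Delta>. 0 < \<delta>1 \<and> \<delta>1 \<le> \<delta>2 \<and> \<delta>2 \<le> 1 \<and>
         (\<forall>w\<in>lists (alphabet M). \<Delta> w \<in> {0..1}) \<and>
         \<Delta> [] = 1 \<and>
         (\<lambda>n. Max (\<Delta> ` words M n)) \<longlonglongrightarrow> 0 \<and>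
         (\<forall>w\<in>lists (alphabet M). \<forall>i\<in>alphabet M. \<forall>j\<in>alphabet M.
            \<Delta> (w @ [i]) = \<Delta> (w @ [j]) \<and> \<Delta> (w @ [i]) / \<Delta> w \<in> {\<delta>1, \<delta>2})}"

definition chain_pdist ::
  "nat \<Rightarrow> (nat \<Rightarrow> nat list pair_pre_digraph) \<Rightarrow> (nat list \<Rightarrow> real)
    \<Rightarrow> (nat \<Rightarrow> nat) \<Rightarrow> (nat \<Rightarrow> nat) \<Rightarrow> real" where
  "chain_pdist M G \<Delta> w u = (INF vs\<in>{vs. chain_joining M G w u vs}. \<Sum>v\<leftarrow>vs. \<Delta> v)"

definition chain_rel ::
  "nat \<Rightarrow> (nat \<Rightarrow> nat list pair_pre_digraph) \<Rightarrow> (nat list \<Rightarrow> real) \<Rightarrow> (nat \<Rightarrow> nat) rel" where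
  "chain_rel M G \<Delta> =
     {(w, w'). w \<in> inf_words M \<and> w' \<in> inf_words M \<and> chain_pdist M G \<Delta> w w' = 0}"

definition chain_class ::
  "nat \<Rightarrow> (nat \<Rightarrow> nat list pair_pre_digraph) \<Rightarrow> (nat list \<Rightarrow> real) \<Rightarrow> (nat \<Rightarrow> nat) \<Rightarrow> (nat \<Rightarrow> nat) set" where
  "chain_class M G \<Delta> w = chain_rel M G \<Delta> `` {w}"

definition chain_space ::
  "nat \<Rightarrow> (nat \<Rightarrow> nat list pair_pre_digraph) \<Rightarrow> (nat list \<Rightarrow> real) \<Rightarrow> (nat \<Rightarrow> nat) set set" where
  "chain_space M G \<Delta> = inf_words M // chain_rel M G \<Delta>"

text \<open>The common value of the pseudodistance on all pairs of representatives.\<close>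

definition chain_dist ::
  "nat \<Rightarrow> (nat \<Rightarrow> nat list pair_pre_digraph) \<Rightarrow> (nat list \<Rightarrow> real)
    \<Rightarrow> (nat \<Rightarrow> nat) set \<Rightarrow> (nat \<Rightarrow> nat) set \<Rightarrow> real" where
  "chain_dist M G \<Delta> P Q = (THE r. \<forall>w\<in>P. \<forall>v\<in>Q. chain_pdist M G \<Delta> w v = r)"

definition cond_P1 :: "nat \<Rightarrow> nat \<Rightarrow> bool" where
  "cond_P1 M N' \<longleftrightarrow> card (alphabet M) \<le> N'"

definition cond_P2 :: "(nat \<Rightarrow> nat list pair_pre_digraph) \<Rightarrow> nat \<Rightarrow> bool" where
  "cond_P2 G n0 \<longleftrightarrow> (\<forall>k. \<forall>v\<in>pverts (G k). card {u. (v, u) \<in> parcs (G k)} \<le> n0)"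

definition cond_P3 :: "nat \<Rightarrow> (nat list \<Rightarrow> real) \<Rightarrow> real \<Rightarrow> real \<Rightarrow> bool" where
  "cond_P3 M \<Delta> \<delta>1 \<delta>2 \<longleftrightarrow>
     (\<forall>w\<in>lists (alphabet M). \<forall>i\<in>alphabet M. \<delta>1 * \<Delta> w \<le> \<Delta> (w @ [i]) \<and> \<Delta> (w @ [i]) \<le> \<delta>2 * \<Delta> w)"

definition cond_P4 ::
  "nat \<Rightarrow> (nat \<Rightarrow> nat list pair_pre_digraph) \<Rightarrow> (nat list \<Rightarrow> real) \<Rightarrow> real \<Rightarrow> bool" where
  "cond_P4 M G \<Delta> c \<longleftrightarrow>
     (\<forall>k. \<forall>u\<in>words M k. \<forall>u1\<in>words M k. \<forall>u2\<in>words M k.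
        u \<noteq> u1 \<and> u \<noteq> u2 \<and> u1 \<noteq> u2 \<longrightarrow>
        (\<forall>w1\<in>comb_inter M G u u1. \<forall>w2\<in>comb_inter M G u u2.
           inverse c * \<Delta> u
             \<le> chain_dist M G \<Delta> (chain_class M G \<Delta> w1) (chain_class M G \<Delta> w2)))"

end

theory Submission
  imports Defs "HOL-Probability.Discrete_Topology"
begin

text \<open>Replace the distance by the diameter \<open>rho x y\<close> of the arc from \<open>x\<close> to \<open>y\<close>; bounded turning makes the
  two bi-Lipschitz. A subtree \<open>P\<close> is cut at a point \<open>z\<close> of an arc \<open>[x, y] \<subseteq> P\<close> into \<open>{z}\<close> together with the side of
  \<open>x\<close>, and the rest. Starting from \<open>X\<close>, a subtree of diameter \<open>t\<close> is cut \<open>M - 1\<close> times, each time through the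
  largest piece, near the middle of a long arc in it. All pieces stay comparable, so doubling forces their
  diameters below \<open>t / 4\<close> once \<open>M\<close> is large. Every cut point keeps a distance \<open>\<ge> \<beta> t / 4\<close>, \<open>\<beta> = \<beta>(M)\<close>, from the other
  cut points and from the older boundary points of the subtree, which were \<open>\<beta> t\<close>-separated. As the new pieces
  have diameter at most \<open>t / 4\<close>, this separation reproduces itself at all scales. In particular no cut point is ever
  used again, so at every level a point lies in at most two cells, two cells meet in at most one point, and
  the intersection graphs \<open>T k\<close> of the cells are trees. If two addresses separate at a word \<open>w\<close>, then either the arc
  between the points passes through two joints of the cell of \<open>w\<close>, or the two child cells share one joint \<open>p\<close>
  and, on each side, leaving the smallest cell that contains \<open>p\<close> and the point costs a proportional
  distance. This bounds the chain distance from above by \<open>rho\<close>; the other bound is the triangle inequality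
  along a chain.\<close>

text \<open>Three obstacles shape the proof. The number of branches varies from point to point, so
  deleting a point gives an uncontrolled number of pieces; the two-sided cut always gives two, which
  makes the alphabet size exact and puts each joint into just two pieces. A diameter function has
  only the ratios \<open>K1\<close> and \<open>K2\<close>, so it cannot equal the normalised cell
  diameters; a feedback rule keeps it within a factor \<open>1 / K1\<close> of them. Finally, a
  one-point tree has nothing to subdivide: the words of an interval are collapsed onto it by weights
  \<open>K1 ^ n\<close> with \<open>M * K1 < 1\<close>. Bounded turning supplies a continuum but no
  arc, so the bound on arc diameters needs that the arc lies in every continuum through its ends.
  This is proved with paths in a Banach space into which the tree is embedded isometrically. The
  constant \<open>sep_const M\<close> collects the losses of one subdivision: a factor
  \<open>8\<close> in diameter per cut, and a factor \<open>Suc M\<close> for avoiding earlier cut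
  points. Since \<open>K2 >= 1 / 2\<close>, the number \<open>1 / K1\<close> is at most
  \<open>2 * K2 / K1\<close>, so \<open>K1\<close> and \<open>K2\<close> enter the bi-Lipschitz
  constant through their ratio only.\<close>

hide_const (open) Digraph_Component.connected

section \<open>Trees given by their segments\<close>

text \<open>The absence of cycles is encoded in \<open>seg_triangle\<close>, and the linear
  structure of an arc in \<open>seg_split\<close>. There are two models: the arcs of an embedded
  metric tree, and the intervals of the real line, which serve the one-point case.\<close>

locale seg_tree =
  fixes X :: "'e::metric_space set" and seg :: "'e \<Rightarrow> 'e \<Rightarrow> 'e set" and C :: real
  assumes compact_X: "compact X" and X_nonempty: "X \<noteq> {}"
    and seg_subset: "\<lbrakk>x \<in> X; y \<in> X\<rbrakk> \<Longrightarrow> seg x y \<subseteq> X"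
    and seg_left: "\<lbrakk>x \<in> X; y \<in> X\<rbrakk> \<Longrightarrow> x \<in> seg x y"
    and seg_commute: "\<lbrakk>x \<in> X; y \<in> X\<rbrakk> \<Longrightarrow> seg x y = seg y x"
    and seg_refl: "x \<in> X \<Longrightarrow> seg x x = {x}"
    and seg_triangle: "\<lbrakk>x \<in> X; y \<in> X; z \<in> X\<rbrakk> \<Longrightarrow> seg x z \<subseteq> seg x y \<union> seg y z"
    and seg_split: "\<lbrakk>x \<in> X; y \<in> X; z \<in> seg x y\<rbrakk> \<Longrightarrow> seg x z \<inter> seg z y \<subseteq> {z}"
    and seg_mono: "\<lbrakk>x \<in> X; y \<in> X; u \<in> seg x y; v \<in> seg x y\<rbrakk> \<Longrightarrow> seg u v \<subseteq> seg x y"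
    and connected_seg: "\<lbrakk>x \<in> X; y \<in> X\<rbrakk> \<Longrightarrow> connected (seg x y)"
    and diameter_seg: "\<lbrakk>x \<in> X; y \<in> X\<rbrakk> \<Longrightarrow> diameter (seg x y) \<le> C * dist x y"
begin

definition rho :: "'e \<Rightarrow> 'e \<Rightarrow> real" where "rho x y = diameter (seg x y)"

abbreviation dm :: "'e set \<Rightarrow> real" where "dm \<equiv> diam_wrt rho"

text \<open>The subtrees that get cut are the closed nonempty sets of this kind.\<close>

definition cvx :: "'e set \<Rightarrow> bool" where
  "cvx S \<longleftrightarrow> S \<subseteq> X \<and> (\<forall>x\<in>S. \<forall>y\<in>S. seg x y \<subseteq> S)"

lemma seg_right: "\<lbrakk>x \<in> X; y \<in> X\<rbrakk> \<Longrightarrow> y \<in> seg x y"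
  using seg_left seg_commute by metis

lemma seg_mem: "\<lbrakk>z \<in> seg x y; x \<in> X; y \<in> X\<rbrakk> \<Longrightarrow> z \<in> X"
  using seg_subset by blast

lemma bounded_seg: "\<lbrakk>x \<in> X; y \<in> X\<rbrakk> \<Longrightarrow> bounded (seg x y)"
  using compact_X compact_imp_bounded bounded_subset seg_subset by metis

lemma rho_commute: "\<lbrakk>x \<in> X; y \<in> X\<rbrakk> \<Longrightarrow> rho x y = rho y x"
  unfolding rho_def using seg_commute by metis

lemma rho_refl: "x \<in> X \<Longrightarrow> rho x x = 0"
  unfolding rho_def by (simp add: seg_refl)

lemma dist_le_rho: "\<lbrakk>x \<in> X; y \<in> X\<rbrakk> \<Longrightarrow> dist x y \<le> rho x y"
  unfolding rho_def by (intro diameter_bounded_bound bounded_seg seg_left seg_right)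

lemma rho_le_dist: "\<lbrakk>x \<in> X; y \<in> X\<rbrakk> \<Longrightarrow> rho x y \<le> C * dist x y"
  unfolding rho_def by (rule diameter_seg)

lemma rho_nonneg: "\<lbrakk>x \<in> X; y \<in> X\<rbrakk> \<Longrightarrow> 0 \<le> rho x y"
  using dist_le_rho zero_le_dist order_trans by blast

lemma rho_pos: "\<lbrakk>x \<in> X; y \<in> X; x \<noteq> y\<rbrakk> \<Longrightarrow> 0 < rho x y"
  using dist_le_rho[of x y] zero_less_dist_iff[of x y] by linarith

lemma rho_eq0: "\<lbrakk>x \<in> X; y \<in> X; rho x y \<le> 0\<rbrakk> \<Longrightarrow> x = y"
  using rho_pos by fastforce

lemma rho_mono:
  assumes "x \<in> X" "y \<in> X" "u \<in> seg x y" "v \<in> seg x y"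
  shows "rho u v \<le> rho x y"
  unfolding rho_def using assms by (intro diameter_subset seg_mono bounded_seg)

text \<open>Two points of \<open>seg x z\<close> lie either on a common one of the segments
  \<open>seg x y\<close>, \<open>seg y z\<close>, or on different ones; in the second case the
  detour through \<open>y\<close> bounds their distance.\<close>

lemma rho_triangle:
  assumes [simp]: "x \<in> X" "y \<in> X" "z \<in> X"
  shows "rho x z \<le> rho x y + rho y z"
proof -
  have b: "dist u v \<le> rho a b" if "a \<in> X" "b \<in> X" "u \<in> seg a b" "v \<in> seg a b" for a b u v
    unfolding rho_def using that by (intro diameter_bounded_bound bounded_seg)
  have m: "dist u v \<le> rho x y + rho y z" if "u \<in> seg x y" "v \<in> seg y z" for u v
    using b[of x y u y] b[of y z y v] that seg_left[of y z] seg_right[of x y]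
      dist_triangle[of u v y] by auto
  have "dist u v \<le> rho x y + rho y z" if "u \<in> seg x z" "v \<in> seg x z" for u v
  proof -
    have "u \<in> seg x y \<union> seg y z" "v \<in> seg x y \<union> seg y z"
      using that seg_triangle[of x y z] by auto
    then show ?thesis
      using m[of u v] m[of v u] b[of x y u v] b[of y z u v] rho_nonneg[of x y] rho_nonneg[of y z]
      by (auto simp: dist_commute)
  qed
  then show ?thesis unfolding rho_def[of x z]
    using seg_left[of x z] by (auto simp: diameter_def intro!: cSUP_least)
qed

lemma C_ge_1: "x \<in> X \<Longrightarrow> y \<in> X \<Longrightarrow> x \<noteq> y \<Longrightarrow> 1 \<le> C"
  using dist_le_rho[of x y] rho_le_dist[of x y]
  by (smt (verit) mult_le_cancel_right1 zero_less_dist_iff)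

lemma rho_bounded: "\<exists>b. \<forall>x\<in>X. \<forall>y\<in>X. rho x y \<le> b"
proof -
  have "rho x y \<le> diameter X" if "x \<in> X" "y \<in> X" for x y
    unfolding rho_def using that
    by (intro diameter_subset seg_subset compact_imp_bounded compact_X)
  then show ?thesis by blast
qed

lemma rho_le_dm: "\<lbrakk>S \<subseteq> X; x \<in> S; y \<in> S\<rbrakk> \<Longrightarrow> rho x y \<le> dm S"
proof -
  assume a: "S \<subseteq> X" "x \<in> S" "y \<in> S"
  obtain b where b: "\<forall>x\<in>X. \<forall>y\<in>X. rho x y \<le> b" using rho_bounded by blast
  have "bdd_above ((\<lambda>(x,y). rho x y) ` (S \<times> S))"
    by (rule bdd_aboveI[of _ b]) (use a b in auto)
  then have "(\<lambda>(x,y). rho x y) (x,y) \<le> (SUP (x, y)\<in>S \<times> S. rho x y)"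
    by (intro cSUP_upper) (use a in auto)
  then show ?thesis unfolding diam_wrt_def using a by auto
qed

lemma dm_le: "\<lbrakk>S \<noteq> {}; \<And>x y. x \<in> S \<Longrightarrow> y \<in> S \<Longrightarrow> rho x y \<le> c\<rbrakk> \<Longrightarrow> dm S \<le> c"
  unfolding diam_wrt_def by (auto intro!: cSUP_least)

lemma dm_mono: "\<lbrakk>S \<subseteq> T; T \<subseteq> X; S \<noteq> {}\<rbrakk> \<Longrightarrow> dm S \<le> dm T"
  by (rule dm_le) (auto intro!: rho_le_dm)

lemma dm_nonneg: "S \<subseteq> X \<Longrightarrow> 0 \<le> dm S"
proof (cases "S = {}")
  case False
  assume "S \<subseteq> X"
  with False obtain x where "x \<in> S" "x \<in> X" by blast
  with rho_le_dm[of S x x] \<open>S \<subseteq> X\<close> show ?thesis by (simp add: rho_refl)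
qed (simp add: diam_wrt_def)

lemma dm_attained:
  assumes "S \<noteq> {}" "c < dm S"
  obtains x y where "x \<in> S" "y \<in> S" "c < rho x y"
  using assms dm_le[of S c] by (meson not_less)

lemma continuous_rho: "x \<in> X \<Longrightarrow> continuous_on X (rho x)"
proof -
  assume x: "x \<in> X"
  have *: "dist (rho x u) (rho x v) \<le> \<bar>C\<bar> * dist u v" if "u \<in> X" "v \<in> X" for u v
  proof -
    have "rho u v \<le> \<bar>C\<bar> * dist u v"
      using rho_le_dist[OF that] by (smt (verit) mult_right_mono zero_le_dist)
    then show ?thesis
      using rho_triangle[of x u v] rho_triangle[of x v u] rho_commute[of u v] x that
      by (auto simp: dist_real_def)
  qed
  have "\<bar>C\<bar>-lipschitz_on X (rho x)" by (rule lipschitz_onI) (use * in auto)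
  then show ?thesis by (rule lipschitz_on_continuous_on)
qed

text \<open>The intermediate value theorem on a connected segment. Along it \<open>rho x\<close> may
  be constant on a stretch, so the point is not unique.\<close>

lemma seg_at_rho:
  assumes "x \<in> X" "y \<in> X" "0 \<le> t" "t \<le> rho x y"
  obtains z where "z \<in> seg x y" "rho x z = t"
proof -
  have "connected (rho x ` seg x y)"
    using continuous_on_subset[OF continuous_rho seg_subset] connected_seg assms
    by (intro connected_continuous_image) auto
  moreover have "0 \<in> rho x ` seg x y" using seg_left[of x y] rho_refl[of x] assms by force
  moreover have "rho x y \<in> rho x ` seg x y" using seg_right[of x y] assms by force
  ultimately have "t \<in> rho x ` seg x y"
    by (rule connectedD_interval) (use assms in auto)
  with that show ?thesis by auto
qed

text \<open>This is the linear order of a segment. If \<open>z\<close> were missing from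
  \<open>seg x w\<close>, it would have to lie on \<open>seg w y\<close>, and also on
  \<open>seg z w\<close>; these two meet only in \<open>w\<close>, which forces
  \<open>z = w\<close>.\<close>

lemma seg_prefix:
  assumes "x \<in> X" "y \<in> X" "z \<in> seg x y" "w \<in> seg z y"
  shows "z \<in> seg x w"
proof (rule ccontr)
  assume n: "z \<notin> seg x w"
  have X: "z \<in> X" "w \<in> X" using assms seg_mem by metis+
  have "w \<in> seg x y" using assms seg_mono[of x y z y] seg_right by blast
  then have "seg x w \<inter> seg w y \<subseteq> {w}" using seg_split assms by blast
  have "z \<in> seg w y" using n assms X seg_triangle[of x w y] by blast
  moreover have "seg z w \<inter> seg w y \<subseteq> {w}" using seg_split[of z y w] assms X by blast
  ultimately have "z = w" using seg_left[of z w] X by blast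
  then show False using n seg_right[of x w] assms X by auto
qed

lemma cvx_X: "cvx X" unfolding cvx_def using seg_subset by auto

lemma cvx_connected: assumes "cvx S" shows "connected S"
proof (cases "S = {}")
  case False
  then obtain x where x: "x \<in> S" by auto
  have X: "S \<subseteq> X" using assms by (auto simp: cvx_def)
  have e: "S = \<Union>(seg x ` S)"
    using assms x X seg_right unfolding cvx_def by blast
  have "connected (\<Union>(seg x ` S))"
    by (rule connected_Union) (use X x connected_seg seg_left in blast)+
  then show ?thesis using e by simp
qed auto

text \<open>Along the connected segment, \<open>P i\<close> and the union of the other members are
  closed, both are visited, and together they cover it; so they cannot be disjoint there. This
  produces the joints through which segments leave cells.\<close>

lemma seg_crossing:
  assumes "finite I" "\<And>i. i \<in> I \<Longrightarrow> closed (P i)" "seg x y \<subseteq> (\<Union>i\<in>I. P i)"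
    "x \<in> X" "y \<in> X" "i \<in> I" "x \<in> P i" "y \<notin> P i"
  obtains j q where "j \<in> I" "j \<noteq> i" "q \<in> seg x y" "q \<in> P i" "q \<in> P j"
proof -
  let ?B = "\<Union>j\<in>I-{i}. P j"
  have cl: "closed (P i)" "closed ?B" using assms by auto
  have cov: "seg x y \<subseteq> P i \<union> ?B" using assms by auto
  have y: "y \<in> ?B \<inter> seg x y" using cov seg_right[of x y] assms by blast
  have x: "x \<in> P i \<inter> seg x y" using seg_left[of x y] assms by blast
  have "P i \<inter> ?B \<inter> seg x y \<noteq> {}"
    using connected_seg[of x y] assms(4,5) cl cov x y unfolding connected_closed by blast
  then show ?thesis using that by blast
qed

text \<open>The detour over \<open>p\<close> shows that the segment is covered by the two closed
  sets. Having one end in each, it must visit their only common point.\<close>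

lemma cvx_meet_seg:
  assumes "cvx P" "cvx R" "closed P" "closed R" "P \<inter> R = {p}" "a \<in> P" "b \<in> R"
  shows "p \<in> seg a b"
proof -
  have X: "a \<in> X" "b \<in> X" "p \<in> X" using assms unfolding cvx_def by auto
  have sub: "seg a b \<subseteq> P \<union> R"
  proof -
    have "seg a p \<subseteq> P" "seg p b \<subseteq> R" using assms unfolding cvx_def by blast+
    then show ?thesis using seg_triangle[OF X(1,3,2)] by blast
  qed
  have "P \<inter> seg a b \<noteq> {}" "R \<inter> seg a b \<noteq> {}"
    using assms seg_left seg_right X by blast+
  then have "P \<inter> R \<inter> seg a b \<noteq> {}"
    using connected_seg[OF X(1,2)] assms(3,4) sub unfolding connected_closed by blast
  with assms(5) show ?thesis by auto
qed

section \<open>Splitting a subtree in two at one point\<close>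

definition near_part :: "'e set \<Rightarrow> 'e \<Rightarrow> 'e \<Rightarrow> 'e set" where
  "near_part P x z = {v \<in> P. v = z \<or> z \<notin> seg x v}"

text \<open>All branches at \<open>z\<close> that do not lead to \<open>x\<close> are kept together,
  however many there are. Both parts contain \<open>z\<close>, so that both are closed.\<close>

definition far_part :: "'e set \<Rightarrow> 'e \<Rightarrow> 'e \<Rightarrow> 'e set" where
  "far_part P x z = {v \<in> P. z \<in> seg x v}"

context
  fixes P x z
  assumes P: "cvx P" "closed P" and x: "x \<in> P" and z: "z \<in> P"
begin

lemma parts_X: "x \<in> X" "z \<in> X" "\<And>v. v \<in> P \<Longrightarrow> v \<in> X"
  using P x z unfolding cvx_def by auto

lemma near_Un_far: "near_part P x z \<union> far_part P x z = P"
  unfolding near_part_def far_part_def by auto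

lemma near_Int_far: "near_part P x z \<inter> far_part P x z = {z}"
  unfolding near_part_def far_part_def using z seg_right parts_X by auto

text \<open>The way from \<open>x\<close> to \<open>u\<close> stays within the way to
  \<open>v\<close> followed by the way from \<open>v\<close> to \<open>u\<close>, so a point missed
  by the former is met by the latter. Closedness and convexity of both parts reduce to this.\<close>

lemma seg_switch:
  assumes "u \<in> P" "v \<in> P" "z \<in> seg x u" "z \<notin> seg x v"
  shows "z \<in> seg v u"
  using assms seg_triangle[of x v u] parts_X by blast

text \<open>Here bounded turning enters: \<open>rho v z\<close> is at most
  \<open>rho v (f n)\<close>, hence at most \<open>C * dist v (f n)\<close>, which tends to
  \<open>0\<close>.\<close>

lemma limit_eq:
  assumes "\<And>n. f n \<in> P" "v \<in> P" "f \<longlonglongrightarrow> v" "\<And>n. z \<in> seg v (f n)"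
  shows "v = z"
proof -
  have X: "v \<in> X" "\<And>n. f n \<in> X" using assms parts_X by auto
  have *: "rho v z \<le> C * dist v (f n)" for n
    using rho_mono[of v "f n" v z] rho_le_dist[of v "f n"] seg_left assms X by fastforce
  have "(\<lambda>n. C * dist v (f n)) \<longlonglongrightarrow> C * dist v v"
    using assms(3) by (intro tendsto_intros)
  then have "rho v z \<le> C * dist v v" by (rule LIMSEQ_le_const) (use * in auto)
  then show ?thesis using rho_eq0 X parts_X by simp
qed

lemma closed_far: "closed (far_part P x z)"
  unfolding closed_sequential_limits
proof (intro allI impI)
  fix f v assume a: "(\<forall>n. f n \<in> far_part P x z) \<and> f \<longlonglongrightarrow> v"
  then have v: "v \<in> P" using P(2) unfolding closed_sequential_limits far_part_def by blast
  have "z \<in> seg x v"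
  proof (rule ccontr)
    assume n: "z \<notin> seg x v"
    have "v = z" using a v n seg_switch by (intro limit_eq[of f]) (auto simp: far_part_def)
    then show False using n seg_right parts_X by auto
  qed
  then show "v \<in> far_part P x z" using v by (simp add: far_part_def)
qed

lemma closed_near: "closed (near_part P x z)"
  unfolding closed_sequential_limits
proof (intro allI impI)
  fix f v assume a: "(\<forall>n. f n \<in> near_part P x z) \<and> f \<longlonglongrightarrow> v"
  then have v: "v \<in> P" using P(2) unfolding closed_sequential_limits near_part_def by blast
  have "v = z" if n: "z \<in> seg x v"
  proof (rule limit_eq[of f])
    fix n
    have f: "f n \<in> P" "f n = z \<or> z \<notin> seg x (f n)" using a by (auto simp: near_part_def)
    have "z \<in> seg (f n) v"
      using f(2) seg_switch[OF v f(1) n] seg_left[of z v] parts_X v by auto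
    then show "z \<in> seg v (f n)" using seg_commute f v parts_X by metis
  qed (use a v in \<open>auto simp: near_part_def\<close>)
  then show "v \<in> near_part P x z" using v by (auto simp: near_part_def)
qed

text \<open>A violation at \<open>w\<close> would place \<open>z\<close> on both halves into which
  \<open>w\<close> splits \<open>seg u v\<close>, and these meet only in \<open>w\<close>. The near
  part is convex for the same reason.\<close>

lemma cvx_far: "cvx (far_part P x z)"
  unfolding cvx_def
proof (intro conjI ballI subsetI)
  fix u v w assume a: "u \<in> far_part P x z" "v \<in> far_part P x z" "w \<in> seg u v"
  then have uv: "u \<in> P" "v \<in> P" "z \<in> seg x u" "z \<in> seg x v" by (auto simp: far_part_def)
  then have w: "w \<in> P" using P a unfolding cvx_def by blast
  have "z \<in> seg x w"
  proof (rule ccontr)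
    assume n: "z \<notin> seg x w"
    have "z \<in> seg w u" "z \<in> seg w v" using seg_switch uv w n by auto
    then have "z = w" using seg_split[OF _ _ a(3)] uv w parts_X seg_commute by blast
    then show False using n seg_right parts_X w by auto
  qed
  then show "w \<in> far_part P x z" using w by (auto simp: far_part_def)
qed (use parts_X in \<open>auto simp: far_part_def\<close>)

lemma cvx_near: "cvx (near_part P x z)"
  unfolding cvx_def
proof (intro conjI ballI subsetI)
  fix u v w assume a: "u \<in> near_part P x z" "v \<in> near_part P x z" "w \<in> seg u v"
  then have uv: "u \<in> P" "v \<in> P" "u = z \<or> z \<notin> seg x u" "v = z \<or> z \<notin> seg x v"
    by (auto simp: near_part_def)
  then have w: "w \<in> P" using P a unfolding cvx_def by blast
  have "w = z" if n: "z \<in> seg x w"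
  proof -
    have "z \<in> seg u w" "z \<in> seg v w"
      using uv seg_switch[OF w uv(1) n] seg_switch[OF w uv(2) n] seg_left w parts_X by blast+
    then show "w = z" using seg_split[OF _ _ a(3)] uv w parts_X seg_commute by blast
  qed
  then show "w \<in> near_part P x z" using w by (auto simp: near_part_def)
qed (use parts_X in \<open>auto simp: near_part_def\<close>)

end

subsection \<open>Cutting a subtree into pieces\<close>

definition separated :: "real \<Rightarrow> 'e set \<Rightarrow> bool" where
  "separated s A \<longleftrightarrow> (\<forall>p\<in>A. \<forall>q\<in>A. p \<noteq> q \<longrightarrow> s \<le> rho p q)"

lemma separatedD: "\<lbrakk>separated s A; p \<in> A; q \<in> A; p \<noteq> q\<rbrakk> \<Longrightarrow> s \<le> rho p q"
  unfolding separated_def by blast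

lemma separated_subset: "\<lbrakk>separated s A; B \<subseteq> A; r \<le> s\<rbrakk> \<Longrightarrow> separated r B"
  unfolding separated_def by (meson order_trans subsetD)

lemma separated_insert:
  assumes "separated s A" "z \<in> X" "A \<subseteq> X" "\<And>q. q \<in> A \<Longrightarrow> s \<le> rho z q"
  shows "separated s (insert z A)"
  using assms rho_commute[of z] unfolding separated_def by (metis insert_iff subsetD)

text \<open>Pigeonhole: along the segment there are \<open>m + 1\<close> candidates whose
  \<open>rho\<close>-distances from \<open>x\<close> increase in steps of \<open>h\<close>. A point
  of \<open>Q\<close> comes within \<open>h / 2\<close> of at most one of them.\<close>

lemma spread_point:
  assumes xy: "x \<in> X" "y \<in> X" and Q: "finite Q" "card Q \<le> m" "Q \<subseteq> X"
    and a: "0 \<le> a" "0 < h" "a + real m * h \<le> rho x y"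
  obtains z where "z \<in> seg x y" "a \<le> rho x z" "rho x z \<le> a + real m * h"
    "\<And>q. q \<in> Q \<Longrightarrow> h / 2 \<le> rho z q"
proof -
  have "\<exists>z. z \<in> seg x y \<and> rho x z = a + real k * h" if "k \<le> m" for k
  proof -
    have "real k * h \<le> real m * h" using that a by (intro mult_right_mono) auto
    then have "0 \<le> a + real k * h" "a + real k * h \<le> rho x y" using a by (simp, linarith)
    then show ?thesis using seg_at_rho[OF xy] by blast
  qed
  then obtain zz where zz: "\<And>k. k \<le> m \<Longrightarrow> zz k \<in> seg x y \<and> rho x (zz k) = a + real k * h"
    by metis
  have zX: "zz k \<in> X" if "k \<le> m" for k using zz[OF that] seg_mem xy by blast
  have "\<exists>k\<le>m. \<forall>q\<in>Q. h / 2 \<le> rho (zz k) q"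
  proof (rule ccontr)
    assume "\<not> ?thesis"
    then obtain g where g: "\<And>k. k \<le> m \<Longrightarrow> g k \<in> Q \<and> rho (zz k) (g k) < h / 2"
      by (metis not_less)
    have "inj_on g {..m}"
    proof (rule linorder_inj_onI)
      fix k l :: nat assume kl: "k < l" "k \<in> {..m}" "l \<in> {..m}"
      show "g k \<noteq> g l"
      proof
        assume e: "g k = g l"
        have "g k \<in> X" using g[of k] kl Q by auto
        then have "rho (zz k) (zz l) < h"
          using g[of k] g[of l] e rho_triangle[of "zz k" "g k" "zz l"] rho_commute[of "zz l" "g k"]
            zX kl by auto
        moreover have "rho x (zz l) \<le> rho x (zz k) + rho (zz k) (zz l)"
          using rho_triangle zX xy kl by auto
        moreover have "real k * h + h \<le> real l * h"
          using kl a(2) by (metis Suc_leI add.commute distrib_right mult_1 mult_right_mono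
            of_nat_Suc of_nat_le_iff order_less_imp_le)
        ultimately show False using zz[of k] zz[of l] kl by auto
      qed
    qed auto
    then have "card {..m} \<le> card Q" using g Q(1) by (intro card_inj_on_le) auto
    then show False using Q by simp
  qed
  then obtain k where k: "k \<le> m" "\<And>q. q \<in> Q \<Longrightarrow> h / 2 \<le> rho (zz k) q" by blast
  have "real k * h \<le> real m * h" using k a by (intro mult_right_mono) auto
  then show ?thesis using that[of "zz k"] k zz[OF k(1)] a by auto
qed

text \<open>The cut points \<open>Q\<close> of the current subdivision are few and are avoided by
  pigeonhole. The older boundary \<open>B\<close> is not counted but \<open>4 * s\<close>-separated,
  so at most one of its points is within \<open>s\<close> of the candidate, and a shift by
  \<open>2 * s\<close> along the arc escapes it.\<close>

lemma cut_point:
  assumes P: "cvx P" and Q: "finite Q" "card Q \<le> m" "Q \<subseteq> X"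
    and B: "B \<subseteq> X" "separated (4 * s) B"
    and s: "0 < s" "48 * s * real (Suc m) \<le> dm P"
  obtains x y z where "x \<in> P" "y \<in> P" "z \<in> seg x y" "dm P / 8 \<le> rho x z" "dm P / 8 \<le> rho z y"
    "\<And>q. q \<in> Q \<union> B \<Longrightarrow> s \<le> rho z q"
proof -
  \<comment> \<open>The hypothesis gives \<open>h >= 6 * s\<close>, so the candidate is
    \<open>3 * s\<close> away from \<open>Q\<close> and can afford a shift by \<open>2 * s\<close>.
    As \<open>m * h <= T / 8\<close>, it also lies at most \<open>T / 4\<close> from
    \<open>x\<close>, on an arc longer than \<open>T / 2\<close>.\<close>
  define T h where "T = dm P" and "h = T / (8 * real (Suc m))"
  have sT: "48 * s \<le> T"
    using s by (simp add: T_def algebra_simps) (smt (verit) mult_nonneg_nonneg of_nat_0_le_iff)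
  have T: "0 < T" using sT s by auto
  have h: "0 < h" "6 * s \<le> h" "real m * h \<le> T / 8"
    using T s(2) by (auto simp: h_def T_def field_simps)
  have PX: "P \<subseteq> X" using P by (simp add: cvx_def)
  have "P \<noteq> {}" using T by (auto simp: T_def diam_wrt_def)
  then obtain x y where xy: "x \<in> P" "y \<in> P" "T / 2 < rho x y"
    using dm_attained[of P "T / 2"] T by (auto simp: T_def)
  then have X: "x \<in> X" "y \<in> X" using PX by auto
  obtain z where z: "z \<in> seg x y" "T / 8 \<le> rho x z" "rho x z \<le> T / 8 + real m * h"
    "\<And>q. q \<in> Q \<Longrightarrow> h / 2 \<le> rho z q"
    using spread_point[OF X Q, of "T/8" h] h T xy(3) by auto
  have zX: "z \<in> X" using z(1) X seg_mem by blast
  have zy: "T / 4 \<le> rho z y" using rho_triangle[OF X(1) zX X(2)] z(3) h(3) xy(3) by linarith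
  show ?thesis
  proof (cases "\<forall>b\<in>B. s \<le> rho z b")
    case True
    then show ?thesis
      using that[of x y z] xy z zy h s T unfolding T_def by fastforce
  next
    case False
    \<comment> \<open>After the shift from \<open>z\<close> to \<open>w\<close> the point
      \<open>b\<close> is at least \<open>2 * s - s\<close> away, and any other point of
      \<open>B\<close> at least \<open>4 * s - s - 2 * s\<close>. Shifting towards \<open>y\<close>
      keeps the distance from \<open>x\<close>, and \<open>2 * s <= T / 24\<close> leaves more than
      \<open>T / 8\<close> towards \<open>y\<close>.\<close>
    then obtain b where b: "b \<in> B" "rho z b < s" by auto
    obtain w where w: "w \<in> seg z y" "rho z w = 2 * s"
      using seg_at_rho[OF zX X(2), of "2 * s"] s zy sT by auto
    have wX: "w \<in> X" using w(1) zX X seg_mem by blast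
    have wxy: "w \<in> seg x y" using seg_mono[OF X z(1), of y] seg_right[OF X] w(1) by blast
    have "z \<in> seg x w" using seg_prefix[OF X z(1) w(1)] .
    then have xw: "rho x z \<le> rho x w" using seg_left X wX by (intro rho_mono) auto
    have wy: "T / 8 \<le> rho w y" using rho_triangle[OF zX wX X(2)] w(2) zy sT s(1) by linarith
    have "s \<le> rho w q" if q: "q \<in> Q \<union> B" for q
    proof -
      have qX: "q \<in> X" using q Q B by auto
      have t1: "rho z q \<le> rho z w + rho w q" using rho_triangle[OF zX wX qX] .
      consider "q \<in> Q" | "q = b" | "q \<in> B" "q \<noteq> b" using q by auto
      then show ?thesis
      proof cases
        case 1 then show ?thesis using z(4)[of q] t1 w h by linarith
      next
        case 2
        have "rho z w \<le> rho z q + rho q w" using rho_triangle[OF zX qX wX] .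
        then show ?thesis using b(2)[folded 2] w(2) rho_commute[OF qX wX] by linarith
      next
        case 3
        have bX: "b \<in> X" using b B by auto
        have "4 * s \<le> rho b q" using separatedD[OF B(2) b(1) 3(1)] 3(2) by auto
        moreover have "rho b q \<le> rho b z + rho z q" using rho_triangle[OF bX zX qX] .
        ultimately show ?thesis using b(2) rho_commute[OF bX zX] t1 w by linarith
      qed
    qed
    then show ?thesis using that[of x y w] xy wxy xw wy z unfolding T_def by fastforce
  qed
qed

text \<open>The invariant after \<open>m\<close> cuts of \<open>S\<close>, with \<open>m + 1\<close>
  pieces and the cut points collected in \<open>Q\<close>. The separation \<open>s\<close> stays
  fixed during the whole subdivision, while diameters may lose a factor \<open>8\<close> with every
  cut.\<close>

definition stage :: "'e set \<Rightarrow> 'e set \<Rightarrow> real \<Rightarrow> nat \<Rightarrow> (nat \<Rightarrow> 'e set) \<Rightarrow> 'e set \<Rightarrow> bool" where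
  "stage S B s m P Q \<longleftrightarrow>
     (\<forall>i\<le>m. closed (P i) \<and> cvx (P i) \<and> P i \<noteq> {}) \<and> (\<Union>i\<le>m. P i) = S \<and>
     (\<forall>i\<le>m. \<forall>j\<le>m. i \<noteq> j \<longrightarrow> P i \<inter> P j \<subseteq> Q \<and> (\<exists>z. P i \<inter> P j \<subseteq> {z})) \<and>
     (\<forall>i\<le>m. \<forall>j\<le>m. \<forall>k\<le>m. i \<noteq> j \<longrightarrow> j \<noteq> k \<longrightarrow> i \<noteq> k \<longrightarrow> P i \<inter> P j \<inter> P k = {}) \<and>
     finite Q \<and> card Q \<le> m \<and> Q \<subseteq> S \<and> Q \<inter> B = {} \<and> separated s (Q \<union> B) \<and>
     (\<forall>i\<le>m. \<forall>j\<le>m. dm (P i) \<le> 8 * dm (P j)) \<and> (\<forall>i\<le>m. dm S / 8 ^ m \<le> dm (P i))"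

lemma stage_0:
  assumes "closed S" "cvx S" "S \<noteq> {}" "separated (4 * s) B" "0 < s"
  shows "stage S B s 0 (\<lambda>_. S) {}"
  using assms separated_subset[of "4 * s" B B s] dm_nonneg[of S]
  unfolding stage_def cvx_def by auto

text \<open>Always cutting a largest piece, of diameter \<open>T\<close>, preserves the ratio
  \<open>8\<close>: no piece exceeds \<open>T\<close>, both new parts contain a segment of diameter
  at least \<open>T / 8\<close>, and the remaining pieces were already that large.\<close>

lemma stage_Suc:
  assumes st: "stage S B s m P Q" and S: "S \<subseteq> X" and B: "B \<subseteq> S" "separated (4 * s) B"
    and s: "0 < s" "48 * s * real (Suc m) \<le> dm S / 8 ^ m"
  shows "\<exists>P' Q'. stage S B s (Suc m) P' Q'"
proof -
  note st' = st[unfolded stage_def]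
  have Pi: "closed (P i)" "cvx (P i)" "P i \<noteq> {}" "P i \<subseteq> S" "dm S / 8 ^ m \<le> dm (P i)" if "i \<le> m" for i
    using st' that by auto
  have mQ: "P i \<inter> P k \<subseteq> Q" and m1: "\<exists>z. P i \<inter> P k \<subseteq> {z}"
    if "i \<le> m" "k \<le> m" "i \<noteq> k" for i k
    using st' that by auto
  have m3: "P i \<inter> P k \<inter> P l = {}"
    if "i \<le> m" "k \<le> m" "l \<le> m" "i \<noteq> k" "k \<noteq> l" "i \<noteq> l" for i k l
  proof -
    have "\<forall>i\<le>m. \<forall>j\<le>m. \<forall>k\<le>m. i \<noteq> j \<longrightarrow> j \<noteq> k \<longrightarrow> i \<noteq> k \<longrightarrow> P i \<inter> P j \<inter> P k = {}"
      using st' by (elim conjE)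
    then show ?thesis using that by simp
  qed
  have dm8: "dm (P i) \<le> 8 * dm (P k)" if "i \<le> m" "k \<le> m" for i k
    using st' that by simp
  have US: "(\<Union>i\<le>m. P i) = S" using st' by simp
  have QS: "finite Q" "card Q \<le> m" "Q \<subseteq> S" "Q \<inter> B = {}" "separated s (Q \<union> B)"
    using st' by auto
  have "Max ((\<lambda>i. dm (P i)) ` {..m}) \<in> (\<lambda>i. dm (P i)) ` {..m}" by (rule Max_in) auto
  then obtain j where j: "j \<le> m" "dm (P j) = Max ((\<lambda>i. dm (P i)) ` {..m})"
    by (metis (no_types, lifting) atMost_iff imageE)
  have jmax: "dm (P i) \<le> dm (P j)" if "i \<le> m" for i using that j(2) by simp
  define T where "T = dm (P j)"
  have T: "dm S / 8 ^ m \<le> T" using Pi(5)[OF j(1)] by (simp add: T_def)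
  have QX: "Q \<subseteq> X" and BX: "B \<subseteq> X" using QS S B by auto
  have sP: "48 * s * real (Suc m) \<le> dm (P j)" using T s unfolding T_def by linarith
  obtain x y z where xyz: "x \<in> P j" "y \<in> P j" "z \<in> seg x y" "T / 8 \<le> rho x z" "T / 8 \<le> rho z y"
    and zs: "\<And>q. q \<in> Q \<union> B \<Longrightarrow> s \<le> rho z q"
    using cut_point[OF Pi(2)[OF j(1)] QS(1,2) QX BX B(2) s(1) sP] unfolding T_def by blast
  have PX: "P j \<subseteq> X" using Pi[OF j(1)] by (simp add: cvx_def)
  have zP: "z \<in> P j" using xyz Pi(2)[OF j(1)] unfolding cvx_def by blast
  have T0: "0 < T"
  proof -
    have "0 < 48 * s * real (Suc m)" using s(1) by simp
    then show ?thesis using sP unfolding T_def by linarith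
  qed
  have zQB: "z \<notin> Q \<union> B"
    using zs[of z] rho_refl[of z] s(1) zP PX by auto
  define A where "A = near_part (P j) x z"
  define F where "F = far_part (P j) x z"
  note pj = Pi(2)[OF j(1)] Pi(1)[OF j(1)] xyz(1) zP
  have AF: "A \<union> F = P j" "A \<inter> F = {z}" "closed A" "closed F" "cvx A" "cvx F"
    unfolding A_def F_def
    using near_Un_far[OF pj] near_Int_far[OF pj] closed_near[OF pj] closed_far[OF pj]
      cvx_near[OF pj] cvx_far[OF pj] by auto
  have xA: "x \<in> A" unfolding A_def near_part_def
    using xyz PX T0 seg_refl[of x] rho_refl[of x] by auto
  have yF: "y \<in> F" unfolding F_def far_part_def using xyz by auto
  have zAF: "z \<in> A" "z \<in> F" using AF by auto
  have SX: "A \<subseteq> X" "F \<subseteq> X" using AF PX by auto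
  have dA: "T / 8 \<le> dm A" using rho_le_dm[OF SX(1) xA zAF(1)] xyz(4) by linarith
  have dF: "T / 8 \<le> dm F" using rho_le_dm[OF SX(2) zAF(2) yF] xyz(5) by linarith
  define P' where "P' = P(j := A, Suc m := F)"
  \<comment> \<open>The piece from which the \<open>i\<close>-th new piece comes. Only the two parts
    of \<open>P j\<close> share a parent, so every intersection property either descends from the
    parents or concerns the single point \<open>z\<close>.\<close>
  define par where "par i = (if i = Suc m then j else i)" for i
  have P'1: "P' j = A" "P' (Suc m) = F" "\<And>i. i \<noteq> j \<Longrightarrow> i \<noteq> Suc m \<Longrightarrow> P' i = P i"
    using j(1) by (auto simp: P'_def)
  have par: "par i \<le> m" "P' i \<subseteq> P (par i)" if "i \<le> Suc m" for i
    using that j(1) AF(1) by (auto simp: P'_def par_def)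
  have pair: "i = j \<and> k = Suc m \<or> i = Suc m \<and> k = j" if "i \<noteq> k" "par i = par k" for i k
    using that unfolding par_def by metis
  have meet: "P' i \<inter> P' k = {z}" if "i \<noteq> k" "par i = par k" for i k
    using pair[OF that] AF(2) P'1(1,2) by (metis Int_commute)
  have parj: "par i = j" if "i \<noteq> k" "par i = par k" for i k
    using pair[OF that] unfolding par_def by auto
  \<comment> \<open>The new cut point avoids all earlier ones, so no third piece contains
    it.\<close>
  have zonly: "i = j" if "i \<le> m" "z \<in> P i" for i
  proof (rule ccontr)
    assume "i \<noteq> j"
    from mQ[OF that(1) j(1) this] that(2) zP have "z \<in> Q" by (meson IntI subsetD)
    with zQB show False by simp
  qed
  have cc: "closed (P' i) \<and> cvx (P' i) \<and> P' i \<noteq> {} \<and> T / 8 \<le> dm (P' i)" if "i \<le> Suc m" for i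
  proof -
    have "i = Suc m \<or> i \<le> m \<and> i \<noteq> Suc m" using that by auto
    then consider "i = j" | "i = Suc m" | "i \<le> m" "i \<noteq> j" "i \<noteq> Suc m"
      by blast
    then show ?thesis
    proof cases
      case 1 then show ?thesis using AF(3,5) xA dA P'1(1) by auto
    next
      case 2 then show ?thesis using AF(4,6) yF dF P'1(2) by auto
    next
      case 3
      have "T / 8 \<le> dm (P i)" using dm8[OF j(1) 3(1)] by (simp add: T_def)
      then show ?thesis using Pi[OF 3(1)] P'1(3)[OF 3(2,3)] by simp
    qed
  qed
  have up: "dm (P' i) \<le> T" if "i \<le> Suc m" for i
    using dm_mono[OF par(2)[OF that]] cc[OF that] jmax[OF par(1)[OF that]] Pi(2)[OF par(1)[OF that]]
    unfolding T_def cvx_def by linarith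
  have "stage S B s (Suc m) P' (insert z Q)"
    unfolding stage_def
  proof (intro conjI allI impI)
    show "(\<Union>i\<le>Suc m. P' i) = S"
    proof
      show "(\<Union>i\<le>Suc m. P' i) \<subseteq> S" using par Pi(4) by blast
      show "S \<subseteq> (\<Union>i\<le>Suc m. P' i)"
      proof
        fix v assume "v \<in> S"
        then obtain i where i: "i \<le> m" "v \<in> P i" using US by auto
        show "v \<in> (\<Union>i\<le>Suc m. P' i)"
        proof (cases "i = j")
          case True
          then have "v \<in> P' j \<or> v \<in> P' (Suc m)" using i(2) AF(1) P'1(1,2) by blast
          then show ?thesis using j(1) by (auto intro: le_SucI)
        next
          case False
          then have "v \<in> P' i" using P'1(3)[OF False] i by auto
          then show ?thesis using i by (auto intro: le_SucI)
        qed
      qed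
    qed
  next
    fix i k assume ik: "i \<le> Suc m" "k \<le> Suc m" "i \<noteq> k"
    have "P' i \<inter> P' k \<subseteq> insert z Q \<and> (\<exists>z. P' i \<inter> P' k \<subseteq> {z})"
    proof (cases "par i = par k")
      case True then show ?thesis using meet[OF ik(3)] by auto
    next
      case False
      then have "P (par i) \<inter> P (par k) \<subseteq> Q \<and> (\<exists>z. P (par i) \<inter> P (par k) \<subseteq> {z})"
        using mQ m1 par(1)[OF ik(1)] par(1)[OF ik(2)] by meson
      then show ?thesis using par(2)[OF ik(1)] par(2)[OF ik(2)] by blast
    qed
    then show "P' i \<inter> P' k \<subseteq> insert z Q" and "\<exists>z. P' i \<inter> P' k \<subseteq> {z}" by auto
  next
    fix i k l assume ikl: "i \<le> Suc m" "k \<le> Suc m" "l \<le> Suc m" "i \<noteq> k" "k \<noteq> l" "i \<noteq> l"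
    have *: "P' a \<inter> P' b \<inter> P' c = {}"
      if "a \<le> Suc m" "b \<le> Suc m" "c \<le> Suc m" "a \<noteq> b" "b \<noteq> c" "a \<noteq> c" "par a = par b" for a b c
    proof -
      have "par c \<noteq> j" using pair[OF that(4,7)] that(5,6) unfolding par_def by metis
      then have "z \<notin> P' c" using zonly[OF par(1)[OF that(3)]] par(2)[OF that(3)] by blast
      then show ?thesis using meet[OF that(4,7)] by auto
    qed
    show "P' i \<inter> P' k \<inter> P' l = {}"
    proof (cases "par i = par k \<or> par k = par l \<or> par i = par l")
      case True
      then show ?thesis using *[of i k l] *[of k l i] *[of i l k] ikl by (auto simp: Int_ac)
    next
      case False
      then have "P (par i) \<inter> P (par k) \<inter> P (par l) = {}"
        using m3 par(1)[OF ikl(1)] par(1)[OF ikl(2)] par(1)[OF ikl(3)] by meson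
      then show ?thesis using par(2)[OF ikl(1)] par(2)[OF ikl(2)] par(2)[OF ikl(3)] by blast
    qed
  next
    show "card (insert z Q) \<le> Suc m" using QS by (simp add: card_insert_if)
  next
    have "z \<in> X" "Q \<union> B \<subseteq> X" using zP PX QX BX by auto
    then show "separated s (insert z Q \<union> B)" using separated_insert[OF QS(5) _ _ zs] by simp
  next
    fix i k assume "i \<le> Suc m" "k \<le> Suc m"
    then show "dm (P' i) \<le> 8 * dm (P' k)" using up[of i] cc[of k] by simp
  next
    fix i assume "i \<le> Suc m"
    then have "T / 8 \<le> dm (P' i)" using cc by blast
    moreover have "dm S / 8 ^ Suc m \<le> T / 8" using T by (simp add: field_simps)
    ultimately show "dm S / 8 ^ Suc m \<le> dm (P' i)" by (rule order_trans[rotated])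
  qed (use cc QS zP Pi(4)[OF j(1)] zQB in auto)
  then show ?thesis by blast
qed

text \<open>What a cut requires of \<open>s\<close> grows with \<open>m\<close> like
  \<open>Suc m * 8 ^ m\<close>, so a single budget computed from \<open>M\<close> covers all
  cuts.\<close>

lemma stage_exists:
  assumes S: "closed S" "cvx S" "S \<noteq> {}" and B: "B \<subseteq> S" "separated (4 * s) B"
    and s: "0 < s" "48 * s * real M * 8 ^ M \<le> dm S"
  shows "m < M \<Longrightarrow> \<exists>P Q. stage S B s m P Q"
proof (induction m)
  case 0 then show ?case using stage_0[OF S B(2) s(1)] by blast
next
  case (Suc m)
  have "real (Suc m) * 8 ^ m \<le> real M * 8 ^ M"
    using Suc.prems by (intro mult_mono power_increasing) auto
  then have "48 * s * (real (Suc m) * 8 ^ m) \<le> 48 * s * (real M * 8 ^ M)"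
    using s(1) by (intro mult_left_mono) auto
  then have "48 * s * real (Suc m) * 8 ^ m \<le> dm S" using s(2) by (simp only: mult.assoc)
  then have "48 * s * real (Suc m) \<le> dm S / 8 ^ m" by (simp add: pos_le_divide_eq)
  then show ?case using Suc stage_Suc S(2) B s(1) unfolding cvx_def by (meson Suc_lessD)
qed

end

text \<open>This is the \<open>\<beta>\<close> of the overview. Inserting
  \<open>s = sep_const M * (dm S / 4)\<close> into \<open>48 * s * real M * 8 ^ M \<le> dm S\<close>
  leaves the factor \<open>12\<close>. \<open>Suc M\<close> instead of \<open>M\<close> keeps the
  value positive for \<open>M = 0\<close>.\<close>

definition sep_const :: "nat \<Rightarrow> real" where
  "sep_const M = 1 / (12 * real (Suc M) * 8 ^ M)"

text \<open>The number of halvings after which a ball of radius \<open>2 * t\<close> is covered by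
  balls so small that two points of one of them have \<open>rho\<close>-distance below
  \<open>a * t\<close>.\<close>

definition doubling_exponent :: "real \<Rightarrow> real \<Rightarrow> nat" where
  "doubling_exponent C a = (LEAST k. 4 * C / a < 2 ^ k)"

text \<open>The factor \<open>2\<close> appears because only half of the pieces are used in the
  count of large pieces; the summand \<open>2\<close> makes the inequality strict and the alphabet
  nontrivial.\<close>

definition split_threshold :: "nat \<Rightarrow> real \<Rightarrow> nat" where
  "split_threshold N C = 2 * N ^ doubling_exponent C (1 / 512) + 2"

lemma sep_const_pos: "0 < sep_const M" by (simp add: sep_const_def)

lemma sep_const_le: "sep_const M \<le> 1 / 8 ^ M" "sep_const M < 1 / real (Suc M)"
proof -
  have "(8::real) ^ M \<le> 12 * real (Suc M) * 8 ^ M" "real (Suc M) * 1 < 12 * real (Suc M) * 8 ^ M"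
  proof -
    have "1 * (8::real) ^ M \<le> (12 * real (Suc M)) * 8 ^ M" by (intro mult_right_mono) auto
    then show "(8::real) ^ M \<le> 12 * real (Suc M) * 8 ^ M" by simp
    have "(12 * real (Suc M)) * 1 \<le> (12 * real (Suc M)) * 8 ^ M" by (intro mult_left_mono) auto
    then show "real (Suc M) * 1 < 12 * real (Suc M) * 8 ^ M" by (simp add: algebra_simps)
  qed
  then show "sep_const M \<le> 1 / 8 ^ M" "sep_const M < 1 / real (Suc M)"
    unfolding sep_const_def by (auto intro!: divide_left_mono divide_strict_left_mono)
qed

lemma doubling_exponent: "4 * C / a < 2 ^ doubling_exponent C a"
proof -
  obtain k where "4 * C / a < 2 ^ k" using real_arch_pow[of 2 "4 * C / a"] by auto
  then show ?thesis unfolding doubling_exponent_def by (rule LeastI)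
qed

definition joints :: "nat set \<Rightarrow> (nat \<Rightarrow> 'e set) \<Rightarrow> 'e set" where
  "joints I P = (\<Union>i\<in>I. \<Union>j\<in>I - {i}. P i \<inter> P j)"

section \<open>Doubling and the size of the pieces\<close>

locale doubling_tree = seg_tree X seg C
  for X :: "'e::metric_space set" and seg :: "'e \<Rightarrow> 'e \<Rightarrow> 'e set" and C :: real +
  fixes N :: nat
  assumes doubling: "\<And>x r. \<lbrakk>x \<in> X; 0 < r\<rbrakk> \<Longrightarrow>
    \<exists>F. finite F \<and> card F \<le> N \<and> F \<subseteq> X \<and> X \<inter> ball x r \<subseteq> (\<Union>y\<in>F. ball y (r / 2))"
begin

lemma doubling_power:
  assumes "x \<in> X" "0 < r"
  shows "\<exists>F. finite F \<and> card F \<le> N ^ k \<and> F \<subseteq> X \<and> X \<inter> ball x r \<subseteq> (\<Union>y\<in>F. ball y (r / 2 ^ k))"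
proof (induction k)
  case 0
  show ?case using assms by (intro exI[of _ "{x}"]) auto
next
  case (Suc k)
  then obtain F where F: "finite F" "card F \<le> N ^ k" "F \<subseteq> X"
    "X \<inter> ball x r \<subseteq> (\<Union>y\<in>F. ball y (r / 2 ^ k))" by blast
  have "\<forall>y\<in>F. \<exists>G. finite G \<and> card G \<le> N \<and> G \<subseteq> X \<and>
      X \<inter> ball y (r / 2 ^ k) \<subseteq> (\<Union>z\<in>G. ball z (r / 2 ^ Suc k))"
  proof
    fix y assume "y \<in> F"
    then show "\<exists>G. finite G \<and> card G \<le> N \<and> G \<subseteq> X \<and>
      X \<inter> ball y (r / 2 ^ k) \<subseteq> (\<Union>z\<in>G. ball z (r / 2 ^ Suc k))"
      using doubling[of y "r / 2 ^ k"] F(3) assms(2) by (auto simp: mult.commute)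
  qed
  then obtain G where G: "\<And>y. y \<in> F \<Longrightarrow> finite (G y)" "\<And>y. y \<in> F \<Longrightarrow> card (G y) \<le> N"
    "\<And>y. y \<in> F \<Longrightarrow> G y \<subseteq> X"
    "\<And>y. y \<in> F \<Longrightarrow> X \<inter> ball y (r / 2 ^ k) \<subseteq> (\<Union>z\<in>G y. ball z (r / 2 ^ Suc k))"
    by metis
  have "card (\<Union>y\<in>F. G y) \<le> (\<Sum>y\<in>F. card (G y))" using F(1) by (rule card_UN_le)
  also have "\<dots> \<le> card F * N" using G(2) sum_bounded_above[of F "\<lambda>y. card (G y)" N] by simp
  also have "\<dots> \<le> N ^ Suc k" using F(2) by (simp add: mult.commute)
  finally have "card (\<Union>y\<in>F. G y) \<le> N ^ Suc k" .
  moreover have "X \<inter> ball x r \<subseteq> (\<Union>z\<in>(\<Union>y\<in>F. G y). ball z (r / 2 ^ Suc k))"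
  proof
    fix v assume "v \<in> X \<inter> ball x r"
    then obtain y where "y \<in> F" "v \<in> X \<inter> ball y (r / 2 ^ k)" using F(4) by blast
    with G(4) show "v \<in> (\<Union>z\<in>(\<Union>y\<in>F. G y). ball z (r / 2 ^ Suc k))" by blast
  qed
  ultimately show ?case using F(1) G(1,3) by (intro exI[of _ "\<Union>y\<in>F. G y"]) auto
qed

text \<open>Two separated points cannot share a ball of the cover obtained by \<open>k\<close>
  halvings: their distance would be below \<open>4 * t / 2 ^ k\<close>, and bounded turning would
  push \<open>rho\<close> below \<open>a * t\<close>.\<close>

lemma card_separated:
  assumes A: "A \<subseteq> X" "\<And>x y. x \<in> A \<Longrightarrow> y \<in> A \<Longrightarrow> rho x y \<le> t" and t: "0 < t"
    and a: "0 < a" "separated (a * t) A"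
  shows "finite A \<and> card A \<le> N ^ doubling_exponent C a"
proof (cases "A = {}")
  case False
  then obtain x where x: "x \<in> A" by blast
  define k where "k = doubling_exponent C a"
  have k: "4 * C < a * 2 ^ k" using doubling_exponent[of C a] a(1) by (simp add: k_def field_simps)
  obtain F where F: "finite F" "card F \<le> N ^ k"
    "X \<inter> ball x (2 * t) \<subseteq> (\<Union>y\<in>F. ball y (2 * t / 2 ^ k))"
    using doubling_power[of x "2 * t" k] x A(1) t by auto
  have "\<forall>v\<in>A. \<exists>y\<in>F. dist y v < 2 * t / 2 ^ k"
  proof
    fix v assume v: "v \<in> A"
    then have "dist x v < 2 * t" using dist_le_rho[of x v] A(2)[OF x v] A(1) x t by fastforce
    then have "v \<in> X \<inter> ball x (2 * t)" using v A(1) by auto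
    then obtain y where "y \<in> F" "v \<in> ball y (2 * t / 2 ^ k)" using F(3) by blast
    then show "\<exists>y\<in>F. dist y v < 2 * t / 2 ^ k" by auto
  qed
  then obtain g where g: "\<And>v. v \<in> A \<Longrightarrow> g v \<in> F \<and> dist (g v) v < 2 * t / 2 ^ k" by metis
  have inj: "inj_on g A"
  proof (rule inj_onI)
    fix u v assume uv: "u \<in> A" "v \<in> A" "g u = g v"
    show "u = v"
    proof (rule ccontr)
      assume ne: "u \<noteq> v"
      have X: "u \<in> X" "v \<in> X" using uv A by auto
      have C: "0 < C" using C_ge_1[OF X ne] by simp
      have "dist u v < 4 * t / 2 ^ k"
        using g[OF uv(1)] g[OF uv(2)] uv(3) dist_triangle3[of u v "g u"] by simp
      then have "C * dist u v < C * (4 * t / 2 ^ k)" using C by (rule mult_strict_left_mono)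
      also have "\<dots> \<le> a * t"
        using mult_right_mono[OF less_imp_le[OF k], of t] t by (simp add: field_simps)
      finally show False
        using rho_le_dist[OF X] separatedD[OF a(2) uv(1,2) ne] by linarith
    qed
  qed
  have "finite A" using inj F(1) g by (meson finite_imageD finite_subset image_subsetI)
  moreover have "card A \<le> card F" using inj F(1) g by (intro card_inj_on_le) auto
  ultimately show ?thesis using F(2) k_def by simp
qed auto

lemma seg_meets_joint:
  assumes "\<And>i. i \<le> (m::nat) \<Longrightarrow> closed (P i)" "cvx S" "(\<Union>i\<le>m. P i) = S"
    "i \<le> m" "x \<in> P i" "y \<in> S" "y \<notin> P i"
  obtains j q where "j \<le> m" "j \<noteq> i" "q \<in> seg x y" "q \<in> P i" "q \<in> P j"
proof -
  have "x \<in> S" using assms(3-5) by auto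
  then have "seg x y \<subseteq> (\<Union>i\<in>{..m}. P i)" "x \<in> X" "y \<in> X" using assms(2,3,6) unfolding cvx_def by auto
  then obtain j q where "j \<in> {..m}" "j \<noteq> i" "q \<in> seg x y" "q \<in> P i" "q \<in> P j"
    using seg_crossing[of "{..m}" P x y i] assms by auto
  then show ?thesis using that by auto
qed

text \<open>There are at most \<open>2 * card Q\<close> incidences between joints and pieces, so half of the pieces carry at
  most three joints and contain a point far from all of them. If all pieces were large, these points
  would be separated, and doubling bounds their number.\<close>

lemma stage_small:
  assumes st: "stage S B s m P Q" and S: "cvx S" "0 < dm S" and m: "split_threshold N C \<le> Suc m"
    and i: "i \<le> m"
  shows "dm (P i) \<le> dm S / 4"
proof (rule ccontr)
  assume n: "\<not> ?thesis"
  define t where "t = dm S"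
  have SX: "S \<subseteq> X" using S by (simp add: cvx_def)
  have Pi: "closed (P j)" "cvx (P j)" "P j \<noteq> {}" "P j \<subseteq> S" if "j \<le> m" for j
    using st that unfolding stage_def by auto
  have Q: "finite Q" "card Q \<le> m" "Q \<subseteq> X" using st SX unfolding stage_def by auto
  have US: "(\<Union>i\<le>m. P i) = S" using st unfolding stage_def by simp
  have mQ: "P j \<inter> P k \<subseteq> Q" if "j \<le> m" "k \<le> m" "j \<noteq> k" for j k
    using st that unfolding stage_def by simp
  have m3: "\<forall>i\<le>m. \<forall>j\<le>m. \<forall>k\<le>m. i \<noteq> j \<longrightarrow> j \<noteq> k \<longrightarrow> i \<noteq> k \<longrightarrow> P i \<inter> P j \<inter> P k = {}"
    using st unfolding stage_def by (elim conjE)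
  have big: "t / 32 < dm (P j)" if "j \<le> m" for j
  proof -
    have "dm (P i) \<le> 8 * dm (P j)" using st that i unfolding stage_def by simp
    then show ?thesis using n by (simp add: t_def)
  qed
  define deg where "deg j = card (Q \<inter> P j)" for j
  define G where "G = {j. j \<le> m \<and> deg j \<le> 3}"
  have two: "card {j \<in> {..m}. q \<in> P j} \<le> 2" for q
  proof (rule ccontr)
    assume "\<not> ?thesis"
    then have "3 \<le> card {j \<in> {..m}. q \<in> P j}" by simp
    then obtain T where T: "T \<subseteq> {j \<in> {..m}. q \<in> P j}" "card T = 3"
      by (meson obtain_subset_with_card_n)
    then obtain a b c where "T = {a,b,c}" "a \<noteq> b" "b \<noteq> c" "a \<noteq> c"
      by (auto simp: card_3_iff)
    with T m3 show False by blast
  qed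
  have "(\<Sum>j\<le>m. deg j) = (\<Sum>j\<le>m. \<Sum>q\<in>Q. if q \<in> P j then 1 else 0)"
    unfolding deg_def using Q(1) by (simp add: sum.If_cases)
  also have "\<dots> = (\<Sum>q\<in>Q. \<Sum>j\<le>m. if q \<in> P j then 1 else 0)" by (rule sum.swap)
  also have "\<dots> = (\<Sum>q\<in>Q. card {j \<in> {..m}. q \<in> P j})" by (simp add: sum.If_cases Int_def)
  also have "\<dots> \<le> card Q * 2" using sum_bounded_above[of Q "\<lambda>q. card {j \<in> {..m}. q \<in> P j}" 2] two by simp
  also have "\<dots> \<le> 2 * m" using Q(2) by simp
  finally have degs: "(\<Sum>j\<le>m. deg j) \<le> 2 * m" .
  have "4 * card ({..m} - G) = (\<Sum>j\<in>{..m} - G. 4)" by simp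
  also have "\<dots> \<le> (\<Sum>j\<in>{..m} - G. deg j)" by (rule sum_mono) (auto simp: G_def)
  also have "\<dots> \<le> (\<Sum>j\<le>m. deg j)" by (rule sum_mono2) auto
  finally have "2 * card ({..m} - G) \<le> m" using degs by simp
  moreover have "card ({..m} - G) = Suc m - card G"
    by (subst card_Diff_subset) (auto simp: G_def)
  ultimately have cG: "Suc m \<le> 2 * card G" by simp
  \<comment> \<open>A piece larger than \<open>t / 4\<close> makes all pieces larger than
    \<open>t / 32\<close>, so each contains a segment longer than \<open>t / 64\<close>. Four
    candidates with spacing \<open>t / 256\<close> on it suffice against three joints.\<close>
  have "\<exists>c. c \<in> P j \<and> (\<forall>q\<in>Q \<inter> P j. t / 512 \<le> rho c q)" if j: "j \<in> G" for j
  proof -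
    have jm: "j \<le> m" "card (Q \<inter> P j) \<le> 3" using j by (auto simp: G_def deg_def)
    have t64: "t / 64 < dm (P j)" using big[OF jm(1)] S(2) by (simp add: t_def)
    obtain x y where xy: "x \<in> P j" "y \<in> P j" "t / 64 < rho x y"
      using dm_attained[OF Pi(3)[OF jm(1)] t64] by blast
    have X: "x \<in> X" "y \<in> X" using xy Pi(4)[OF jm(1)] SX by auto
    obtain z where z: "z \<in> seg x y" "\<And>q. q \<in> Q \<inter> P j \<Longrightarrow> t / 256 / 2 \<le> rho z q"
    proof (rule spread_point[OF X, of "Q \<inter> P j" 3 0 "t / 256"])
      show "finite (Q \<inter> P j)" "card (Q \<inter> P j) \<le> 3" "Q \<inter> P j \<subseteq> X" using jm Q by auto
      show "0 < t / 256" "0 + real 3 * (t / 256) \<le> rho x y" using S(2) xy(3) by (auto simp: t_def)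
    qed auto
    have "z \<in> P j" using z(1) xy Pi(2)[OF jm(1)] unfolding cvx_def by blast
    then show ?thesis using z(2) by auto
  qed
  then obtain c where c: "\<And>j. j \<in> G \<Longrightarrow> c j \<in> P j"
    "\<And>j q. j \<in> G \<Longrightarrow> q \<in> Q \<inter> P j \<Longrightarrow> t / 512 \<le> rho (c j) q" by metis
  have cS: "c j \<in> S" if "j \<in> G" for j using c(1)[OF that] Pi(4)[of j] that by (auto simp: G_def)
  \<comment> \<open>The segment between the chosen points leaves \<open>P j\<close> through a joint,
    which is already that far from \<open>c j\<close>. If \<open>c k\<close> belongs to
    \<open>P j\<close> as well, it is itself such a joint.\<close>
  have far: "t / 512 \<le> rho (c j) (c k)" if jk: "j \<in> G" "k \<in> G" "j \<noteq> k" for j k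
  proof -
    have m: "j \<le> m" "k \<le> m" using jk by (auto simp: G_def)
    show ?thesis
    proof (cases "c k \<in> P j")
      case True
      then have "c k \<in> Q" using mQ[OF m jk(3)] c(1)[OF jk(2)] by blast
      then show ?thesis using c(2)[OF jk(1)] True by blast
    next
      case False
      obtain l q where lq: "l \<le> m" "l \<noteq> j" "q \<in> seg (c j) (c k)" "q \<in> P j" "q \<in> P l"
        using seg_meets_joint[OF Pi(1) S(1) US m(1) c(1)[OF jk(1)] cS[OF jk(2)] False] by blast
      have "q \<in> Q" using mQ[OF m(1) lq(1)] lq by blast
      then have "t / 512 \<le> rho (c j) q" using c(2)[OF jk(1)] lq(4) by blast
      also have "\<dots> \<le> rho (c j) (c k)"
        using cS[OF jk(1)] cS[OF jk(2)] SX lq(3) seg_left by (intro rho_mono) auto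
      finally show ?thesis .
    qed
  qed
  have inj: "inj_on c G"
  proof (rule inj_onI, rule ccontr)
    fix j k assume jk: "j \<in> G" "k \<in> G" "c j = c k" "j \<noteq> k"
    have "c k \<in> X" using cS[OF jk(2)] SX by blast
    then show False using far[OF jk(1,2,4)] rho_refl[of "c k"] jk(3) S(2) by (simp add: t_def)
  qed
  have sep: "separated (1 / 512 * t) (c ` G)" unfolding separated_def using far by auto
  have "card (c ` G) \<le> N ^ doubling_exponent C (1 / 512)"
  proof (rule conjunct2[OF card_separated[of "c ` G" t "1 / 512"]])
    show "c ` G \<subseteq> X" using cS SX by blast
    show "rho x y \<le> t" if "x \<in> c ` G" "y \<in> c ` G" for x y
      using rho_le_dm[OF SX] cS that unfolding t_def by blast
  qed (use sep S(2) t_def in auto)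
  then have "card G \<le> N ^ doubling_exponent C (1 / 512)" using card_image[OF inj] by simp
  then show False using cG m unfolding split_threshold_def by linarith
qed

text \<open>The form of a subdivision that can be iterated: the separation of old and new boundary
  points together is stated at the scale \<open>dm S / 4\<close>, which bounds the diameter of every
  piece. Indices now run through the alphabet.\<close>

definition good_split :: "nat \<Rightarrow> 'e set \<Rightarrow> 'e set \<Rightarrow> (nat \<Rightarrow> 'e set) \<Rightarrow> bool" where
  "good_split M S B P \<longleftrightarrow>
     (\<forall>i\<in>{1..M}. closed (P i) \<and> cvx (P i) \<and> P i \<noteq> {} \<and>
        dm S / 8 ^ M \<le> dm (P i) \<and> dm (P i) \<le> dm S / 4) \<and>
     (\<Union>i\<in>{1..M}. P i) = S \<and>
     (\<forall>i\<in>{1..M}. \<forall>j\<in>{1..M}. i \<noteq> j \<longrightarrow> (\<exists>z. P i \<inter> P j \<subseteq> {z})) \<and>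
     (\<forall>i\<in>{1..M}. \<forall>j\<in>{1..M}. \<forall>k\<in>{1..M}. i \<noteq> j \<longrightarrow> j \<noteq> k \<longrightarrow> i \<noteq> k \<longrightarrow> P i \<inter> P j \<inter> P k = {}) \<and>
     joints {1..M} P \<inter> B = {} \<and> separated (sep_const M * (dm S / 4)) (joints {1..M} P \<union> B)"

lemma good_split_exists:
  assumes S: "closed S" "cvx S" "0 < dm S" and B: "B \<subseteq> S" "separated (sep_const M * dm S) B"
    and M: "split_threshold N C \<le> M"
  shows "\<exists>P. good_split M S B P"
proof -
  \<comment> \<open>So \<open>4 * s\<close> is the separation that \<open>B\<close> has at the scale
    of \<open>S\<close>, and \<open>s\<close> is the one wanted at a quarter of this scale.\<close>
  define s where "s = sep_const M * (dm S / 4)"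
  have ne: "S \<noteq> {}" using S(3) by (auto simp: diam_wrt_def)
  have s: "0 < s" using S(3) sep_const_pos by (simp add: s_def)
  have "48 * s * real M * 8 ^ M \<le> 48 * s * real (Suc M) * 8 ^ M"
    using s by (intro mult_right_mono mult_left_mono) auto
  also have "\<dots> = dm S * (sep_const M * (12 * real (Suc M) * 8 ^ M))" by (simp add: s_def)
  also have "\<dots> = dm S" by (simp add: sep_const_def del: of_nat_Suc)
  finally have s48: "48 * s * real M * 8 ^ M \<le> dm S" by simp
  have sB: "separated (4 * s) B" using B(2) by (simp add: s_def)
  obtain m where m: "M = Suc m" using M unfolding split_threshold_def by (cases M) auto
  obtain P Q where st: "stage S B s m P Q"
    using stage_exists[OF S(1,2) ne B(1) sB s s48, of m] m by auto
  define P' where "P' i = P (i - 1)" for i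
  have cov: "(\<Union>i\<in>{1..M}. P' i) = (\<Union>i\<le>m. P i)"
  proof -
    have "(\<lambda>i. i - 1) ` {1..M} = {..m}"
    proof (intro equalityI subsetI)
      fix k assume "k \<in> {..m}" then have "k = Suc k - 1" "Suc k \<in> {1..M}" using m by auto
      then show "k \<in> (\<lambda>i. i - 1) ` {1..M}" by blast
    qed (use m in auto)
    then have "\<Union>(P ` ((\<lambda>i. i - 1) ` {1..M})) = \<Union>(P ` {..m})" by (rule arg_cong)
    then show ?thesis unfolding P'_def by (simp only: image_image)
  qed
  have r: "i - 1 \<le> m" if "i \<in> {1..M}" for i using that m by auto
  have ne: "i - 1 \<noteq> j - 1" if "i \<in> {1..M}" "j \<in> {1..M}" "i \<noteq> j" for i j using that by auto
  have mQ: "P j \<inter> P k \<subseteq> Q \<and> (\<exists>z. P j \<inter> P k \<subseteq> {z})" if "j \<le> m" "k \<le> m" "j \<noteq> k" for j k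
    using st that unfolding stage_def by simp
  have m3: "\<forall>i\<le>m. \<forall>j\<le>m. \<forall>k\<le>m. i \<noteq> j \<longrightarrow> j \<noteq> k \<longrightarrow> i \<noteq> k \<longrightarrow> P i \<inter> P j \<inter> P k = {}"
    using st unfolding stage_def by (elim conjE)
  have jQ: "joints {1..M} P' \<subseteq> Q"
  proof
    fix v assume "v \<in> joints {1..M} P'"
    then obtain i j where ij: "i \<in> {1..M}" "j \<in> {1..M}" "i \<noteq> j" "v \<in> P (i - 1) \<inter> P (j - 1)"
    proof -
      obtain i j where "i \<in> {1..M}" "j \<in> {1..M} - {i}" "v \<in> P' i \<inter> P' j"
        using \<open>v \<in> joints {1..M} P'\<close> unfolding joints_def by blast
      then show ?thesis using that[of i j] by (simp add: P'_def)
    qed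
    then show "v \<in> Q" using mQ[OF r[OF ij(1)] r[OF ij(2)] ne[OF ij(1-3)]] by blast
  qed
  have a: "closed (P k) \<and> cvx (P k) \<and> P k \<noteq> {} \<and> dm S / 8 ^ M \<le> dm (P k) \<and> dm (P k) \<le> dm S / 4"
    if k: "k \<le> m" for k
  proof -
    have "dm S / 8 ^ M \<le> dm S / 8 ^ m" using S(3) m by (intro divide_left_mono) auto
    moreover have "dm S / 8 ^ m \<le> dm (P k)" "closed (P k)" "cvx (P k)" "P k \<noteq> {}"
      using st k unfolding stage_def by auto
    moreover have "dm (P k) \<le> dm S / 4" using stage_small[OF st S(2,3) _ k] M m by simp
    ultimately show ?thesis by auto
  qed
  have QB: "Q \<inter> B = {}" "separated s (Q \<union> B)" "(\<Union>i\<le>m. P i) = S" using st unfolding stage_def by auto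
  have "good_split M S B P'"
    unfolding good_split_def
  proof (intro conjI ballI impI)
    fix i j k assume "i \<in> {1..M}" "j \<in> {1..M}" "k \<in> {1..M}" "i \<noteq> j" "j \<noteq> k" "i \<noteq> k"
    then show "P' i \<inter> P' j \<inter> P' k = {}" unfolding P'_def using m3 r ne by metis
  next
    show "separated (sep_const M * (dm S / 4)) (joints {1..M} P' \<union> B)"
      by (rule separated_subset[OF QB(2)]) (use jQ s_def in auto)
  next
    fix i j assume "i \<in> {1..M}" "j \<in> {1..M}" "i \<noteq> j"
    then show "\<exists>z. P' i \<inter> P' j \<subseteq> {z}" unfolding P'_def using mQ r ne by metis
  qed (use a r cov QB jQ in \<open>auto simp: P'_def\<close>)
  then show ?thesis by blast
qed

end

section \<open>Graphs that are trees\<close>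

lemma rtrancl_on_mono:
  assumes "(a, b) \<in> rtrancl_on V r" "r \<subseteq> r'"
  shows "(a, b) \<in> rtrancl_on V r'"
  using assms(1)
proof induct
  case (step y z)
  show ?case by (rule converse_rtrancl_on_into_rtrancl_on[of y z]) (use step assms(2) in auto)
qed simp

lemma digraph_connectedI:
  assumes "verts G \<noteq> {}"
    and "\<And>u v. \<lbrakk>u \<in> verts G; v \<in> verts G\<rbrakk> \<Longrightarrow> (u, v) \<in> rtrancl_on (verts G) (arcs_ends G)"
  shows "Digraph_Component.connected G"
proof -
  have "arcs_ends G \<subseteq> parcs (mk_symmetric G)"
    by (auto simp: mk_symmetric_def arcs_ends_conv)
  then have "(u, v) \<in> rtrancl_on (verts G) (parcs (mk_symmetric G))"
    if "u \<in> verts G" "v \<in> verts G" for u v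
    using rtrancl_on_mono assms(2)[OF that] by metis
  moreover have "pverts (mk_symmetric G) = verts G" by (simp add: mk_symmetric_def)
  ultimately show ?thesis
    using assms(1)
    unfolding Digraph_Component.connected_def strongly_connected_def reachable_def by simp
qed

text \<open>The members reachable from \<open>a\<close> and the remaining ones have disjoint closed
  unions. It gives the connectedness of the graphs, that of the children of a word, and a
  neighbouring sibling for every child.\<close>

lemma closed_cover_connected:
  assumes I: "finite I" "a \<in> I" "b \<in> I"
    and c: "\<And>i. i \<in> I \<Longrightarrow> closed (c i)" "\<And>i. i \<in> I \<Longrightarrow> c i \<noteq> {}"
    and con: "connected (\<Union>i\<in>I. c i)"
    and r: "\<And>i j. \<lbrakk>i \<in> I; j \<in> I; i \<noteq> j; c i \<inter> c j \<noteq> {}\<rbrakk> \<Longrightarrow> (i, j) \<in> r"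
  shows "(a, b) \<in> rtrancl_on I r"
proof (rule ccontr)
  assume n: "(a, b) \<notin> rtrancl_on I r"
  define R where "R = {i \<in> I. (a, i) \<in> rtrancl_on I r}"
  have aR: "a \<in> R" using I by (simp add: R_def)
  have bR: "b \<in> I - R" using n I by (simp add: R_def)
  define U V where "U = (\<Union>i\<in>R. c i)" and "V = (\<Union>i\<in>I - R. c i)"
  have RI: "R \<subseteq> I" by (auto simp: R_def)
  have cl: "closed U" "closed V"
    unfolding U_def V_def using c(1) RI finite_subset[OF RI I(1)] I(1) by (auto intro!: closed_UN)
  have dis: "U \<inter> V = {}"
  proof (rule ccontr)
    assume "U \<inter> V \<noteq> {}"
    then obtain i j where ij: "i \<in> R" "j \<in> I" "j \<notin> R" "c i \<inter> c j \<noteq> {}"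
      unfolding U_def V_def by blast
    have "(i, j) \<in> r" using r[of i j] ij RI by blast
    moreover have "(a, i) \<in> rtrancl_on I r" using ij(1) by (simp add: R_def)
    ultimately have "(a, j) \<in> rtrancl_on I r"
      using ij(2) rtrancl_on_into_rtrancl_on by metis
    then show False using ij by (simp add: R_def)
  qed
  have "I = R \<union> (I - R)" using RI by blast
  then have cov: "(\<Union>i\<in>I. c i) = U \<union> V" unfolding U_def V_def by (metis UN_Un)
  have "c a \<subseteq> U" "c b \<subseteq> V" unfolding U_def V_def using aR bR by (auto simp del: Diff_iff)
  then have ne: "U \<noteq> {}" "V \<noteq> {}"
    using c(2)[OF I(2)] c(2)[OF I(3)] by (metis subset_empty)+
  have "\<exists>A B. closed A \<and> closed B \<and> A \<noteq> {} \<and> B \<noteq> {} \<and> A \<union> B = U \<union> V \<and> A \<inter> B = {}"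
    by (rule exI[of _ U], rule exI[of _ V]) (simp add: cl dis ne)
  then have "\<not> connected (U \<union> V)" by (simp only: connected_closed_set[OF closed_Un[OF cl]] not_not)
  then show False using con by (simp only: cov)
qed

context pair_graph begin

lemma awalk_avoiding:
  assumes "awalk a es v" "u \<notin> set (pawalk_verts a es)"
  shows "(a, v) \<in> (parcs G - {(u, c), (c, u)})\<^sup>*"
  using assms
proof (induction es arbitrary: a)
  case Nil
  then show ?case by (simp add: awalk_Nil_iff)
next
  case (Cons e es)
  obtain b where e: "e = (a, b)" "(a, b) \<in> parcs G" "awalk b es v"
    using Cons.prems(1) by (cases e) (auto simp: awalk_Cons_iff)
  have "u \<notin> set (pawalk_verts b es)" "u \<noteq> a" using Cons.prems(2) e by auto
  moreover have "b \<in> set (pawalk_verts b es)" by (cases es) (use e in \<open>auto simp: awalk_Cons_iff\<close>)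
  ultimately have "(a, b) \<in> parcs G - {(u, c), (c, u)}" "(b, v) \<in> (parcs G - {(u, c), (c, u)})\<^sup>*"
    using Cons.IH[OF e(3)] e by auto
  then show ?case by (rule converse_rtrancl_into_rtrancl)
qed

text \<open>Acyclicity is used in the form that every edge is a bridge. If two simple paths from
  \<open>u\<close> start with different vertices \<open>a\<close> and \<open>b\<close>, then going
  to \<open>b\<close>, on to \<open>v\<close> and back along the first path to \<open>a\<close>
  avoids the edge between \<open>u\<close> and \<open>a\<close>.\<close>

lemma apath_unique:
  assumes bridge: "\<And>x y. (x, y) \<in> parcs G \<Longrightarrow> (x, y) \<notin> (parcs G - {(x, y), (y, x)})\<^sup>*"
    and "apath u p v" "apath u q v"
  shows "p = q"
  using assms(2,3)
proof (induction p arbitrary: u q)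
  case Nil
  then show ?case using apath_nonempty_ends[of u q v] by (auto simp: apath_Nil_iff)
next
  case (Cons e es)
  then have "u \<noteq> v" using apath_nonempty_ends by blast
  then obtain f fs where q: "q = f # fs" using Cons.prems(2) by (cases q) (auto simp: apath_Nil_iff)
  obtain a where e: "e = (u, a)" "(u, a) \<in> parcs G" "apath a es v" "u \<notin> set (pawalk_verts a es)"
    using Cons.prems(1) by (cases e) (auto simp: apath_Cons_iff)
  obtain b where f: "f = (u, b)" "(u, b) \<in> parcs G" "apath b fs v" "u \<notin> set (pawalk_verts b fs)"
    using Cons.prems(2) q by (cases f) (auto simp: apath_Cons_iff)
  show ?case
  proof (cases "a = b")
    case True
    then show ?thesis using Cons.IH e f q by blast
  next
    case False
    let ?R = "parcs G - {(u, a), (a, u)}"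
    have "sym ?R" using arcs_symmetric unfolding sym_def by blast
    then have "sym (?R\<^sup>*)" by (rule sym_rtrancl)
    moreover have "(a, v) \<in> ?R\<^sup>*" using awalk_avoiding[OF awalkI_apath[OF e(3)] e(4)] by simp
    ultimately have "(v, a) \<in> ?R\<^sup>*" by (rule symD)
    moreover have "(b, v) \<in> ?R\<^sup>*" using awalk_avoiding[OF awalkI_apath[OF f(3)] f(4)] by simp
    moreover have "(u, b) \<in> ?R" using f(2) False pair_no_loops[OF e(2)] by auto
    ultimately have "(u, a) \<in> ?R\<^sup>*" by (meson converse_rtrancl_into_rtrancl rtrancl_trans)
    then show ?thesis using bridge[OF e(2)] by blast
  qed
qed

lemma combinatorial_treeI:
  assumes "\<And>x y. (x, y) \<in> parcs G \<Longrightarrow> (x, y) \<notin> (parcs G - {(x, y), (y, x)})\<^sup>*"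
    and "\<And>u v. \<lbrakk>u \<in> pverts G; v \<in> pverts G\<rbrakk> \<Longrightarrow> (u, v) \<in> rtrancl_on (pverts G) (parcs G)"
  shows "combinatorial_tree G"
  unfolding combinatorial_tree_def
proof (intro conjI ballI impI)
  show "pair_graph G" by (rule pair_graph)
  fix u v assume uv: "u \<in> pverts G" "v \<in> pverts G"
  then have "u \<rightarrow>\<^sup>*\<^bsub>with_proj G\<^esub> v" using assms(2) by (simp add: reachable_def)
  then obtain p where "apath u p v" using reachable_apath by blast
  then show "\<exists>!p. apath u p v" using apath_unique[OF assms(1)] by blast
qed

end

lemma finite_words: "finite (words M k)"
proof -
  have "words M k = {w. set w \<subseteq> {1..M} \<and> length w = k}" by (auto simp: words_def in_lists_conv_set)
  then show ?thesis using finite_lists_length_eq[of "{1..M}" k] by simp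
qed

lemma words_0: "words M 0 = {[]}" by (auto simp: words_def)

lemma words_Suc: "words M (Suc k) = {w @ [i] | w i. w \<in> words M k \<and> i \<in> {1..M}}"
proof -
  have "\<exists>u i. w = u @ [i] \<and> u \<in> words M k \<and> i \<in> {1..M}" if w: "w \<in> words M (Suc k)" for w
  proof -
    obtain u i where "w = u @ [i]" using w by (cases w rule: rev_cases) (auto simp: words_def)
    then show ?thesis using w by (auto simp: words_def)
  qed
  moreover have "w @ [i] \<in> words M (Suc k)" if "w \<in> words M k" "i \<in> {1..M}" for w i
    using that by (auto simp: words_def)
  ultimately show ?thesis by blast
qed

lemma words_lists: "w \<in> words M k \<Longrightarrow> w \<in> lists {1..M}"
  by (simp add: words_def)

lemma length_initial [simp]: "length (initial x n) = n" by (simp add: initial_def)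

lemma initial_Suc: "initial x (Suc n) = initial x n @ [x n]" by (simp add: initial_def)

lemma initial_words: "x \<in> inf_words M \<Longrightarrow> initial x n \<in> words M n"
  by (auto simp: inf_words_def initial_def words_def)

lemma take_initial: "m \<le> n \<Longrightarrow> take m (initial x n) = initial x m"
  by (simp add: initial_def take_map)

section \<open>Cells indexed by words\<close>

locale tree_code = doubling_tree X seg C N
  for X :: "'e::metric_space set" and seg :: "'e \<Rightarrow> 'e \<Rightarrow> 'e set" and C :: real and N :: nat +
  fixes M :: nat
  assumes threshold: "split_threshold N C \<le> M" and dm_X_pos: "0 < dm X"
begin

text \<open>The boundary accumulated so far travels with the cell, because the next split has to
  avoid it. The choice of the split does not mention the letter \<open>i\<close>, so all children of
  a word come from the same split.\<close>

definition subdivide :: "'e set \<times> 'e set \<Rightarrow> nat \<Rightarrow> 'e set \<times> 'e set" where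
  "subdivide S i =
     (let P = SOME P. good_split M (fst S) (snd S) P
      in (P i, (snd S \<union> joints {1..M} P) \<inter> P i))"

definition cell :: "nat list \<Rightarrow> 'e set" where
  "cell w = fst (foldl subdivide (X, {}) w)"

text \<open>The points that \<open>cell w\<close> shares with the other cells of its level lie in \<open>bd w\<close>.\<close>

definition bd :: "nat list \<Rightarrow> 'e set" where
  "bd w = snd (foldl subdivide (X, {}) w)"

lemma M2: "2 \<le> M"
  using threshold by (simp add: split_threshold_def)

lemma cell_Nil [simp]: "cell [] = X" by (simp add: cell_def)

lemma bd_Nil [simp]: "bd [] = {}" by (simp add: bd_def)

lemma cell_snoc: "cell (w @ [i]) = (SOME P. good_split M (cell w) (bd w) P) i"
  by (simp add: cell_def bd_def subdivide_def Let_def)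

lemma bd_snoc: "bd (w @ [i]) = (bd w \<union> joints {1..M} (\<lambda>j. cell (w @ [j]))) \<inter> cell (w @ [i])"
  unfolding cell_snoc by (simp add: cell_def bd_def subdivide_def Let_def)

definition cell_ok :: "nat list \<Rightarrow> bool" where
  "cell_ok w \<longleftrightarrow> closed (cell w) \<and> cvx (cell w) \<and> 0 < dm (cell w) \<and> bd w \<subseteq> cell w \<and>
     separated (sep_const M * dm (cell w)) (bd w)"

lemma good_split_cells:
  assumes "cell_ok w"
  shows "good_split M (cell w) (bd w) (\<lambda>i. cell (w @ [i]))"
proof -
  have "\<exists>P. good_split M (cell w) (bd w) P"
    using good_split_exists[of "cell w" "bd w" M] threshold assms unfolding cell_ok_def by blast
  then have "good_split M (cell w) (bd w) (SOME P. good_split M (cell w) (bd w) P)"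
    by (rule someI_ex[of "good_split M (cell w) (bd w)"])
  then show ?thesis unfolding cell_snoc .
qed

lemma cell_ok_Nil: "cell_ok []"
  using dm_X_pos cvx_X compact_imp_closed[OF compact_X] by (auto simp: cell_ok_def separated_def)

text \<open>The factor \<open>4\<close> lost in the separation is regained because a child has at
  most a quarter of the diameter: relative to its own size it is as well separated as its
  parent.\<close>

lemma cell_ok_snoc:
  assumes "cell_ok w" "i \<in> {1..M}"
  shows "cell_ok (w @ [i])"
proof -
  note g = good_split_cells[OF assms(1), unfolded good_split_def]
  have c: "closed (cell (w @ [i]))" "cvx (cell (w @ [i]))" "dm (cell w) / 8 ^ M \<le> dm (cell (w @ [i]))"
    "dm (cell (w @ [i])) \<le> dm (cell w) / 4"
    using bspec[OF conjunct1[OF g] assms(2)] by simp_all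
  have "0 < dm (cell w) / 8 ^ M" using assms(1) by (simp add: cell_ok_def)
  then have pos: "0 < dm (cell (w @ [i]))" using c(3) by linarith
  have sp: "separated (sep_const M * (dm (cell w) / 4)) (joints {1..M} (\<lambda>i. cell (w @ [i])) \<union> bd w)"
    using g by (elim conjE)
  have le: "sep_const M * dm (cell (w @ [i])) \<le> sep_const M * (dm (cell w) / 4)"
    using c(4) less_imp_le[OF sep_const_pos] by (rule mult_left_mono)
  have "separated (sep_const M * dm (cell (w @ [i]))) (bd (w @ [i]))"
    by (rule separated_subset[OF sp _ le]) (auto simp: bd_snoc)
  then show ?thesis using c pos by (auto simp: cell_ok_def bd_snoc)
qed

lemma cell_ok: "w \<in> lists {1..M} \<Longrightarrow> cell_ok w"
proof (induction w rule: rev_induct)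
  case (snoc i w)
  then show ?case using cell_ok_snoc[of w i] by auto
qed (rule cell_ok_Nil)

context
  fixes w assumes w: "w \<in> lists {1..M}"
begin

lemma closed_cell: "closed (cell w)" and cvx_cell: "cvx (cell w)" and dm_cell_pos: "0 < dm (cell w)"
  and bd_subset: "bd w \<subseteq> cell w" and separated_bd: "separated (sep_const M * dm (cell w)) (bd w)"
  using cell_ok[OF w] by (auto simp: cell_ok_def)

lemma cell_X: "cell w \<subseteq> X" using cvx_cell by (simp add: cvx_def)

lemma cell_nonempty: "cell w \<noteq> {}"
  using dm_cell_pos by (auto simp: diam_wrt_def)

lemma split_facts:
  "(\<Union>i\<in>{1..M}. cell (w @ [i])) = cell w"
  "\<And>i. i \<in> {1..M} \<Longrightarrow> dm (cell w) / 8 ^ M \<le> dm (cell (w @ [i]))"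
  "\<And>i. i \<in> {1..M} \<Longrightarrow> dm (cell (w @ [i])) \<le> dm (cell w) / 4"
  "\<And>i j. \<lbrakk>i \<in> {1..M}; j \<in> {1..M}; i \<noteq> j\<rbrakk> \<Longrightarrow> \<exists>z. cell (w @ [i]) \<inter> cell (w @ [j]) \<subseteq> {z}"
  "joints {1..M} (\<lambda>i. cell (w @ [i])) \<inter> bd w = {}"
  "separated (sep_const M * (dm (cell w) / 4)) (joints {1..M} (\<lambda>i. cell (w @ [i])) \<union> bd w)"
  using good_split_cells[OF cell_ok[OF w]] unfolding good_split_def by auto

lemma split_triple:
  "\<lbrakk>i \<in> {1..M}; j \<in> {1..M}; k \<in> {1..M}; i \<noteq> j; j \<noteq> k; i \<noteq> k\<rbrakk> \<Longrightarrow>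
     cell (w @ [i]) \<inter> cell (w @ [j]) \<inter> cell (w @ [k]) = {}"
  using good_split_cells[OF cell_ok[OF w]] unfolding good_split_def
  by (elim conjE) blast

lemma cell_snoc_subset: "i \<in> {1..M} \<Longrightarrow> cell (w @ [i]) \<subseteq> cell w"
  using split_facts(1) by blast

lemma in_joints: "\<lbrakk>i \<in> {1..M}; j \<in> {1..M}; i \<noteq> j; p \<in> cell (w @ [i]); p \<in> cell (w @ [j])\<rbrakk> \<Longrightarrow>
   p \<in> joints {1..M} (\<lambda>i. cell (w @ [i]))"
  unfolding joints_def by blast

text \<open>New joints avoid the old boundary. Hence a boundary point is handed down to one child
  only, and the number of cells of a level containing it never grows.\<close>

lemma bd_one_child:
  "\<lbrakk>p \<in> bd w; i \<in> {1..M}; j \<in> {1..M}; p \<in> cell (w @ [i]); p \<in> cell (w @ [j])\<rbrakk> \<Longrightarrow> i = j"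
  using in_joints[of i j p] split_facts(5) by blast

lemma in_child: "p \<in> cell w \<Longrightarrow> \<exists>i\<in>{1..M}. p \<in> cell (w @ [i])"
  using split_facts(1) by blast

end

lemma cell_append_subset:
  "\<lbrakk>u \<in> lists {1..M}; v \<in> lists {1..M}\<rbrakk> \<Longrightarrow> cell (u @ v) \<subseteq> cell u"
proof (induction v rule: rev_induct)
  case (snoc i v)
  then have "cell ((u @ v) @ [i]) \<subseteq> cell (u @ v)" by (intro cell_snoc_subset) auto
  then show ?case using snoc by auto
qed simp

text \<open>Siblings meet in new joints, by the split; other cells meet where their parents do, and
  \<open>bd\<close> inherits the old boundary.\<close>

lemma cells_meet:
  "\<lbrakk>u \<in> words M k; v \<in> words M k; u \<noteq> v\<rbrakk> \<Longrightarrow>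
     cell u \<inter> cell v \<subseteq> bd u \<and> (\<exists>z. cell u \<inter> cell v \<subseteq> {z})"
proof (induction k arbitrary: u v)
  case 0 then show ?case by (simp add: words_0)
next
  case (Suc k)
  obtain u' i where u: "u = u' @ [i]" "u' \<in> words M k" "i \<in> {1..M}"
    using Suc.prems(1) unfolding words_Suc by blast
  obtain v' j where v: "v = v' @ [j]" "v' \<in> words M k" "j \<in> {1..M}"
    using Suc.prems(2) unfolding words_Suc by blast
  have l: "u' \<in> lists {1..M}" "v' \<in> lists {1..M}" using u v words_lists by auto
  show ?case
  proof (cases "u' = v'")
    case True
    then have ij: "i \<noteq> j" using u v Suc.prems(3) by auto
    have "cell u \<inter> cell v \<subseteq> bd u"
      using in_joints[OF l(1) u(3) v(3) ij] True u v by (auto simp: bd_snoc)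
    then show ?thesis using split_facts(4)[OF l(1) u(3) v(3) ij] True u v by simp
  next
    case False
    note IH = Suc.IH[OF u(2) v(2) False]
    have "cell u \<subseteq> cell u'" "cell v \<subseteq> cell v'"
      using cell_snoc_subset l u v by auto
    then show ?thesis using IH u(1) by (auto simp: bd_snoc) blast
  qed
qed

text \<open>Three distinct parents are excluded by induction, a common parent by the split. If
  exactly two of the cells are siblings, the third parent puts the point on the boundary of their
  parent, and such a point has only one child.\<close>

lemma cells_triple:
  "\<lbrakk>u \<in> words M k; v \<in> words M k; w \<in> words M k; u \<noteq> v; v \<noteq> w; u \<noteq> w\<rbrakk> \<Longrightarrow>
     cell u \<inter> cell v \<inter> cell w = {}"
proof (induction k arbitrary: u v w)
  case 0 then show ?case by (simp add: words_0)
next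
  case (Suc k)
  obtain u' i where u: "u = u' @ [i]" "u' \<in> words M k" "i \<in> {1..M}"
    using Suc.prems(1) unfolding words_Suc by blast
  obtain v' j where v: "v = v' @ [j]" "v' \<in> words M k" "j \<in> {1..M}"
    using Suc.prems(2) unfolding words_Suc by blast
  obtain w' l where w: "w = w' @ [l]" "w' \<in> words M k" "l \<in> {1..M}"
    using Suc.prems(3) unfolding words_Suc by blast
  have L: "u' \<in> lists {1..M}" "v' \<in> lists {1..M}" "w' \<in> lists {1..M}" using u v w words_lists by auto
  have sub: "cell u \<subseteq> cell u'" "cell v \<subseteq> cell v'" "cell w \<subseteq> cell w'"
    using cell_snoc_subset L u v w by auto
  have two: "a = b" if "p \<in> cell (x @ [a])" "p \<in> cell (x @ [b])" "p \<in> cell y" "x \<in> words M k"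
    "y \<in> words M k" "x \<noteq> y" "a \<in> {1..M}" "b \<in> {1..M}" for p x y a b
  proof -
    have x: "x \<in> lists {1..M}" using that words_lists by auto
    have "p \<in> cell x" using cell_snoc_subset[OF x that(7)] that(1) by blast
    then have "p \<in> bd x" using cells_meet[OF that(4,5,6)] that(3) by blast
    then show ?thesis using bd_one_child[OF x _ that(7,8,1,2)] by blast
  qed
  show ?case
  proof (rule ccontr)
    assume "\<not> ?thesis"
    then obtain p where p: "p \<in> cell u" "p \<in> cell v" "p \<in> cell w" by blast
    then have p': "p \<in> cell u'" "p \<in> cell v'" "p \<in> cell w'" using sub by auto
    have "u' = v' \<or> v' = w' \<or> u' = w'" using Suc.IH[OF u(2) v(2) w(2)] p' by blast
    moreover have "False" if "u' = v'" "v' = w'"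
    proof -
      have "i \<noteq> j" "j \<noteq> l" "i \<noteq> l" using that u v w Suc.prems by auto
      then show False using split_triple[OF L(1) u(3) v(3) w(3)] p that u v w by auto
    qed
    moreover have "False" if "u' = v'" "v' \<noteq> w'"
      using two[of p u' i j w'] that u v w p p' Suc.prems by auto
    moreover have "False" if "v' = w'" "v' \<noteq> u'"
      using two[of p v' j l u'] that u v w p p' Suc.prems by auto
    moreover have "False" if "u' = w'" "v' \<noteq> u'"
      using two[of p u' i l v'] that u v w p p' Suc.prems by auto
    ultimately show False by blast
  qed
qed

lemma cells_cover: "(\<Union>w\<in>words M k. cell w) = X"
proof (induction k)
  case (Suc k)
  have "(\<Union>w\<in>words M (Suc k). cell w) = (\<Union>w\<in>words M k. \<Union>i\<in>{1..M}. cell (w @ [i]))"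
    unfolding words_Suc by blast
  also have "\<dots> = (\<Union>w\<in>words M k. cell w)"
    using split_facts(1) words_lists by (intro SUP_cong) auto
  finally show ?case using Suc by simp
qed (simp add: words_0)

lemma dm_cell_le: "w \<in> words M k \<Longrightarrow> dm (cell w) \<le> dm X / 4 ^ k"
proof (induction k arbitrary: w)
  case (Suc k)
  then obtain u i where u: "w = u @ [i]" "u \<in> words M k" "i \<in> {1..M}"
    unfolding words_Suc by blast
  have "dm (cell w) \<le> dm (cell u) / 4" using split_facts(3) u words_lists by auto
  also have "\<dots> \<le> dm X / 4 ^ k / 4" using Suc.IH[OF u(2)] by simp
  finally show ?case by (simp add: mult.commute)
qed (simp add: words_0)

section \<open>The intersection graphs of the cells\<close>

definition T :: "nat \<Rightarrow> nat list pair_pre_digraph" where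
  "T k = \<lparr>pverts = words M k,
     parcs = {(u, v). u \<in> words M k \<and> v \<in> words M k \<and> u \<noteq> v \<and> cell u \<inter> cell v \<noteq> {}}\<rparr>"

lemma pverts_T [simp]: "pverts (T k) = words M k" by (simp add: T_def)

lemma parcs_T: "(u, v) \<in> parcs (T k) \<longleftrightarrow>
    u \<in> words M k \<and> v \<in> words M k \<and> u \<noteq> v \<and> cell u \<inter> cell v \<noteq> {}"
  by (simp add: T_def)

lemma pair_graph_T: "pair_graph (T k)"
proof
  show "finite (parcs (T k))"
    by (rule finite_subset[of _ "words M k \<times> words M k"]) (auto simp: parcs_T finite_words)
  show "symmetric (with_proj (T k))"
    by (auto simp: symmetric_def sym_def parcs_T)
qed (auto simp: parcs_T finite_words)

lemma T_reachable:
  assumes "u \<in> words M k" "v \<in> words M k"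
  shows "(u, v) \<in> rtrancl_on (words M k) (parcs (T k))"
proof (rule closed_cover_connected[where c = cell])
  show "connected (\<Union>i\<in>words M k. cell i)"
    unfolding cells_cover by (rule cvx_connected[OF cvx_X])
qed (use assms finite_words words_lists closed_cell cell_nonempty in \<open>auto simp: parcs_T\<close>)

text \<open>The common point \<open>p\<close> of two adjacent cells lies in no other cell of the level, so every other chain of
  cells starting at \<open>u\<close> stays on one side of \<open>p\<close>.\<close>

lemma T_bridge:
  assumes uv: "(u, v) \<in> parcs (T k)"
  shows "(u, v) \<notin> (parcs (T k) - {(u, v), (v, u)})\<^sup>*"
proof
  assume path: "(u, v) \<in> (parcs (T k) - {(u, v), (v, u)})\<^sup>*"
  have W: "u \<in> words M k" "v \<in> words M k" "u \<noteq> v" using uv by (auto simp: parcs_T)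
  obtain p where p: "cell u \<inter> cell v = {p}"
    using cells_meet[OF W] uv by (auto simp: parcs_T)
  have pX: "p \<in> X" using p cell_X[OF words_lists[OF W(1)]] by blast
  \<comment> \<open>The invariant of a walk that does not use the edge between \<open>u\<close> and
    \<open>v\<close>: points of its cells other than \<open>p\<close> are joined to the cell of
    \<open>u\<close> by segments missing \<open>p\<close>.\<close>
  define near where "near y \<longleftrightarrow> y \<in> words M k \<and> y \<noteq> v \<and>
      (\<forall>z\<in>cell y - {p}. \<exists>a\<in>cell u - {p}. p \<notin> seg a z)" for y
  have near_u: "near u"
    unfolding near_def
  proof (intro conjI ballI)
    fix z assume z: "z \<in> cell u - {p}"
    then have "seg z z = {z}" using cell_X[OF words_lists[OF W(1)]] by (intro seg_refl) auto
    then show "\<exists>a\<in>cell u - {p}. p \<notin> seg a z" using z by (intro bexI[of _ z]) auto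
  qed (use W in auto)
  have "near v"
    using path
  proof (induction rule: rtrancl_induct)
    case base show ?case by (rule near_u)
  next
    case (step y y')
    have yy: "y \<in> words M k" "y' \<in> words M k" "y \<noteq> y'" "cell y \<inter> cell y' \<noteq> {}"
      using step(2) by (auto simp: parcs_T)
    obtain q where q: "q \<in> cell y" "q \<in> cell y'" using yy by blast
    \<comment> \<open>The removed edge is the only one with \<open>p\<close> in both cells, so the
      step from \<open>y\<close> to \<open>y'\<close> happens at a point \<open>q\<close> other than
      \<open>p\<close>.\<close>
    have pyy: "p \<notin> cell y \<or> p \<notin> cell y'"
    proof (rule ccontr)
      assume "\<not> ?thesis"
      then have pc: "p \<in> cell y" "p \<in> cell y'" "p \<in> cell u" "p \<in> cell v" using p by auto
      have "y = u \<or> y = v" using cells_triple[OF yy(1) W(1,2)] W(3) pc by blast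
      moreover have "y' = u \<or> y' = v" using cells_triple[OF yy(2) W(1,2)] W(3) pc by blast
      ultimately show False using step(2) yy(3) by auto
    qed
    then have "q \<noteq> p" using q by auto
    then obtain a where a: "a \<in> cell u" "a \<noteq> p" "p \<notin> seg a q"
      using step(3) q(1) unfolding near_def by blast
    have y'v: "y' \<noteq> v"
    proof
      assume "y' = v"
      then have "p \<in> seg a q"
        using cvx_meet_seg[OF _ _ _ _ p a(1)] q W words_lists cvx_cell closed_cell by auto
      then show False using a by blast
    qed
    show ?case
    proof (cases "y' = u")
      case True then show ?thesis using near_u by simp
    next
      case False
      have "p \<notin> cell y'" using cells_triple[OF yy(2) W(1,2) False] y'v W(3) p by blast
      moreover have "p \<notin> seg a z" if z: "z \<in> cell y'" for z
      proof -
        have l: "y' \<in> lists {1..M}" "u \<in> lists {1..M}" using yy W words_lists by auto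
        have "seg q z \<subseteq> cell y'" using cvx_cell[OF l(1)] q(2) z unfolding cvx_def by blast
        moreover have "seg a z \<subseteq> seg a q \<union> seg q z"
          using seg_triangle[of a q z] cell_X[OF l(1)] cell_X[OF l(2)] a q z by blast
        ultimately show ?thesis using a(3) \<open>p \<notin> cell y'\<close> by blast
      qed
      ultimately show ?thesis unfolding near_def using yy(2) y'v a by blast
    qed
  qed
  then show False by (simp add: near_def)
qed

lemma combinatorial_tree_T: "combinatorial_tree (T k)"
  by (rule pair_graph.combinatorial_treeI[OF pair_graph_T]) (use T_bridge T_reachable in auto)

lemma combinatorial_data_T: "combinatorial_data M T"
  unfolding combinatorial_data_def
proof (intro conjI allI ballI impI)
  show "2 \<le> M" by (rule M2)
  fix k
  show "pair_graph (T k)" by (rule pair_graph_T)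
  show "pverts (T k) = words M k" by simp
  have "replicate k 1 \<in> words M k" using M2 by (auto simp: words_def)
  then show "Digraph_Component.connected (with_proj (T k))"
    by (intro digraph_connectedI) (use T_reachable in auto)
next
  fix k w assume w: "w \<in> words M k"
  then have wl: "w \<in> lists {1..M}" by (rule words_lists)
  define V where "V = {w @ [i] | i. i \<in> {1..M}}"
  have V: "V \<subseteq> words M (Suc k)" unfolding V_def words_Suc using w by blast
  have Vi: "V = (\<lambda>i. w @ [i]) ` {1..M}" unfolding V_def by blast
  let ?H = "induce_subgraph (with_proj (T (Suc k))) V"
  have "Digraph_Component.connected ?H"
  proof (rule digraph_connectedI)
    show "verts ?H \<noteq> {}" using M2 by (auto simp: Vi)
    fix a b assume ab: "a \<in> verts ?H" "b \<in> verts ?H"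
    have "(\<Union>i\<in>V. cell i) = cell w" using split_facts(1)[OF wl] by (simp add: Vi)
    then have con: "connected (\<Union>i\<in>V. cell i)" using cvx_connected[OF cvx_cell[OF wl]] by simp
    have "(a, b) \<in> rtrancl_on V (arcs_ends ?H)"
    proof (rule closed_cover_connected[OF _ _ _ _ _ con])
      show "finite V" by (simp add: Vi)
      fix i assume "i \<in> V"
      then have "i \<in> lists {1..M}" using V words_lists by blast
      then show "closed (cell i)" "cell i \<noteq> {}" using closed_cell cell_nonempty by auto
      fix j assume ij: "j \<in> V" "i \<noteq> j" "cell i \<inter> cell j \<noteq> {}"
      then have "(i, j) \<in> parcs (T (Suc k))" using V \<open>i \<in> V\<close> by (auto simp: parcs_T)
      then show "(i, j) \<in> arcs_ends ?H" using ij \<open>i \<in> V\<close> by (auto simp: arcs_ends_conv intro!: image_eqI[of _ _ "(i, j)"])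
    qed (use ab in auto)
    then show "(a, b) \<in> rtrancl_on (verts ?H) (arcs_ends ?H)" by simp
  qed
  then show "Digraph_Component.connected
      (induce_subgraph (with_proj (T (Suc k))) {w @ [i] | i. i \<in> alphabet M})" by (simp add: V_def)
next
  fix k w u assume wu: "(w, u) \<in> parcs (T k)"
  then have W: "w \<in> words M k" "u \<in> words M k" "w \<noteq> u" by (auto simp: parcs_T)
  obtain p where p: "p \<in> cell w" "p \<in> cell u" using wu by (auto simp: parcs_T)
  obtain i j where "i \<in> {1..M}" "p \<in> cell (w @ [i])" "j \<in> {1..M}" "p \<in> cell (u @ [j])"
    using in_child[OF words_lists[OF W(1)] p(1)] in_child[OF words_lists[OF W(2)] p(2)] by blast
  then show "\<exists>i\<in>alphabet M. \<exists>j\<in>alphabet M. (w @ [i], u @ [j]) \<in> parcs (T (Suc k))"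
    using W by (intro bexI[of _ i] bexI[of _ j]) (auto simp: parcs_T words_Suc)
qed

section \<open>Infinite words as addresses of points\<close>

lemma initial_lists: "x \<in> inf_words M \<Longrightarrow> initial x n \<in> lists {1..M}"
  using initial_words words_lists by blast

lemma letter: "x \<in> inf_words M \<Longrightarrow> x n \<in> {1..M}"
  by (simp add: inf_words_def)

lemma initial_split: "m \<le> n \<Longrightarrow> initial x n = initial x m @ drop m (initial x n)"
  using take_initial[of m n x] append_take_drop_id[of m "initial x n"] by simp

lemma cell_initial_antimono:
  assumes "x \<in> inf_words M" "m \<le> n"
  shows "cell (initial x n) \<subseteq> cell (initial x m)"
proof -
  have "initial x m @ drop m (initial x n) \<in> lists {1..M}"
    using initial_lists[OF assms(1), of n] initial_split[OF assms(2), of x] by simp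
  then have "cell (initial x m @ drop m (initial x n)) \<subseteq> cell (initial x m)"
    by (intro cell_append_subset) auto
  then show ?thesis using initial_split[OF assms(2), of x] by simp
qed

lemma dm_initial_small:
  assumes "0 < e"
  obtains n where "k \<le> n" "\<And>x. x \<in> inf_words M \<Longrightarrow> dm (cell (initial x n)) < e"
proof -
  obtain m where m: "dm X / e < 4 ^ m" using real_arch_pow[of 4 "dm X / e"] by auto
  have "(4::real) ^ m \<le> 4 ^ max k m" by (intro power_increasing) auto
  then have "dm X / e < 4 ^ max k m" using m by linarith
  then have "dm X / 4 ^ max k m < e" using assms by (simp add: field_simps)
  then show ?thesis using that[of "max k m"] dm_cell_le[OF initial_words, of _ "max k m"]
    by (meson max.cobounded1 order_le_less_trans)
qed

definition pt :: "(nat \<Rightarrow> nat) \<Rightarrow> 'e" where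
  "pt x = (SOME p. \<forall>n. p \<in> cell (initial x n))"

lemma pt_mem:
  assumes "x \<in> inf_words M"
  shows "pt x \<in> cell (initial x n)"
proof -
  have "X \<inter> (\<Inter>n\<in>UNIV. cell (initial x n)) \<noteq> {}"
  proof (rule compact_imp_fip_image[OF compact_X])
    fix I' :: "nat set" assume I': "finite I'" "I' \<subseteq> UNIV"
    have "cell (initial x (Max (insert 0 I'))) \<subseteq> X \<inter> (\<Inter>i\<in>I'. cell (initial x i))"
      using cell_initial_antimono[OF assms] cell_X[OF initial_lists[OF assms]] I'
      by (simp add: subset_iff) (metis Max_ge Max_insert2 finite_insert insertCI zero_le)
    then show "X \<inter> (\<Inter>i\<in>I'. cell (initial x i)) \<noteq> {}"
      using cell_nonempty[OF initial_lists[OF assms]] by blast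
  qed (use closed_cell[OF initial_lists[OF assms]] in auto)
  then have "\<exists>p. \<forall>n. p \<in> cell (initial x n)" by blast
  then have "\<forall>n. pt x \<in> cell (initial x n)" unfolding pt_def by (rule someI_ex)
  then show ?thesis by blast
qed

lemma pt_X: "x \<in> inf_words M \<Longrightarrow> pt x \<in> X"
  using pt_mem[of x 0] by (simp add: initial_def)

lemma rho_initial:
  assumes "x \<in> inf_words M" "p \<in> cell (initial x n)" "q \<in> cell (initial x n)"
  shows "rho p q \<le> dm (cell (initial x n))"
  using assms cell_X[OF initial_lists] by (intro rho_le_dm) auto

lemma pt_eqI:
  assumes x: "x \<in> inf_words M" and p: "\<And>n. p \<in> cell (initial x n)"
  shows "pt x = p"
proof (rule ccontr)
  assume "pt x \<noteq> p"
  moreover have "p \<in> X" using p[of 0] by (simp add: initial_def)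
  ultimately have "0 < rho (pt x) p" using pt_X[OF x] by (intro rho_pos) auto
  then obtain n where "dm (cell (initial x n)) < rho (pt x) p" using dm_initial_small[of _ 0] x by metis
  then show False using rho_initial[OF x pt_mem[OF x, of n] p[of n]] by simp
qed

lemma inf_words_from_sub: "x \<in> inf_words_from M u \<Longrightarrow> x \<in> inf_words M"
  by (simp add: inf_words_from_def)

lemma inf_words_from_lists: "x \<in> inf_words_from M u \<Longrightarrow> u \<in> lists {1..M}"
  using initial_lists[of x "length u"] by (auto simp: inf_words_from_def)

lemma pt_from: "x \<in> inf_words_from M u \<Longrightarrow> pt x \<in> cell u"
  using pt_mem[of x "length u"] by (simp add: inf_words_from_def)

text \<open>A child containing \<open>p\<close> is chosen again and again, starting at
  \<open>v\<close>. Points in two cells have several addresses, so the cylinder is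
  prescribed.\<close>

lemma address_exists:
  assumes v: "v \<in> lists {1..M}" and p: "p \<in> cell v"
  obtains x where "x \<in> inf_words_from M v" "\<And>n. p \<in> cell (initial x n)" "pt x = p"
proof -
  define P where "P n w \<longleftrightarrow> w \<in> words M (length v + n) \<and> p \<in> cell w \<and> (n = 0 \<longrightarrow> w = v)" for n w
  have "\<exists>f. \<forall>n. P n (f n) \<and> (\<exists>i. f (Suc n) = f n @ [i])"
  proof (rule dependent_nat_choice)
    show "\<exists>w. P 0 w" using v p by (auto simp: P_def words_def)
    fix w n assume w: "P n w"
    then have "w \<in> lists {1..M}" "p \<in> cell w" using words_lists by (auto simp: P_def)
    then obtain i where i: "i \<in> {1..M}" "p \<in> cell (w @ [i])" using in_child by blast
    then have "P (Suc n) (w @ [i])" using w by (auto simp: P_def words_Suc)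
    then show "\<exists>w'. P (Suc n) w' \<and> (\<exists>i. w' = w @ [i])" by blast
  qed
  then obtain f where f: "\<And>n. P n (f n)" "\<And>n. \<exists>i. f (Suc n) = f n @ [i]" by blast
  have len: "length (f n) = length v + n" for n using f(1)[of n] by (simp add: P_def words_def)
  have pre: "take (length v + m) (f (m + k)) = f m" for m k
  proof (induction k)
    case (Suc k)
    obtain i where "f (Suc (m + k)) = f (m + k) @ [i]" using f(2) by blast
    then show ?case using Suc len[of "m + k"] by simp
  qed (simp add: len)
  \<comment> \<open>The word \<open>f (Suc k)\<close> has length \<open>length v + Suc k\<close>, so
    its \<open>k\<close>-th letter exists even when \<open>v\<close> is empty.\<close>
  define x where "x k = f (Suc k) ! k" for k
  have nth: "f m ! k = f n ! k" if "m \<le> n" "k < length v + m" for m n k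
  proof -
    have "f m = take (length v + m) (f n)" using pre[of m "n - m"] that by simp
    then show ?thesis using that(2) by (metis nth_take)
  qed
  have ini: "initial x (length v + n) = f n" for n
  proof (rule nth_equalityI)
    fix k assume "k < length (initial x (length v + n))"
    then have k: "k < length v + n" by simp
    have "f (Suc k) ! k = f n ! k"
    proof (cases "Suc k \<le> n")
      case True then show ?thesis using nth[of "Suc k" n k] by simp
    next
      case False then show ?thesis using nth[of n "Suc k" k] k by simp
    qed
    then show "initial x (length v + n) ! k = f n ! k" using k by (simp add: initial_def x_def)
  qed (simp add: len)
  have xM: "x \<in> inf_words M"
  proof -
    have "x n \<in> {1..M}" for n
    proof -
      have "f (Suc n) \<in> lists {1..M}" "n < length (f (Suc n))"
        using f(1)[of "Suc n"] words_lists len by (auto simp: P_def)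
      then show ?thesis unfolding x_def by (meson in_listsD nth_mem)
    qed
    then show ?thesis by (simp add: inf_words_def)
  qed
  have "f 0 = v" using f(1)[of 0] by (simp add: P_def)
  then have "x \<in> inf_words_from M v" using xM ini[of 0] by (simp add: inf_words_from_def)
  moreover have pn: "p \<in> cell (initial x n)" for n
  proof -
    have "p \<in> cell (initial x (length v + n))" using ini f(1) by (simp add: P_def)
    then show ?thesis using cell_initial_antimono[OF xM, of n "length v + n"] by auto
  qed
  ultimately show ?thesis using that pt_eqI[OF xM pn] by blast
qed

text \<open>The adjacent cells of level \<open>n\<close> meet in a point of \<open>cell u\<close>
  whose distance from \<open>pt x\<close> is at most the diameter of the cell of
  \<open>initial x n\<close>; as \<open>n\<close> grows, closedness of \<open>cell u\<close>
  applies.\<close>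

lemma pt_limit:
  assumes x: "x \<in> inf_words M" and u: "u \<in> lists {1..M}"
    and adj: "\<And>n. k < n \<Longrightarrow> \<exists>v\<in>words_from M u n. (initial x n, v) \<in> parcs (T n)"
  shows "pt x \<in> cell u"
proof -
  have "\<exists>q\<in>cell u. dist q (pt x) < e" if e: "0 < e" for e
  proof -
    obtain n where n: "Suc k \<le> n" "dm (cell (initial x n)) < e" using dm_initial_small[OF e] x by metis
    then obtain v where v: "v \<in> words_from M u n" "(initial x n, v) \<in> parcs (T n)" using adj[of n] by auto
    then obtain q where q: "q \<in> cell (initial x n)" "q \<in> cell v" by (auto simp: parcs_T)
    have vw: "v \<in> lists {1..M}" "take (length u) v = u" using v by (auto simp: words_from_def words_def)
    then have "v = u @ drop (length u) v" by (metis append_take_drop_id)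
    then have "cell v \<subseteq> cell u" using cell_append_subset[OF u, of "drop (length u) v"] vw
      by (metis append_in_lists_conv)
    then have qu: "q \<in> cell u" using q by blast
    then have "dist q (pt x) \<le> rho q (pt x)" using cell_X[OF u] pt_X[OF x] by (intro dist_le_rho) auto
    also have "\<dots> \<le> dm (cell (initial x n))" using rho_initial[OF x q(1) pt_mem[OF x]] .
    finally show ?thesis using n(2) qu by (intro bexI[of _ q]) auto
  qed
  then show ?thesis using closed_approachable[OF closed_cell[OF u]] by blast
qed

lemma comb_inter_pt:
  assumes "x \<in> comb_inter M T u v" "u \<in> lists {1..M}" "v \<in> lists {1..M}"
  shows "x \<in> inf_words M" "pt x \<in> cell u" "pt x \<in> cell v"
proof -
  have "x \<in> inf_words M \<and> pt x \<in> cell u \<and> pt x \<in> cell v"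
    using assms(1) unfolding comb_inter_def mem_Collect_eq
  proof (elim disjE conjE)
    assume a: "x \<in> inf_words_from M u"
      "\<forall>n>max (length u) (length v). \<exists>w\<in>words_from M v n. (initial x n, w) \<in> parcs (T n)"
    then show ?thesis
      using inf_words_from_sub[OF a(1)] pt_from[OF a(1)] pt_limit[of x v "max (length u) (length v)"] assms(3) by blast
  next
    assume a: "x \<in> inf_words_from M v"
      "\<forall>n>max (length u) (length v). \<exists>w\<in>words_from M u n. (initial x n, w) \<in> parcs (T n)"
    then show ?thesis
      using inf_words_from_sub[OF a(1)] pt_from[OF a(1)] pt_limit[of x u "max (length u) (length v)"] assms(2) by blast
  qed
  then show "x \<in> inf_words M" "pt x \<in> cell u" "pt x \<in> cell v" by auto
qed

text \<open>Addresses of \<open>p\<close> through \<open>u\<close> and through \<open>v\<close> name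
  cells that share \<open>p\<close> at every level. The graphs have no loops, so the two addresses
  must differ; the distinct prefixes of length \<open>k\<close> ensure this.\<close>

lemma comb_inter_nonempty:
  assumes u: "u \<in> lists {1..M}" "v \<in> lists {1..M}" and p: "p \<in> cell u" "p \<in> cell v"
    and k: "k \<le> length u" "k \<le> length v" "take k u \<noteq> take k v"
  shows "comb_inter M T u v \<noteq> {}"
proof -
  obtain x where x: "x \<in> inf_words_from M u" "\<And>n. p \<in> cell (initial x n)"
    using address_exists[OF u(1) p(1)] by metis
  obtain y where y: "y \<in> inf_words_from M v" "\<And>n. p \<in> cell (initial y n)"
    using address_exists[OF u(2) p(2)] by metis
  have "\<exists>w\<in>words_from M v n. (initial x n, w) \<in> parcs (T n)" if n: "max (length u) (length v) < n" for n
  proof (intro bexI)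
    have xy: "initial x (length u) = u" "initial y (length v) = v" using x y by (auto simp: inf_words_from_def)
    then have "initial x k \<noteq> initial y k" using k take_initial by metis
    then have "initial x n \<noteq> initial y n" using take_initial[of k n] k n by (metis max_less_iff_conj order_trans less_imp_le_nat)
    moreover have "cell (initial x n) \<inter> cell (initial y n) \<noteq> {}" using x(2) y(2) by blast
    ultimately show "(initial x n, initial y n) \<in> parcs (T n)"
      using x(1) y(1) initial_words inf_words_from_sub unfolding parcs_T by blast
    show "initial y n \<in> words_from M v n"
      using xy n y initial_words inf_words_from_sub take_initial[of "length v" n y] by (auto simp: words_from_def)
  qed
  then have "x \<in> comb_inter M T u v" using x by (auto simp: comb_inter_def)
  then show ?thesis by blast
qed

lemma sibling_adjacent:
  assumes w: "w \<in> lists {1..M}" and i: "i \<in> {1..M}"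
  obtains j where "j \<in> {1..M}" "j \<noteq> i" "cell (w @ [i]) \<inter> cell (w @ [j]) \<noteq> {}"
proof -
  obtain j0 where j0: "j0 \<in> {1..M}" "j0 \<noteq> i"
    using that[of 1] that[of 2] M2 i by (cases "i = 1") auto
  define r where "r = {(a, b). b \<in> {1..M} \<and> a \<noteq> b \<and> cell (w @ [a]) \<inter> cell (w @ [b]) \<noteq> {}}"
  have "connected (\<Union>i\<in>{1..M}. cell (w @ [i]))"
    using split_facts(1)[OF w] cvx_connected[OF cvx_cell[OF w]] by simp
  then have "(i, j0) \<in> rtrancl_on {1..M} r"
    by (rule closed_cover_connected[rotated 5])
      (use i j0 w closed_cell cell_nonempty in \<open>auto simp: r_def\<close>)
  then have "(i, j0) \<in> r\<^sup>*" by (rule rtrancl_on_rtranclI)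
  then obtain j where "(i, j) \<in> r" using j0(2) by (metis converse_rtranclE)
  then show ?thesis using that unfolding r_def by blast
qed

lemma comb_inter_commute: "comb_inter M T u v = comb_inter M T v u"
  unfolding comb_inter_def by (simp add: max.commute disj_commute)

text \<open>For overlapping cylinders, even equal ones, \<open>initial x n\<close> is not its own
  neighbour. A sibling adjacent to it is the witness: it differs only in the last letter and hence
  still begins with the shorter word. Chains can thereby be concatenated.\<close>

lemma comb_inter_nested:
  assumes "x \<in> inf_words_from M u" "x \<in> inf_words_from M v"
  shows "comb_inter M T u v \<noteq> {}"
proof -
  have *: "comb_inter M T u v \<noteq> {}"
    if x: "x \<in> inf_words_from M u" "x \<in> inf_words_from M v" and le: "length u \<le> length v" for u v
  proof -
    have xM: "x \<in> inf_words M" using x inf_words_from_sub by blast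
    have "\<exists>w\<in>words_from M u n. (initial x n, w) \<in> parcs (T n)" if n: "max (length u) (length v) < n" for n
    proof -
      obtain m where m: "n = Suc m" "length u \<le> m" using n by (cases n) auto
      have ul: "take (length u) (initial x m) = u"
        using take_initial[OF m(2)] x by (simp add: inf_words_from_def)
      obtain j where j: "j \<in> {1..M}" "j \<noteq> x m" "cell (initial x m @ [x m]) \<inter> cell (initial x m @ [j]) \<noteq> {}"
        using sibling_adjacent[OF initial_lists[OF xM] letter[OF xM]] by metis
      have W: "initial x m @ [i] \<in> words M n" if "i \<in> {1..M}" for i
        unfolding m(1) words_Suc using initial_words[OF xM] that by blast
      have "(initial x n, initial x m @ [j]) \<in> parcs (T n)"
        using j W[OF j(1)] W[OF letter[OF xM]] unfolding parcs_T m(1) initial_Suc by auto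
      moreover have "initial x m @ [j] \<in> words_from M u n"
        using W[OF j(1)] ul m(2) by (simp add: words_from_def)
      ultimately show ?thesis by blast
    qed
    then have "x \<in> comb_inter M T u v" using x by (auto simp: comb_inter_def)
    then show ?thesis by blast
  qed
  show ?thesis
    using *[of u v] *[of v u] assms comb_inter_commute[of u v] by (cases "length u \<le> length v") auto
qed

lemma bd_persists:
  assumes x: "x \<in> inf_words M" and "m \<le> n" "p \<in> bd (initial x m)" "p \<in> cell (initial x n)"
  shows "p \<in> bd (initial x n)"
  using assms(2,4)
proof (induction n rule: dec_induct)
  case base then show ?case using assms(3) by simp
next
  case (step n)
  have "p \<in> cell (initial x n)" using step.prems cell_initial_antimono[OF x, of n "Suc n"] by auto
  then show ?case using step by (auto simp: initial_Suc bd_snoc)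
qed

lemma seg_joint:
  assumes w: "w \<in> lists {1..M}" and i: "i \<in> {1..M}" and a: "a \<in> cell (w @ [i])"
    and b: "b \<in> cell w" "b \<notin> cell (w @ [i])"
  obtains q where "q \<in> seg a b" "q \<in> cell (w @ [i])" "q \<in> joints {1..M} (\<lambda>i. cell (w @ [i]))"
proof -
  have aw: "a \<in> cell w" using cell_snoc_subset[OF w i] a by blast
  have s: "seg a b \<subseteq> (\<Union>i\<in>{1..M}. cell (w @ [i]))"
    unfolding split_facts(1)[OF w] using cvx_cell[OF w] aw b(1) unfolding cvx_def by blast
  have X: "a \<in> X" "b \<in> X" using aw b cell_X[OF w] by auto
  have cl: "closed (cell (w @ [j]))" if "j \<in> {1..M}" for j using w that by (intro closed_cell) auto
  obtain j q where "j \<in> {1..M}" "j \<noteq> i" "q \<in> seg a b" "q \<in> cell (w @ [i])" "q \<in> cell (w @ [j])"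
    using seg_crossing[of "{1..M}" "\<lambda>i. cell (w @ [i])" a b i] cl s X i a b by auto
  then show ?thesis using that[of q] in_joints[OF w i, of j q] by blast
qed

text \<open>In the smallest cell on the way to \<open>x\<close> that contains \<open>p\<close>, the
  point \<open>p\<close> is an old boundary point, and the segment from \<open>pt x\<close> to
  \<open>p\<close> leaves the next cell through a new joint \<open>q\<close>. Separation of
  \<open>q\<close> from \<open>p\<close> bounds the diameter of the cell. If \<open>p\<close> never
  drops out, cells below any \<open>e\<close> contain both points.\<close>

lemma near_boundary:
  assumes x: "x \<in> inf_words_from M v" and p: "p \<in> bd v" and e: "0 < e"
  obtains n where "length v \<le> n" "p \<in> cell (initial x n)"
    "dm (cell (initial x n)) \<le> 4 / sep_const M * rho (pt x) p + e"
proof -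
  have xM: "x \<in> inf_words M" and xv: "initial x (length v) = v" using x by (auto simp: inf_words_from_def)
  have vl: "v \<in> lists {1..M}" using inf_words_from_lists[OF x] .
  have pX: "p \<in> X" and pv: "p \<in> cell v" using p bd_subset[OF vl] cell_X[OF vl] by auto
  have r: "0 \<le> 4 / sep_const M * rho (pt x) p"
    using rho_nonneg[OF pt_X[OF xM] pX] sep_const_pos[of M] by simp
  show ?thesis
  proof (cases "\<forall>n. p \<in> cell (initial x n)")
    case True
    obtain n where "length v \<le> n" "dm (cell (initial x n)) < e" using dm_initial_small[OF e] xM by metis
    then show ?thesis using that[of n] True r by auto
  next
    case False
    \<comment> \<open>The first level that loses \<open>p\<close>. It exceeds
      \<open>length v\<close>, so level \<open>m - 1\<close> is the cell in question.\<close>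
    define m where "m = (LEAST n. p \<notin> cell (initial x n))"
    have m: "p \<notin> cell (initial x m)" unfolding m_def by (rule LeastI_ex) (use False in blast)
    have below: "p \<in> cell (initial x n)" if "n < m" for n using not_less_Least that unfolding m_def by blast
    have "length v < m"
    proof (rule ccontr)
      assume "\<not> ?thesis"
      then show False using m pv xv cell_initial_antimono[OF xM, of m "length v"] by auto
    qed
    then obtain n where n: "m = Suc n" "length v \<le> n" by (cases m) auto
    let ?w = "initial x n"
    have w: "?w \<in> lists {1..M}" by (rule initial_lists[OF xM])
    have pw: "p \<in> cell ?w" using below n by simp
    have pb: "p \<in> bd ?w" using bd_persists[OF xM n(2) _ pw] p xv by simp
    have px: "pt x \<in> cell (?w @ [x n])" using pt_mem[OF xM, of "Suc n"] by (simp add: initial_Suc)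
    have pn: "p \<notin> cell (?w @ [x n])" using m n by (simp add: initial_Suc)
    obtain q where q: "q \<in> seg (pt x) p" "q \<in> joints {1..M} (\<lambda>i. cell (?w @ [i]))"
      using seg_joint[OF w letter[OF xM] px pw pn] by metis
    have "q \<noteq> p" using split_facts(5)[OF w] q(2) pb by blast
    then have "sep_const M * (dm (cell ?w) / 4) \<le> rho q p"
      using separatedD[OF split_facts(6)[OF w], of q p] q(2) pb by blast
    also have "\<dots> \<le> rho (pt x) p"
      using q(1) seg_right[OF pt_X[OF xM] pX] by (intro rho_mono pt_X[OF xM] pX)
    finally have "dm (cell ?w) \<le> 4 / sep_const M * rho (pt x) p"
      using sep_const_pos[of M] by (simp add: field_simps)
    then show ?thesis using that[of n] n(2) pw e by simp
  qed
qed

subsection \<open>The chain distance\<close>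

abbreviation linked :: "nat list \<Rightarrow> nat list \<Rightarrow> bool" where
  "linked u v \<equiv> comb_inter M T u v \<noteq> {}"

lemma chain_joining_iff:
  "chain_joining M T x y vs \<longleftrightarrow> vs \<noteq> [] \<and> set vs \<subseteq> lists {1..M} \<and>
     x \<in> inf_words_from M (hd vs) \<and> y \<in> inf_words_from M (last vs) \<and> successively linked vs"
  unfolding chain_joining_def successively_conv_nth by auto

lemma chain_append:
  assumes "chain_joining M T x y us" "chain_joining M T y z vs"
  shows "chain_joining M T x z (us @ vs)"
proof -
  have "linked (last us) (hd vs)"
    using assms comb_inter_nested[of y] unfolding chain_joining_iff by blast
  then show ?thesis using assms unfolding chain_joining_iff by (auto simp: successively_append_iff)
qed

text \<open>Consecutive cells of a chain share the point coded by any word of their combinatorial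
  intersection, so the triangle inequality can be applied along the chain.\<close>

lemma chain_rho:
  assumes "vs \<noteq> []" "set vs \<subseteq> lists {1..M}" "successively linked vs"
    "p \<in> cell (hd vs)" "q \<in> cell (last vs)"
  shows "rho p q \<le> (\<Sum>v\<leftarrow>vs. dm (cell v))"
  using assms
proof (induction vs arbitrary: p)
  case (Cons v vs)
  have v: "v \<in> lists {1..M}" and vX: "cell v \<subseteq> X" using Cons.prems(2) cell_X by auto
  show ?case
  proof (cases "vs = []")
    case True
    then show ?thesis using Cons.prems vX by (simp add: rho_le_dm)
  next
    case False
    then obtain v' vs' where vs: "vs = v' # vs'" by (cases vs) auto
    then obtain x where x: "x \<in> comb_inter M T v v'" using Cons.prems(3) by auto
    have v': "v' \<in> lists {1..M}" using Cons.prems(2) vs by auto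
    have z: "pt x \<in> cell v" "pt x \<in> cell v'" using comb_inter_pt[OF x v v'] by auto
    have "successively linked vs" using Cons.prems(3) vs by auto
    then have "rho (pt x) q \<le> (\<Sum>v\<leftarrow>vs. dm (cell v))"
      using Cons.IH[of "pt x"] Cons.prems vs z by auto
    moreover have "rho p (pt x) \<le> dm (cell v)" using rho_le_dm[OF vX] Cons.prems z by simp
    moreover have "last vs \<in> lists {1..M}" using Cons.prems(2) False by (simp add: subset_iff)
    then have "q \<in> X" using cell_X Cons.prems(5) False by auto
    then have "rho p q \<le> rho p (pt x) + rho (pt x) q"
      using rho_triangle[of p "pt x" q] vX z Cons.prems by auto
    ultimately show ?thesis by simp
  qed
qed simp

text \<open>The weight is arbitrary but positive here, because two weights are needed:
  \<open>delta\<close> for proper trees and \<open>K1 ^ length w\<close> for the one-point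
  tree.\<close>

context
  fixes \<Delta> :: "nat list \<Rightarrow> real"
  assumes \<Delta>_pos: "\<And>w. w \<in> lists {1..M} \<Longrightarrow> 0 < \<Delta> w"
begin

abbreviation D :: "(nat \<Rightarrow> nat) \<Rightarrow> (nat \<Rightarrow> nat) \<Rightarrow> real" where
  "D \<equiv> chain_pdist M T \<Delta>"

lemma sum_nonneg_chain: "set vs \<subseteq> lists {1..M} \<Longrightarrow> 0 \<le> (\<Sum>v\<leftarrow>vs. \<Delta> v)"
  by (rule sum_list_nonneg) (use \<Delta>_pos in \<open>fastforce intro: less_imp_le\<close>)

lemma D_le: "chain_joining M T x y vs \<Longrightarrow> D x y \<le> (\<Sum>v\<leftarrow>vs. \<Delta> v)"
  unfolding chain_pdist_def
proof (rule cINF_lower)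
  show "bdd_below ((\<lambda>vs. \<Sum>v\<leftarrow>vs. \<Delta> v) ` {vs. chain_joining M T x y vs})"
    by (rule bdd_belowI2[of _ 0]) (rule sum_nonneg_chain, simp add: chain_joining_iff)
qed simp

lemma D_ge:
  assumes "x \<in> inf_words M" "y \<in> inf_words M"
    and "\<And>vs. chain_joining M T x y vs \<Longrightarrow> c \<le> (\<Sum>v\<leftarrow>vs. \<Delta> v)"
  shows "c \<le> D x y"
  unfolding chain_pdist_def
proof (rule cINF_greatest)
  have "chain_joining M T x y [[]]"
    using assms by (simp add: chain_joining_iff inf_words_from_def initial_def)
  then show "{vs. chain_joining M T x y vs} \<noteq> {}" by blast
qed (use assms in auto)

lemma D_nonneg: "\<lbrakk>x \<in> inf_words M; y \<in> inf_words M\<rbrakk> \<Longrightarrow> 0 \<le> D x y"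
  by (rule D_ge) (simp_all add: chain_joining_iff sum_nonneg_chain del: One_nat_def)

lemma D_triangle:
  assumes "x \<in> inf_words M" "y \<in> inf_words M" "z \<in> inf_words M"
  shows "D x z \<le> D x y + D y z"
proof -
  have 1: "D x z - (\<Sum>v\<leftarrow>us. \<Delta> v) \<le> D y z" if us: "chain_joining M T x y us" for us
  proof (rule D_ge[OF assms(2,3)])
    fix vs assume "chain_joining M T y z vs"
    then have "D x z \<le> (\<Sum>v\<leftarrow>us @ vs. \<Delta> v)" by (intro D_le chain_append[OF us])
    then show "D x z - (\<Sum>v\<leftarrow>us. \<Delta> v) \<le> (\<Sum>v\<leftarrow>vs. \<Delta> v)" by simp
  qed
  have "D x z - D y z \<le> D x y"
  proof (rule D_ge[OF assms(1,2)])
    fix us assume "chain_joining M T x y us"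
    from 1[OF this] show "D x z - D y z \<le> (\<Sum>v\<leftarrow>us. \<Delta> v)" by linarith
  qed
  then show ?thesis by simp
qed

lemma rho_le_D:
  assumes x: "x \<in> inf_words M" "y \<in> inf_words M"
    and K: "0 < K" "\<And>w. w \<in> lists {1..M} \<Longrightarrow> dm (cell w) \<le> K * \<Delta> w"
  shows "rho (pt x) (pt y) \<le> K * D x y"
proof -
  have "rho (pt x) (pt y) / K \<le> D x y"
  proof (rule D_ge[OF x])
    fix vs assume vs: "chain_joining M T x y vs"
    then have "rho (pt x) (pt y) \<le> (\<Sum>v\<leftarrow>vs. dm (cell v))"
      using chain_rho[of vs] pt_from unfolding chain_joining_iff by blast
    also have "\<dots> \<le> (\<Sum>v\<leftarrow>vs. K * \<Delta> v)"
      using vs K(2) unfolding chain_joining_iff by (intro sum_list_mono) auto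
    also have "\<dots> = K * (\<Sum>v\<leftarrow>vs. \<Delta> v)" by (simp add: sum_list_const_mult)
    finally show "rho (pt x) (pt y) / K \<le> (\<Sum>v\<leftarrow>vs. \<Delta> v)" using K(1) by (simp add: field_simps)
  qed
  then show ?thesis using K(1) by (simp add: field_simps)
qed

text \<open>Every single chain has positive weight; the infimum vanishes because the cylinders
  around \<open>x\<close> have arbitrarily small weight.\<close>

lemma D_self:
  assumes x: "x \<in> inf_words M"
    and K: "0 < K" "\<And>w. w \<in> lists {1..M} \<Longrightarrow> \<Delta> w \<le> K * dm (cell w)"
  shows "D x x = 0"
proof -
  have "D x x \<le> 0 + e" if e: "0 < e" for e
  proof -
    obtain n where n: "dm (cell (initial x n)) < e / K" using dm_initial_small[of "e / K" 0] e K(1) x by auto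
    have "chain_joining M T x x [initial x n]"
      using x initial_lists by (simp add: chain_joining_iff inf_words_from_def)
    then have "D x x \<le> \<Delta> (initial x n)" using D_le by fastforce
    also have "\<dots> \<le> K * dm (cell (initial x n))" by (rule K(2)[OF initial_lists[OF x]])
    finally show ?thesis using n K(1) by (simp add: field_simps)
  qed
  then have "D x x \<le> 0" by (rule field_le_epsilon)
  then show ?thesis using D_nonneg[OF x x] by simp
qed

text \<open>A single word suffices as a chain when the children are disjoint, and two words when
  they touch. Each word of the second chain costs \<open>4 * K / sep_const M\<close>, whence the
  factor \<open>8\<close>.\<close>

lemma D_le_rho:
  assumes x: "x \<in> inf_words M" and y: "y \<in> inf_words M"
    and K: "0 < K" "\<And>w. w \<in> lists {1..M} \<Longrightarrow> \<Delta> w \<le> K * dm (cell w)"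
  shows "D x y \<le> 8 * K / sep_const M * rho (pt x) (pt y)"
proof (cases "x = y")
  case True
  then show ?thesis using D_self[OF x K] pt_X[OF x] by (simp add: rho_refl)
next
  case False
  let ?s = "sep_const M" and ?r = "rho (pt x) (pt y)"
  have s: "0 < ?s" by (rule sep_const_pos)
  have X: "pt x \<in> X" "pt y \<in> X" using pt_X x y by auto
  have r: "0 \<le> ?r" using rho_nonneg[OF X] .
  define n where "n = (LEAST n. x n \<noteq> y n)"
  have n: "x n \<noteq> y n" unfolding n_def by (rule LeastI_ex) (use False in auto)
  have "x m = y m" if "m < n" for m using not_less_Least[of m "\<lambda>n. x n \<noteq> y n"] that unfolding n_def by blast
  then have w_eq: "initial y n = initial x n" by (simp add: initial_def)
  define w i j where "w = initial x n" and "i = x n" and "j = y n"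
  have w: "w \<in> lists {1..M}" and ij: "i \<in> {1..M}" "j \<in> {1..M}" "i \<noteq> j"
    using initial_lists[OF x] letter x y n by (auto simp: w_def i_def j_def)
  have wi: "w @ [i] = initial x (Suc n)" and wj: "w @ [j] = initial y (Suc n)"
    using w_eq by (auto simp: w_def i_def j_def initial_Suc)
  have px: "pt x \<in> cell (w @ [i])" and py: "pt y \<in> cell (w @ [j])"
    unfolding wi wj using pt_mem x y by auto
  have pw: "pt x \<in> cell w" "pt y \<in> cell w"
    using px py cell_snoc_subset[OF w ij(1)] cell_snoc_subset[OF w ij(2)] by auto
  show ?thesis
  proof (cases "cell (w @ [i]) \<inter> cell (w @ [j]) = {}")
    case True
    have pn: "pt y \<notin> cell (w @ [i])" "pt x \<notin> cell (w @ [j])" using True px py by auto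
    obtain q where q: "q \<in> seg (pt x) (pt y)" "q \<in> cell (w @ [i])"
        "q \<in> joints {1..M} (\<lambda>i. cell (w @ [i]))"
      using seg_joint[OF w ij(1) px pw(2) pn(1)] by blast
    obtain q' where q': "q' \<in> seg (pt y) (pt x)" "q' \<in> cell (w @ [j])"
        "q' \<in> joints {1..M} (\<lambda>i. cell (w @ [i]))"
      using seg_joint[OF w ij(2) py pw(1) pn(2)] by blast
    have "q \<noteq> q'" using q q' True by auto
    then have "?s * (dm (cell w) / 4) \<le> rho q q'"
      using separatedD[OF split_facts(6)[OF w], of q q'] q(3) q'(3) by blast
    also have "\<dots> \<le> ?r" using q(1) q'(1) seg_commute[OF X] by (intro rho_mono X) auto
    finally have "dm (cell w) \<le> 4 / ?s * ?r" using s by (simp add: field_simps)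
    then have "K * dm (cell w) \<le> K * (4 / ?s * ?r)" using K(1) by (intro mult_left_mono) auto
    also have "\<dots> \<le> 8 * K / ?s * ?r" using s K(1) r by (simp add: field_simps)
    finally have 1: "K * dm (cell w) \<le> 8 * K / ?s * ?r" .
    have "chain_joining M T x y [w]"
      using x y w w_eq by (simp add: chain_joining_iff inf_words_from_def w_def)
    then have "D x y \<le> \<Delta> w" using D_le by fastforce
    also have "\<dots> \<le> K * dm (cell w)" by (rule K(2)[OF w])
    finally show ?thesis using 1 by linarith
  next
    case False
    then obtain p where p: "p \<in> cell (w @ [i])" "p \<in> cell (w @ [j])" by blast
    have W: "w @ [i] \<in> words M (Suc n)" "w @ [j] \<in> words M (Suc n)" "w @ [i] \<noteq> w @ [j]"
      using initial_words[OF x, of "Suc n"] initial_words[OF y, of "Suc n"] ij(3)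
      unfolding wi[symmetric] wj[symmetric] by auto
    then have L: "w @ [i] \<in> lists {1..M}" "w @ [j] \<in> lists {1..M}" using words_lists by blast+
    have pp: "cell (w @ [i]) \<inter> cell (w @ [j]) = {p}" using cells_meet[OF W] p by blast
    have pb: "p \<in> bd (w @ [i])" "p \<in> bd (w @ [j])"
      using cells_meet[OF W] cells_meet[OF W(2,1) W(3)[symmetric]] p by blast+
    have pX: "p \<in> X" using p(1) cell_X[OF L(1)] by blast
    have pseg: "p \<in> seg (pt x) (pt y)"
      using cvx_meet_seg[OF cvx_cell[OF L(1)] cvx_cell[OF L(2)] closed_cell[OF L(1)] closed_cell[OF L(2)] pp px py] .
    have rx: "rho (pt x) p \<le> ?r" using pseg seg_left[OF X] by (intro rho_mono X) auto
    have ry: "rho (pt y) p \<le> ?r" using pseg seg_right[OF X] by (intro rho_mono X) auto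
    have xf: "x \<in> inf_words_from M (w @ [i])" and yf: "y \<in> inf_words_from M (w @ [j])"
      using x y unfolding wi wj by (auto simp: inf_words_from_def)
    have "D x y \<le> 8 * K / ?s * ?r + e" if e: "0 < e" for e
    proof -
      \<comment> \<open>Two cells are estimated with this error, each multiplied by
        \<open>K\<close>.\<close>
      define e' where "e' = e / (2 * K)"
      have e': "0 < e'" using e K(1) by (simp add: e'_def)
      obtain a where a: "length (w @ [i]) \<le> a" "p \<in> cell (initial x a)"
        "dm (cell (initial x a)) \<le> 4 / ?s * rho (pt x) p + e'"
        using near_boundary[OF xf pb(1) e'] by blast
      obtain b where b: "length (w @ [j]) \<le> b" "p \<in> cell (initial y b)"
        "dm (cell (initial y b)) \<le> 4 / ?s * rho (pt y) p + e'"
        using near_boundary[OF yf pb(2) e'] by blast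
      have len: "Suc n \<le> a" "Suc n \<le> b" using a(1) b(1) by (auto simp: w_def)
      have tk: "take (Suc n) (initial x a) \<noteq> take (Suc n) (initial y b)"
        using take_initial[OF len(1), of x] take_initial[OF len(2), of y] W(3) wi wj by simp
      have "linked (initial x a) (initial y b)"
        using comb_inter_nonempty[OF initial_lists[OF x] initial_lists[OF y] a(2) b(2), of "Suc n"] len tk by simp
      then have "chain_joining M T x y [initial x a, initial y b]"
        using x y initial_lists by (simp add: chain_joining_iff inf_words_from_def)
      then have "D x y \<le> \<Delta> (initial x a) + \<Delta> (initial y b)" using D_le by fastforce
      also have "\<dots> \<le> K * dm (cell (initial x a)) + K * dm (cell (initial y b))"
        using K(2)[OF initial_lists[OF x]] K(2)[OF initial_lists[OF y]] by (intro add_mono)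
      also have "\<dots> \<le> K * (4 / ?s * ?r + e') + K * (4 / ?s * ?r + e')"
      proof -
        have "4 / ?s * rho (pt x) p \<le> 4 / ?s * ?r" "4 / ?s * rho (pt y) p \<le> 4 / ?s * ?r"
          using rx ry s by (intro mult_left_mono; simp)+
        then show ?thesis using a(3) b(3) K(1) by (intro add_mono mult_left_mono) auto
      qed
      also have "\<dots> = 8 * K / ?s * ?r + e" using K(1) by (simp add: e'_def field_simps)
      finally show ?thesis .
    qed
    then show ?thesis by (rule field_le_epsilon)
  qed
qed

text \<open>The map \<open>f\<close> is any labelling of words that separates exactly the classes;
  \<open>pt\<close> and a constant map are both used. Independence of representatives, which gives
  \<open>THE\<close> its value, follows from the triangle inequality.\<close>

lemma chain_dist_class:
  assumes eq: "\<And>x y. \<lbrakk>x \<in> inf_words M; y \<in> inf_words M\<rbrakk> \<Longrightarrow> D x y = 0 \<longleftrightarrow> f x = f y"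
    and x: "x \<in> inf_words M" and y: "y \<in> inf_words M"
  shows "chain_class M T \<Delta> x = {u \<in> inf_words M. f u = f x}"
    and "chain_dist M T \<Delta> (chain_class M T \<Delta> x) (chain_class M T \<Delta> y) = D x y"
proof -
  have c: "chain_class M T \<Delta> z = {u \<in> inf_words M. f u = f z}" if "z \<in> inf_words M" for z
    using eq that by (auto simp: chain_class_def chain_rel_def)
  then show "chain_class M T \<Delta> x = {u \<in> inf_words M. f u = f x}" using x by blast
  have "D u v = D x y" if "u \<in> inf_words M" "v \<in> inf_words M" "f u = f x" "f v = f y" for u v
  proof -
    have "D u x = 0" "D x u = 0" "D y v = 0" "D v y = 0" using eq x y that by simp_all
    then show ?thesis
      using D_triangle[OF that(1) x that(2)] D_triangle[OF x y that(2)]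
        D_triangle[OF x that(1) y] D_triangle[OF that(1,2) y] by linarith
  qed
  then have *: "\<forall>u\<in>chain_class M T \<Delta> x. \<forall>v\<in>chain_class M T \<Delta> y. D u v = D x y"
    unfolding c[OF x] c[OF y] by blast
  have self: "x \<in> chain_class M T \<Delta> x" "y \<in> chain_class M T \<Delta> y"
    unfolding c[OF x] c[OF y] using x y by auto
  show "chain_dist M T \<Delta> (chain_class M T \<Delta> x) (chain_class M T \<Delta> y) = D x y"
    unfolding chain_dist_def
  proof (rule the_equality)
    show "\<forall>u\<in>chain_class M T \<Delta> x. \<forall>v\<in>chain_class M T \<Delta> y. D u v = D x y" by (rule *)
    fix r assume "\<forall>u\<in>chain_class M T \<Delta> x. \<forall>v\<in>chain_class M T \<Delta> y. D u v = r"
    then show "r = D x y" using self by metis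
  qed
qed

lemma bilipschitz_equivalent_chain_space:
  assumes eq: "\<And>x y. \<lbrakk>x \<in> inf_words M; y \<in> inf_words M\<rbrakk> \<Longrightarrow> D x y = 0 \<longleftrightarrow> f x = f y"
    and im: "f ` inf_words M = Y" and L: "1 \<le> L"
    and bl: "\<And>x y. \<lbrakk>x \<in> inf_words M; y \<in> inf_words M\<rbrakk> \<Longrightarrow>
       inverse L * D x y \<le> d (f x) (f y) \<and> d (f x) (f y) \<le> L * D x y"
  shows "bilipschitz_equivalent L (chain_space M T \<Delta>) (chain_dist M T \<Delta>) Y d"
proof -
  define F where "F P = f (SOME x. x \<in> P)" for P
  have cs: "chain_space M T \<Delta> = chain_class M T \<Delta> ` inf_words M"
    by (auto simp: chain_space_def chain_class_def quotient_def)
  have F: "F (chain_class M T \<Delta> x) = f x" if x: "x \<in> inf_words M" for x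
  proof -
    have "x \<in> chain_class M T \<Delta> x" using chain_dist_class(1)[OF eq x x] x by auto
    then have "(SOME u. u \<in> chain_class M T \<Delta> x) \<in> chain_class M T \<Delta> x"
      by (rule someI[of "\<lambda>u. u \<in> chain_class M T \<Delta> x"])
    then show ?thesis unfolding F_def using chain_dist_class(1)[OF eq x x] by auto
  qed
  have "F ` chain_space M T \<Delta> = Y" unfolding cs image_image im[symmetric] using F by (intro image_cong) auto
  moreover have "bilipschitz_map L (chain_space M T \<Delta>) (chain_dist M T \<Delta>) d F"
    unfolding bilipschitz_map_def cs
    using L bl F chain_dist_class(2)[OF eq] by auto
  ultimately show ?thesis unfolding bilipschitz_equivalent_def by blast
qed

end

text \<open>Sending a neighbour to a point shared with \<open>v\<close> is injective, since no point
  lies in three cells, and lands in \<open>bd v\<close>. Separation and doubling bound the size of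
  \<open>bd v\<close>.\<close>

lemma cond_P2_T: "\<exists>n0. cond_P2 T n0"
proof -
  define n0 where "n0 = N ^ doubling_exponent C (sep_const M)"
  have "card {u. (v, u) \<in> parcs (T k)} \<le> n0" if v: "v \<in> words M k" for v k
  proof -
    have vl: "v \<in> lists {1..M}" using v words_lists by blast
    have bX: "bd v \<subseteq> X" using bd_subset[OF vl] cell_X[OF vl] by blast
    have bc: "finite (bd v) \<and> card (bd v) \<le> n0"
      unfolding n0_def
      using card_separated[OF bX _ dm_cell_pos[OF vl] sep_const_pos separated_bd[OF vl]]
        rho_le_dm[OF cell_X[OF vl]] bd_subset[OF vl] by blast
    define g where "g u = (SOME p. p \<in> cell v \<inter> cell u)" for u
    have g: "g u \<in> cell v \<inter> cell u" "u \<in> words M k" "u \<noteq> v" if u: "(v, u) \<in> parcs (T k)" for u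
    proof -
      have "\<exists>p. p \<in> cell v \<inter> cell u" using u by (auto simp: parcs_T)
      then show "g u \<in> cell v \<inter> cell u" unfolding g_def by (rule someI_ex)
      show "u \<in> words M k" "u \<noteq> v" using u by (auto simp: parcs_T)
    qed
    have "inj_on g {u. (v, u) \<in> parcs (T k)}"
    proof (rule inj_onI, rule ccontr)
      fix a b assume "a \<in> {u. (v, u) \<in> parcs (T k)}" "b \<in> {u. (v, u) \<in> parcs (T k)}"
        and e: "g a = g b" "a \<noteq> b"
      then have ab: "(v, a) \<in> parcs (T k)" "(v, b) \<in> parcs (T k)" by auto
      then show False
        using cells_triple[OF v g(2)[OF ab(1)] g(2)[OF ab(2)]] g[OF ab(1)] g[OF ab(2)] e by auto
    qed
    moreover have "g ` {u. (v, u) \<in> parcs (T k)} \<subseteq> bd v"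
      using g cells_meet[OF v] by blast
    ultimately have "card {u. (v, u) \<in> parcs (T k)} \<le> card (bd v)" using bc by (intro card_inj_on_le) auto
    then show ?thesis using bc by simp
  qed
  then show ?thesis unfolding cond_P2_def by auto
qed

text \<open>The geometric content of P4: both points are boundary points of \<open>u\<close>, and
  they are distinct because a common one would lie in three cells.\<close>

lemma bd_two_points:
  assumes W: "u \<in> words M k" "u1 \<in> words M k" "u2 \<in> words M k" "u \<noteq> u1" "u \<noteq> u2" "u1 \<noteq> u2"
    and w: "w1 \<in> comb_inter M T u u1" "w2 \<in> comb_inter M T u u2"
  shows "w1 \<in> inf_words M" "w2 \<in> inf_words M"
    "sep_const M * dm (cell u) \<le> rho (pt w1) (pt w2)"
proof -
  have l: "u \<in> lists {1..M}" "u1 \<in> lists {1..M}" "u2 \<in> lists {1..M}" using W words_lists by auto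
  note c1 = comb_inter_pt[OF w(1) l(1,2)] and c2 = comb_inter_pt[OF w(2) l(1,3)]
  show "w1 \<in> inf_words M" "w2 \<in> inf_words M" using c1 c2 by auto
  have "pt w1 \<in> bd u" "pt w2 \<in> bd u"
    using cells_meet[OF W(1,2,4)] cells_meet[OF W(1,3,5)] c1 c2 by auto
  moreover have "pt w1 \<noteq> pt w2" using cells_triple[OF W(1-3,4,6,5)] c1 c2 by auto
  ultimately show "sep_const M * dm (cell u) \<le> rho (pt w1) (pt w2)"
    by (rule separatedD[OF separated_bd[OF l(1)]])
qed

end

section \<open>The diameter function\<close>

text \<open>In a one-point space all distances vanish, whereas P4 asks for a positive one as soon as
  some word meets two others; this explains the guard in front of P4.\<close>

definition has_tree_code ::
  "nat \<Rightarrow> real \<Rightarrow> real \<Rightarrow> real \<Rightarrow> 'b set \<Rightarrow> ('b \<Rightarrow> 'b \<Rightarrow> real) \<Rightarrow> bool" where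
  "has_tree_code M K1 K2 L Y d \<longleftrightarrow>
     (\<exists>T \<Delta>. combinatorial_data M T \<and> (\<forall>k. combinatorial_tree (T k)) \<and>
        \<Delta> \<in> diameter_functions M K1 K2 \<and>
        bilipschitz_equivalent L (chain_space M T \<Delta>) (chain_dist M T \<Delta>) Y d \<and>
        (\<exists>(N' :: nat) (n0 :: nat) (c :: real) (\<delta>1 :: real) (\<delta>2 :: real).
           1 < c \<and> 0 < \<delta>1 \<and> \<delta>1 < 1 \<and> 0 < \<delta>2 \<and> \<delta>2 < 1 \<and>
           cond_P1 M N' \<and> cond_P2 T n0 \<and> cond_P3 M \<Delta> \<delta>1 \<delta>2 \<and>
           ((\<exists>x\<in>Y. \<exists>y\<in>Y. x \<noteq> y) \<longrightarrow> cond_P4 M T \<Delta> c)))"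

lemma sep_const_less_1: "sep_const M < 1"
proof -
  have "1 / real (Suc M) \<le> 1" by (simp del: of_nat_Suc)
  then show ?thesis using sep_const_le(2)[of M] by linarith
qed

lemma diameter_functionsI:
  assumes K: "0 < K1" "K1 \<le> K2" "K2 < 1" and M: "1 \<le> M" and "\<Delta> [] = 1"
    and step: "\<And>w. w \<in> lists {1..M} \<Longrightarrow> \<exists>K\<in>{K1, K2}. \<forall>i\<in>{1..M}. \<Delta> (w @ [i]) = K * \<Delta> w"
  shows "\<Delta> \<in> diameter_functions M K1 K2"
    and "cond_P3 M \<Delta> K1 K2"
    and "\<And>w. w \<in> lists {1..M} \<Longrightarrow> 0 < \<Delta> w \<and> \<Delta> w \<le> K2 ^ length w"
proof -
  have b: "0 < \<Delta> w \<and> \<Delta> w \<le> K2 ^ length w" if "w \<in> lists {1..M}" for w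
    using that
  proof (induction w rule: rev_induct)
    case Nil then show ?case using assms by simp
  next
    case (snoc i w)
    then have w: "w \<in> lists {1..M}" "i \<in> {1..M}" and IH: "0 < \<Delta> w" "\<Delta> w \<le> K2 ^ length w" by auto
    obtain k where k: "k \<in> {K1, K2}" "\<Delta> (w @ [i]) = k * \<Delta> w" using step[OF w(1)] w(2) by blast
    have k': "0 < k" "k \<le> K2" using k(1) K by auto
    have "k * \<Delta> w \<le> K2 * K2 ^ length w" using k' IH K by (intro mult_mono) auto
    then show ?case using k k' IH by simp
  qed
  then show "\<And>w. w \<in> lists {1..M} \<Longrightarrow> 0 < \<Delta> w \<and> \<Delta> w \<le> K2 ^ length w" by blast
  have le1: "\<Delta> w \<le> 1" if "w \<in> lists {1..M}" for w
    using b[OF that] K power_le_one[of K2 "length w"] by linarith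
  have lim: "(\<lambda>n. Max (\<Delta> ` words M n)) \<longlonglongrightarrow> 0"
  proof (rule tendsto_sandwich[of "\<lambda>_. 0" _ _ "\<lambda>n. K2 ^ n"])
    have ne: "\<Delta> ` words M n \<noteq> {}" "finite (\<Delta> ` words M n)" for n
    proof -
      have "replicate n 1 \<in> words M n" using M by (auto simp: words_def)
      then show "\<Delta> ` words M n \<noteq> {}" by blast
    qed (simp add: finite_words)
    have "0 \<le> Max (\<Delta> ` words M n) \<and> Max (\<Delta> ` words M n) \<le> K2 ^ n" for n
    proof -
      obtain w where w: "w \<in> words M n" "Max (\<Delta> ` words M n) = \<Delta> w" using Max_in[OF ne(2,1)[of n]] by blast
      then show ?thesis using b[of w] by (auto simp: words_def)
    qed
    then show "\<forall>\<^sub>F n in sequentially. 0 \<le> Max (\<Delta> ` words M n)"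
      "\<forall>\<^sub>F n in sequentially. Max (\<Delta> ` words M n) \<le> K2 ^ n" by auto
    show "(\<lambda>n. K2 ^ n) \<longlonglongrightarrow> 0" using K by (intro LIMSEQ_realpow_zero) auto
  qed simp
  have ratio: "\<Delta> (w @ [i]) = \<Delta> (w @ [j]) \<and> \<Delta> (w @ [i]) / \<Delta> w \<in> {K1, K2}"
    if w: "w \<in> lists {1..M}" "i \<in> {1..M}" "j \<in> {1..M}" for w i j
  proof -
    obtain k where "k \<in> {K1, K2}" "\<forall>i\<in>{1..M}. \<Delta> (w @ [i]) = k * \<Delta> w" using step[OF w(1)] by blast
    then show ?thesis using w b[OF w(1)] by auto
  qed
  have range: "\<Delta> w \<in> {0..1}" if "w \<in> lists {1..M}" for w
    using b[OF that] le1[OF that] by simp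
  show "\<Delta> \<in> diameter_functions M K1 K2"
    unfolding diameter_functions_def mem_Collect_eq
    using K(1,2) less_imp_le[OF K(3)] range assms(5) lim ratio by blast
  show "cond_P3 M \<Delta> K1 K2"
    unfolding cond_P3_def
  proof (intro ballI)
    fix w i assume w: "w \<in> lists {1..M}" "i \<in> {1..M}"
    obtain k where k: "k \<in> {K1, K2}" "\<Delta> (w @ [i]) = k * \<Delta> w" using step[OF w(1)] w(2) by blast
    have "K1 \<le> k" "k \<le> K2" using k(1) K by auto
    then show "K1 * \<Delta> w \<le> \<Delta> (w @ [i]) \<and> \<Delta> (w @ [i]) \<le> K2 * \<Delta> w"
      using b[OF w(1)] k(2) by (auto intro!: mult_right_mono)
  qed
qed

context tree_code begin

text \<open>The fold carries the prefix read so far and its weight \<open>r\<close>, normalised by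
  \<open>dm X\<close>. A cell that is small compared with its weight calls for the small ratio
  \<open>K1\<close>, otherwise the weight decreases by \<open>K2\<close>.\<close>

definition delta :: "real \<Rightarrow> real \<Rightarrow> nat list \<Rightarrow> real" where
  "delta K1 K2 w = snd (foldl (\<lambda>(u, r) i. (u @ [i], (if dm (cell u) \<le> r * dm X then K1 else K2) * r)) ([], 1) w)"

lemma delta_Nil: "delta K1 K2 [] = 1" by (simp add: delta_def)

lemma delta_snoc:
  "delta K1 K2 (w @ [i]) = (if dm (cell w) \<le> delta K1 K2 w * dm X then K1 else K2) * delta K1 K2 w"
proof -
  have "fst (foldl (\<lambda>(u, r) i. (u @ [i], (if dm (cell u) \<le> r * dm X then K1 else K2) * r)) ([], 1) w) = w"
    by (induction w rule: rev_induct) (auto simp: case_prod_beta)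
  then show ?thesis by (simp add: delta_def case_prod_beta)
qed

context
  fixes K1 K2 :: real
  assumes K: "0 < K1" "K1 \<le> sep_const M" "1 / 2 \<le> K2" "K2 < 1"
begin

lemma K1_less: "K1 < 1" "K1 \<le> 1 / 8 ^ M" "K1 \<le> K2"
proof -
  show "K1 < 1" using K(2) sep_const_less_1[of M] by linarith
  show k: "K1 \<le> 1 / 8 ^ M" using K(2) sep_const_le(1)[of M] by linarith
  have "(8::real) ^ 1 \<le> 8 ^ M" using M2 by (intro power_increasing) auto
  then have "1 / (8::real) ^ M \<le> 1 / 8" by (intro divide_left_mono) auto
  then show "K1 \<le> K2" using k K(3) by linarith
qed

lemma delta_props:
  shows "delta K1 K2 \<in> diameter_functions M K1 K2" and "cond_P3 M (delta K1 K2) K1 K2"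
    and "w \<in> lists {1..M} \<Longrightarrow> 0 < delta K1 K2 w"
  using diameter_functionsI[OF K(1) K1_less(3) K(4), of M "delta K1 K2"] M2
  by (auto simp: delta_Nil delta_snoc)

text \<open>The choice between \<open>K1\<close> and \<open>K2\<close> pulls the ratio \<open>delta w * dm X / dm (cell w)\<close> back
  towards \<open>1\<close> at every step, so it never leaves \<open>[K1, 1 / K1]\<close>.\<close>

lemma delta_comparable:
  assumes "w \<in> lists {1..M}"
  shows "K1 * dm (cell w) \<le> delta K1 K2 w * dm X \<and> K1 * (delta K1 K2 w * dm X) \<le> dm (cell w)"
  using assms
proof (induction w rule: rev_induct)
  case Nil
  have "K1 * dm X \<le> 1 * dm X" using K1_less(1) dm_X_pos by (intro mult_right_mono) auto
  then show ?case by (simp add: delta_Nil)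
next
  case (snoc i w)
  define a where "a = delta K1 K2 w * dm X"
  have w: "w \<in> lists {1..M}" "i \<in> {1..M}" using snoc by auto
  have IH: "K1 * dm (cell w) \<le> a" "K1 * a \<le> dm (cell w)" using snoc w by (auto simp: a_def)
  have d: "dm (cell w) / 8 ^ M \<le> dm (cell (w @ [i]))" "dm (cell (w @ [i])) \<le> dm (cell w) / 4"
    using split_facts(2,3)[OF w] by auto
  have a: "0 < a" using delta_props(3)[OF w(1)] dm_X_pos by (simp add: a_def)
  have "K1 * dm (cell w) \<le> 1 / 8 ^ M * dm (cell w)"
    using K1_less(2) dm_cell_pos[OF w(1)] by (intro mult_right_mono) auto
  then have low: "K1 * dm (cell w) \<le> dm (cell (w @ [i]))" using d(1) by simp
  have up: "K1 * dm (cell (w @ [i])) \<le> K1 * (dm (cell w) / 4)" using d(2) K(1) by (intro mult_left_mono) auto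
  show ?case
  proof (cases "dm (cell w) \<le> a")
    \<comment> \<open>The weight drops by \<open>K1\<close>, at least as much as any child, because
      \<open>K1 <= 1 / 8 ^ M\<close>; so the upper bound survives. The weight was at least
      \<open>dm (cell w)\<close>, which gives the lower one.\<close>
    case True
    have e: "delta K1 K2 (w @ [i]) * dm X = K1 * a" using True by (simp add: delta_snoc a_def)
    have "K1 * (dm (cell w) / 4) \<le> K1 * a"
      using True dm_cell_pos[OF w(1)] K(1) by (intro mult_left_mono) auto
    moreover have "K1 * (K1 * a) \<le> K1 * dm (cell w)" using IH(2) K(1) by (intro mult_left_mono) auto
    ultimately show ?thesis unfolding e using up low by (intro conjI) linarith+
  next
    \<comment> \<open>By \<open>1 / 2 <= K2\<close> the weight loses at most a factor
      \<open>2\<close>, while every child loses at least \<open>4\<close>, so the lower bound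
      survives. The weight was below \<open>dm (cell w)\<close>, which gives the upper one.\<close>
    case False
    have e: "delta K1 K2 (w @ [i]) * dm X = K2 * a" using False by (simp add: delta_snoc a_def)
    have "a / 2 \<le> K2 * a" using mult_right_mono[OF K(3), of a] a by simp
    moreover have "K1 * (K2 * a) \<le> K1 * dm (cell w)"
    proof (rule mult_left_mono)
      have "K2 * a \<le> 1 * a" using K(4) a by (intro mult_right_mono) auto
      then show "K2 * a \<le> dm (cell w)" using False by linarith
    qed (use K(1) in auto)
    moreover have "0 < K1 * dm (cell w)" using K(1) dm_cell_pos[OF w(1)] by simp
    ultimately show ?thesis unfolding e using up low IH(1) by (intro conjI) linarith+
  qed
qed

lemma delta_le: "w \<in> lists {1..M} \<Longrightarrow> delta K1 K2 w \<le> 1 / (K1 * dm X) * dm (cell w)"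
  using delta_comparable[of w] K(1) dm_X_pos by (simp add: field_simps)

lemma dm_le_delta: "w \<in> lists {1..M} \<Longrightarrow> dm (cell w) \<le> dm X / K1 * delta K1 K2 w"
  using delta_comparable[of w] K(1) dm_X_pos by (simp add: field_simps)

text \<open>In the second bound \<open>1 / sep_const M\<close> is replaced by the larger
  \<open>1 / K1\<close>, so that \<open>M\<close> does not appear in the constant.\<close>

lemma D_bounds:
  assumes "x \<in> inf_words M" "y \<in> inf_words M"
  shows "rho (pt x) (pt y) \<le> dm X / K1 * chain_pdist M T (delta K1 K2) x y"
    and "chain_pdist M T (delta K1 K2) x y \<le> 8 / (K1\<^sup>2 * dm X) * rho (pt x) (pt y)"
proof -
  show "rho (pt x) (pt y) \<le> dm X / K1 * chain_pdist M T (delta K1 K2) x y"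
    using K(1) dm_X_pos dm_le_delta by (intro rho_le_D[OF delta_props(3) assms]) auto
  have "chain_pdist M T (delta K1 K2) x y \<le> 8 * (1 / (K1 * dm X)) / sep_const M * rho (pt x) (pt y)"
    using K(1) dm_X_pos delta_le by (intro D_le_rho[OF delta_props(3) assms]) auto
  also have "\<dots> \<le> 8 / (K1\<^sup>2 * dm X) * rho (pt x) (pt y)"
  proof (rule mult_right_mono)
    have "8 * (1 / (K1 * dm X)) / sep_const M \<le> 8 * (1 / (K1 * dm X)) / K1"
      using K(1,2) dm_X_pos sep_const_pos[of M] by (intro divide_left_mono) auto
    then show "8 * (1 / (K1 * dm X)) / sep_const M \<le> 8 / (K1\<^sup>2 * dm X)"
      by (simp add: power2_eq_square field_simps)
  qed (use assms pt_X rho_nonneg in auto)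
  finally show "chain_pdist M T (delta K1 K2) x y \<le> 8 / (K1\<^sup>2 * dm X) * rho (pt x) (pt y)" .
qed

lemma D_eq_0_iff:
  assumes x: "x \<in> inf_words M" "y \<in> inf_words M"
  shows "chain_pdist M T (delta K1 K2) x y = 0 \<longleftrightarrow> pt x = pt y"
proof
  assume "chain_pdist M T (delta K1 K2) x y = 0"
  then show "pt x = pt y" using D_bounds(1)[OF x] rho_eq0[of "pt x" "pt y"] pt_X x by auto
next
  assume "pt x = pt y"
  then show "chain_pdist M T (delta K1 K2) x y = 0"
    using D_bounds(2)[OF x] D_nonneg[where \<Delta> = "delta K1 K2", OF delta_props(3) x] pt_X[OF x(2)]
    by (simp add: rho_refl)
qed

lemma pt_image: "pt ` inf_words M = X"
proof
  show "pt ` inf_words M \<subseteq> X" using pt_X by blast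
  show "X \<subseteq> pt ` inf_words M"
  proof
    fix p assume "p \<in> X"
    then obtain x where "x \<in> inf_words_from M []" "pt x = p" using address_exists[of "[]" p] by auto
    then show "p \<in> pt ` inf_words M" using inf_words_from_sub by blast
  qed
qed

text \<open>One factor \<open>K1\<close> is lost in passing from the weight of \<open>u\<close> to
  the diameter of its cell, another in passing from \<open>rho\<close> to the chain
  distance.\<close>

lemma cond_P4_T: "cond_P4 M T (delta K1 K2) (1 / (K1\<^sup>2 * sep_const M))"
  unfolding cond_P4_def
proof (intro allI ballI impI)
  fix k u u1 u2 w1 w2
  assume W: "u \<in> words M k" "u1 \<in> words M k" "u2 \<in> words M k" "u \<noteq> u1 \<and> u \<noteq> u2 \<and> u1 \<noteq> u2"
    and w: "w1 \<in> comb_inter M T u u1" "w2 \<in> comb_inter M T u u2"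
  let ?s = "sep_const M"
  have l: "u \<in> lists {1..M}" using W(1) words_lists by blast
  have b: "w1 \<in> inf_words M" "w2 \<in> inf_words M" "?s * dm (cell u) \<le> rho (pt w1) (pt w2)"
    using bd_two_points[OF W(1-3) _ _ _ w] W(4) by auto
  have "?s * (K1 * (delta K1 K2 u * dm X)) \<le> ?s * dm (cell u)"
    using delta_comparable[OF l] sep_const_pos[of M] by (intro mult_left_mono) auto
  also have "\<dots> \<le> dm X / K1 * chain_pdist M T (delta K1 K2) w1 w2"
    using b(3) D_bounds(1)[OF b(1,2)] by linarith
  finally have "inverse (1 / (K1\<^sup>2 * ?s)) * delta K1 K2 u \<le> chain_pdist M T (delta K1 K2) w1 w2"
    using K(1) dm_X_pos by (simp add: field_simps power2_eq_square)
  then show "inverse (1 / (K1\<^sup>2 * ?s)) * delta K1 K2 u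
      \<le> chain_dist M T (delta K1 K2) (chain_class M T (delta K1 K2) w1) (chain_class M T (delta K1 K2) w2)"
    using chain_dist_class(2)[where \<Delta> = "delta K1 K2" and f = pt, OF delta_props(3) D_eq_0_iff b(1,2)] by simp
qed

lemma const_gt_1: "1 < 1 / (K1\<^sup>2 * sep_const M)"
proof -
  have "K1\<^sup>2 \<le> 1" using K(1) K1_less(1) by (simp add: power_le_one)
  then have "K1\<^sup>2 * sep_const M \<le> 1 * sep_const M"
    using sep_const_pos[of M] by (intro mult_right_mono) auto
  then have "K1\<^sup>2 * sep_const M < 1" using sep_const_less_1[of M] by simp
  then show ?thesis using K(1) sep_const_pos[of M] by simp
qed

lemma has_tree_code_nondegenerate:
  assumes g: "g ` X = Y" "\<And>x y. \<lbrakk>x \<in> X; y \<in> X\<rbrakk> \<Longrightarrow> d (g x) (g y) = dist x y"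
    and L: "1 \<le> L" "dm X / K1 \<le> L" "8 * C / (K1\<^sup>2 * dm X) \<le> L"
  shows "has_tree_code M K1 K2 L Y d"
proof -
  let ?D = "chain_pdist M T (delta K1 K2)"
  have inj: "g p = g q \<longleftrightarrow> p = q" if "p \<in> X" "q \<in> X" for p q
    using g(2)[OF that(1,1)] g(2)[OF that] by auto
  have "bilipschitz_equivalent L (chain_space M T (delta K1 K2)) (chain_dist M T (delta K1 K2)) Y d"
  proof (rule bilipschitz_equivalent_chain_space[where f = "g \<circ> pt"])
    fix x y assume x: "x \<in> inf_words M" "y \<in> inf_words M"
    have p: "pt x \<in> X" "pt y \<in> X" using pt_X x by auto
    show "?D x y = 0 \<longleftrightarrow> (g \<circ> pt) x = (g \<circ> pt) y" using D_eq_0_iff[OF x] inj[OF p] by simp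
    have D0: "0 \<le> ?D x y" by (rule D_nonneg[OF delta_props(3) x])
    have "dist (pt x) (pt y) \<le> dm X / K1 * ?D x y" using dist_le_rho[OF p] D_bounds(1)[OF x] by linarith
    also have "\<dots> \<le> L * ?D x y" using L(2) D0 by (rule mult_right_mono)
    finally have 1: "dist (pt x) (pt y) \<le> L * ?D x y" .
    have "?D x y \<le> 8 / (K1\<^sup>2 * dm X) * rho (pt x) (pt y)" by (rule D_bounds(2)[OF x])
    also have "\<dots> \<le> 8 / (K1\<^sup>2 * dm X) * (C * dist (pt x) (pt y))"
      using rho_le_dist[OF p] K(1) dm_X_pos by (intro mult_left_mono) auto
    also have "\<dots> = 8 * C / (K1\<^sup>2 * dm X) * dist (pt x) (pt y)" by simp
    also have "\<dots> \<le> L * dist (pt x) (pt y)" using L(3) by (intro mult_right_mono) auto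
    finally have "inverse L * ?D x y \<le> dist (pt x) (pt y)" using L(1) by (simp add: field_simps)
    then show "inverse L * ?D x y \<le> d ((g \<circ> pt) x) ((g \<circ> pt) y) \<and> d ((g \<circ> pt) x) ((g \<circ> pt) y) \<le> L * ?D x y"
      using 1 g(2)[OF p] by simp
  next
    show "(g \<circ> pt) ` inf_words M = Y" unfolding image_comp[symmetric] pt_image by (rule g(1))
  qed (use delta_props(3) L(1) in auto)
  moreover obtain n0 where "cond_P2 T n0" using cond_P2_T by blast
  moreover have "cond_P1 M M" by (simp add: cond_P1_def)
  ultimately show ?thesis
    unfolding has_tree_code_def
    using combinatorial_data_T combinatorial_tree_T delta_props(1,2) cond_P4_T const_gt_1 K K1_less
    by (intro exI[of _ T] exI[of _ "delta K1 K2"] conjI exI[of _ M] exI[of _ n0]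
        exI[of _ "1 / (K1\<^sup>2 * sep_const M)"] exI[of _ K1] exI[of _ K2]) auto
qed

section \<open>A weight that collapses the space of words to a point\<close>

lemma path_chain:
  assumes "(u, v) \<in> (parcs (T n))\<^sup>*"
  shows "u \<in> words M n \<Longrightarrow> \<exists>vs. vs \<noteq> [] \<and> distinct vs \<and> set vs \<subseteq> words M n \<and> hd vs = u \<and> last vs = v \<and> successively linked vs"
  using assms
proof (induction rule: converse_rtrancl_induct)
  case base then show ?case by (intro exI[of _ "[v]"]) auto
next
  case (step u z)
  then have uz: "u \<in> words M n" "z \<in> words M n" "u \<noteq> z" "cell u \<inter> cell z \<noteq> {}" by (auto simp: parcs_T)
  obtain vs where vs: "vs \<noteq> []" "distinct vs" "set vs \<subseteq> words M n" "hd vs = z" "last vs = v" "successively linked vs"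
    using step.IH[OF uz(2)] by blast
  show ?case
  proof (cases "u \<in> set vs")
    \<comment> \<open>Cutting out the loop keeps the words distinct, so that their number is at most
      \<open>M ^ n\<close>.\<close>
    case True
    then obtain ys zs where e: "vs = ys @ u # zs" by (meson split_list)
    have "successively linked (u # zs)" using vs(6) unfolding e successively_append_iff by auto
    then show ?thesis using vs e by (intro exI[of _ "u # zs"]) auto
  next
    case False
    have "linked u z"
    proof -
      obtain p where "p \<in> cell u" "p \<in> cell z" using uz by blast
      then show ?thesis
        using comb_inter_nonempty[of u z p n] uz by (auto simp: words_def)
    qed
    then have "successively linked (u # vs)" using vs by (cases vs) auto
    then show ?thesis using vs False uz by (intro exI[of _ "u # vs"]) auto
  qed
qed

text \<open>With weights \<open>K1 ^ n\<close>, the chain of all words of length \<open>n\<close> has total weight \<open>(M * K1) ^ n\<close>, which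
  tends to \<open>0\<close>: every tree of words carries a weight whose chain space is a single point.\<close>

lemma D_power:
  assumes x: "x \<in> inf_words M" "y \<in> inf_words M"
  shows "chain_pdist M T (\<lambda>w. K1 ^ length w) x y = 0"
proof -
  let ?\<Delta> = "\<lambda>w. K1 ^ length w"
  have pos: "0 < ?\<Delta> w" for w :: "nat list" using K(1) by simp
  have le: "chain_pdist M T ?\<Delta> x y \<le> (real M * K1) ^ n" for n
  proof -
    have W: "initial x n \<in> words M n" "initial y n \<in> words M n" using x initial_words by auto
    have "(initial x n, initial y n) \<in> (parcs (T n))\<^sup>*" using T_reachable[OF W] by (rule rtrancl_on_rtranclI)
    then obtain vs where vs: "vs \<noteq> []" "distinct vs" "set vs \<subseteq> words M n" "hd vs = initial x n"
      "last vs = initial y n" "successively linked vs"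
      using path_chain W by metis
    have "chain_joining M T x y vs"
    proof -
      have "set vs \<subseteq> lists {1..M}" using vs(3) words_lists by blast
      then show ?thesis unfolding chain_joining_iff using vs x by (simp add: inf_words_from_def)
    qed
    then have "chain_pdist M T ?\<Delta> x y \<le> (\<Sum>v\<leftarrow>vs. ?\<Delta> v)" by (rule D_le[rotated]) (rule pos)
    also have "\<dots> = (\<Sum>v\<leftarrow>vs. K1 ^ n)"
      using vs(3) by (intro arg_cong[of _ _ sum_list] map_cong) (auto simp: words_def)
    also have "\<dots> = real (length vs) * K1 ^ n" by (simp add: sum_list_triv)
    also have "length vs = card (set vs)" using vs(2) by (simp add: distinct_card)
    also have "real (card (set vs)) * K1 ^ n \<le> real M ^ n * K1 ^ n"
    proof (rule mult_right_mono)
      have "card (set vs) \<le> card (words M n)" by (rule card_mono[OF finite_words vs(3)])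
      also have "words M n = {w. set w \<subseteq> {1..M} \<and> length w = n}" by (auto simp: words_def in_lists_conv_set)
      also have "card \<dots> = M ^ n" by (simp add: card_lists_length_eq)
      finally show "real (card (set vs)) \<le> real M ^ n" by (metis of_nat_le_iff of_nat_power)
    qed (use K(1) in auto)
    finally show ?thesis by (simp add: power_mult_distrib)
  qed
  have "real M * K1 < 1"
  proof -
    have "K1 < 1 / real (Suc M)" using K(2) sep_const_le(2)[of M] by linarith
    then have "K1 * real (Suc M) < 1" by (simp add: field_simps)
    then show ?thesis using K(1) by (simp add: algebra_simps)
  qed
  then have "(\<lambda>n. (real M * K1) ^ n) \<longlonglongrightarrow> 0" using K(1) by (intro LIMSEQ_realpow_zero) auto
  then have "chain_pdist M T ?\<Delta> x y \<le> 0" by (rule LIMSEQ_le_const) (use le in auto)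
  moreover have "0 \<le> chain_pdist M T ?\<Delta> x y" by (rule D_nonneg[OF _ x]) (rule pos)
  ultimately show ?thesis by simp
qed

text \<open>Only the words and graphs of the underlying tree are used; the weight makes its chain
  space a single point, whatever the tree is.\<close>

lemma has_tree_code_point:
  assumes d: "d y y = 0" and L: "1 \<le> L"
  shows "has_tree_code M K1 K2 L {y} d"
proof -
  let ?\<Delta> = "\<lambda>w::nat list. K1 ^ length w"
  have pos: "0 < ?\<Delta> w" for w using K(1) by simp
  have "(\<lambda>_. 1) \<in> inf_words M" using M2 by (simp add: inf_words_def)
  then have im: "(\<lambda>_. y) ` inf_words M = {y}" by auto
  have "bilipschitz_equivalent L (chain_space M T ?\<Delta>) (chain_dist M T ?\<Delta>) {y} d"
    by (rule bilipschitz_equivalent_chain_space[where f = "\<lambda>_. y"]) (use pos D_power im L d in auto)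
  moreover have "?\<Delta> \<in> diameter_functions M K1 K2" "cond_P3 M ?\<Delta> K1 K2"
    using diameter_functionsI[OF K(1) K1_less(3) K(4), of M ?\<Delta>] M2 by auto
  moreover obtain n0 where "cond_P2 T n0" using cond_P2_T by blast
  moreover have "cond_P1 M M" by (simp add: cond_P1_def)
  ultimately show ?thesis
    unfolding has_tree_code_def
    using combinatorial_data_T combinatorial_tree_T K K1_less
    by (intro exI[of _ T] exI[of _ ?\<Delta>] conjI exI[of _ M] exI[of _ n0]
        exI[of _ "2::real"] exI[of _ K1] exI[of _ K2]) auto
qed

end

end

section \<open>Arcs lie in continua\<close>

text \<open>Being joined by steps shorter than \<open>e\<close> is an equivalence relation with
  relatively open classes.\<close>

lemma connected_chain:
  fixes K :: "'e::metric_space set"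
  assumes K: "connected K" "x \<in> K" "y \<in> K" and e: "0 < e"
  obtains n f where "f (0::nat) = x" "f n = y" "\<And>i. i \<le> n \<Longrightarrow> f i \<in> K"
    "\<And>i. i < n \<Longrightarrow> dist (f i) (f (Suc i)) < e"
proof -
  define r where "r = {(a, b). a \<in> K \<and> b \<in> K \<and> dist a b < e}"
  have "(x, y) \<in> r\<^sup>*"
  proof (rule connected_equivalence_relation[OF K])
    fix a b assume "(a, b) \<in> r\<^sup>*"
    moreover have "sym r" by (auto simp: r_def sym_def dist_commute)
    ultimately show "(b, a) \<in> r\<^sup>*" by (meson sym_rtrancl symD)
  next
    fix a assume a: "a \<in> K"
    show "\<exists>U. openin (top_of_set K) U \<and> a \<in> U \<and> (\<forall>z\<in>U. (a, z) \<in> r\<^sup>*)"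
      by (rule exI[of _ "K \<inter> ball a e"]) (use a e in \<open>auto simp: r_def intro!: r_into_rtrancl\<close>)
  qed (auto intro: rtrancl_trans)
  then obtain n where "(x, y) \<in> r ^^ n" by (auto simp: rtrancl_power)
  then obtain f where f: "f 0 = x" "f n = y" "\<forall>i<n. (f i, f (Suc i)) \<in> r" by (auto simp: relpow_fun_conv)
  have "f i \<in> K" if "i \<le> n" for i
    using f that K(3) by (cases "i = n") (auto simp: r_def)
  then show ?thesis using that f by (auto simp: r_def)
qed

definition chain_in :: "'e::metric_space set \<Rightarrow> real \<Rightarrow> 'e \<Rightarrow> 'e \<Rightarrow> nat \<times> (nat \<Rightarrow> 'e) \<Rightarrow> bool" where
  "chain_in S e x y = (\<lambda>(n, f). 0 < n \<and> f 0 = x \<and> f n = y \<and> (\<forall>i\<le>n. f i \<in> S) \<and>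
     (\<forall>i<n. dist (f i) (f (Suc i)) < e))"

text \<open>Every step is replaced by a block of the same length \<open>k\<close>. Read as step
  functions on \<open>[0, 1]\<close>, the two chains can then be compared at equal
  parameters.\<close>

definition refines :: "real \<Rightarrow> nat \<times> (nat \<Rightarrow> 'e::metric_space) \<Rightarrow> nat \<times> (nat \<Rightarrow> 'e) \<Rightarrow> bool" where
  "refines b = (\<lambda>(n', f') (n, f). \<exists>k>0. n' = k * n \<and> (\<forall>j\<le>n'. dist (f' j) (f (j div k)) \<le> b))"

context
  fixes S :: "'e::metric_space set" and C :: real
  assumes turning: "\<And>x y. \<lbrakk>x \<in> S; y \<in> S\<rbrakk> \<Longrightarrow> \<exists>K. K \<subseteq> S \<and> connected K \<and> x \<in> K \<and> y \<in> K \<and>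
      (\<forall>u\<in>K. dist x u \<le> C * dist x y)"
    and C: "0 \<le> C"
begin

text \<open>Each link of length below \<open>e\<close> is bridged by a continuum within
  \<open>C * e\<close> of its first point, and this continuum is walked through in steps shorter
  than \<open>e'\<close>.\<close>

lemma chain_refinement:
  assumes ch: "chain_in S e x y (n, f)" and e': "0 < e'"
  shows "\<exists>c. chain_in S e' x y c \<and> refines (C * e) c (n, f)"
proof -
  have f: "0 < n" "f 0 = x" "f n = y" "\<And>i. i \<le> n \<Longrightarrow> f i \<in> S" "\<And>i. i < n \<Longrightarrow> dist (f i) (f (Suc i)) < e"
    using ch by (auto simp: chain_in_def)
  have "\<exists>m h. h 0 = f i \<and> h m = f (Suc i) \<and> (\<forall>j\<le>m. h j \<in> S \<and> dist (f i) (h j) \<le> C * e) \<and>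
      (\<forall>j<m. dist (h j) (h (Suc j)) < e')" if i: "i < n" for i
  proof -
    obtain K where K: "K \<subseteq> S" "connected K" "f i \<in> K" "f (Suc i) \<in> K"
      "\<And>u. u \<in> K \<Longrightarrow> dist (f i) u \<le> C * dist (f i) (f (Suc i))"
      using turning[of "f i" "f (Suc i)"] f(4) i by (metis Suc_leI less_imp_le_nat)
    have "C * dist (f i) (f (Suc i)) \<le> C * e"
      using f(5)[OF i] C by (intro mult_left_mono) auto
    then have b: "dist (f i) u \<le> C * e" if "u \<in> K" for u using K(5)[OF that] by linarith
    obtain m h where "h 0 = f i" "h m = f (Suc i)" "\<And>j. j \<le> m \<Longrightarrow> h j \<in> K"
      "\<And>j. j < m \<Longrightarrow> dist (h j) (h (Suc j)) < e'"
      using connected_chain[OF K(2-4) e'] by metis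
    then show ?thesis using b K(1) by blast
  qed
  then obtain m h where h: "\<And>i. i < n \<Longrightarrow> h i 0 = f i" "\<And>i. i < n \<Longrightarrow> h i (m i) = f (Suc i)"
    "\<And>i j. i < n \<Longrightarrow> j \<le> m i \<Longrightarrow> h i j \<in> S \<and> dist (f i) (h i j) \<le> C * e"
    "\<And>i j. i < n \<Longrightarrow> j < m i \<Longrightarrow> dist (h i j) (h i (Suc j)) < e'"
    by metis
  \<comment> \<open>The links need different numbers of steps. Short blocks wait at their last point
    up to the common length, and \<open>Suc\<close> keeps this length positive.\<close>
  define k where "k = Suc (Max (m ` {..<n}))"
  have mk: "m i \<le> k" if "i < n" for i
    using that by (simp add: k_def le_SucI)
  define h' where "h' i j = h i (min j (m i))" for i j
  have h': "h' i 0 = f i" "h' i k = f (Suc i)" "h' i j \<in> S" "dist (f i) (h' i j) \<le> C * e"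
    "dist (h' i j) (h' i (Suc j)) < e'" if "i < n" for i j
  proof -
    show "h' i 0 = f i" "h' i k = f (Suc i)" using h(1,2)[OF that] mk[OF that] by (auto simp: h'_def min_def)
    show "h' i j \<in> S" "dist (f i) (h' i j) \<le> C * e" using h(3)[OF that] by (auto simp: h'_def)
    show "dist (h' i j) (h' i (Suc j)) < e'"
      using h(4)[OF that] e' by (cases "j < m i") (auto simp: h'_def min_def)
  qed
  have k: "0 < k" by (simp add: k_def)
  \<comment> \<open>The value \<open>y\<close> matters only at the final index \<open>k * n\<close>,
    which belongs to no block.\<close>
  define g where "g j = (if j div k < n then h' (j div k) (j mod k) else y)" for j
  have dk: "j div k < n \<longleftrightarrow> j < k * n" for j using k by (simp add: div_less_iff_less_mult mult.commute)
  have ge: "0 \<le> C * e" using f(5)[OF f(1)] C zero_le_dist[of "f 0" "f (Suc 0)"]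
    by (intro mult_nonneg_nonneg) linarith+
  have yS: "y \<in> S" using f(3,4) by auto
  have "chain_in S e' x y (k * n, g)"
    unfolding chain_in_def split
  proof (intro conjI allI impI)
    show "g 0 = x" using f h'(1) k by (simp add: g_def)
    show "g (k * n) = y" using k by (simp add: g_def)
    show "g j \<in> S" for j using h'(3) yS by (auto simp: g_def)
    fix j assume j: "j < k * n"
    let ?i = "j div k"
    have i: "?i < n" using dk j by simp
    have "g (Suc j) = h' ?i (Suc (j mod k))"
    proof (cases "Suc (j mod k) = k")
      case True
      have "Suc j = k * ?i + Suc (j mod k)" using mult_div_mod_eq[of k j] by linarith
      also have "\<dots> = k * Suc ?i" using True by simp
      finally have s: "Suc j = k * Suc ?i" .
      have 1: "Suc j div k = Suc ?i" "Suc j mod k = 0" unfolding s using k by auto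
      show ?thesis
      proof (cases "Suc ?i < n")
        case c: True
        then show ?thesis using 1 h'(1)[OF c] h'(2)[OF i] True by (simp add: g_def)
      next
        case False
        then have "Suc ?i = n" using i by simp
        then show ?thesis using 1 h'(2)[OF i] True f(3) by (simp add: g_def)
      qed
    next
      case False
      then have "Suc j mod k = Suc (j mod k)" "Suc j div k = ?i"
        using mod_Suc[of j k] div_Suc[of j k] by auto
      then show ?thesis using i by (simp add: g_def)
    qed
    then show "dist (g j) (g (Suc j)) < e'" using h'(5)[OF i] i by (simp add: g_def)
  qed (use k f(1) in auto)
  moreover have "refines (C * e) (k * n, g) (n, f)"
    unfolding refines_def split
  proof (intro exI[of _ k] conjI allI impI)
    fix j assume "j \<le> k * n"
    show "dist (g j) (f (j div k)) \<le> C * e"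
    proof (cases "j div k < n")
      case True then show ?thesis using h'(4)[OF True] by (simp add: g_def dist_commute)
    next
      case False
      then have "j = k * n" using dk \<open>j \<le> k * n\<close> by (metis le_neq_implies_less)
      then show ?thesis using k f(3) ge by (simp add: g_def)
    qed
  qed (use k in auto)
  ultimately show ?thesis by blast
qed

text \<open>The Hahn--Mazurkiewicz construction: ever finer chains, read as step functions on \<open>[0, 1]\<close>,
  converge uniformly.\<close>

lemma path_near_connected:
  assumes S: "compact S" and K: "K \<subseteq> S" "connected K" "x \<in> K" "y \<in> K" and e: "0 < e"
  obtains p where "path p" "pathstart p = x" "pathfinish p = y" "path_image p \<subseteq> S"
    "\<And>t. t \<in> {0..1} \<Longrightarrow> \<exists>u\<in>K. dist u (p t) < e"
proof -
  \<comment> \<open>From the first chain to the limit, points move by at most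
    \<open>C * (\<eta> + \<eta> / 2 + ...) = 2 * C * \<eta>\<close>. As the first chain runs in
    \<open>K\<close>, the limit path stays within \<open>e\<close> of \<open>K\<close>. The summand
    \<open>1\<close> covers \<open>C = 0\<close>.\<close>
  define \<eta> where "\<eta> = e / (2 * C + 1) / 2"
  have C1: "0 < 2 * C + 1" using C by simp
  have \<eta>: "0 < \<eta>" "2 * C * \<eta> < e"
    using e C C1 by (auto simp: \<eta>_def field_simps add_strict_increasing)
  define b where "b m = \<eta> / 2 ^ m" for m :: nat
  have b: "0 < b m" for m using \<eta> by (simp add: b_def)
  obtain n0 f0 where f0: "f0 (0::nat) = x" "f0 n0 = y" "\<And>i. i \<le> n0 \<Longrightarrow> f0 i \<in> K"
    "\<And>i. i < n0 \<Longrightarrow> dist (f0 i) (f0 (Suc i)) < \<eta>"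
    using connected_chain[OF K(2-4) \<eta>(1)] by metis
  \<comment> \<open>One idle step at the end makes the number of steps positive even if
    \<open>n0 = 0\<close>.\<close>
  define f1 where "f1 i = (if i \<le> n0 then f0 i else y)" for i
  have f1K: "f1 i \<in> K" for i using f0(3) K(4) by (simp add: f1_def)
  have f1d: "dist (f1 i) (f1 (Suc i)) < \<eta>" for i
    using f0(4)[of i] \<eta>(1) f0(2) by (cases "i = n0") (auto simp: f1_def)
  have start: "chain_in S (b 0) x y (Suc n0, f1)"
    using f0 f1K f1d K(1) by (auto simp: chain_in_def b_def f1_def[of 0] f1_def[of "Suc n0"])
  have "\<exists>c. \<forall>m. (chain_in S (b m) x y (c m) \<and> (m = 0 \<longrightarrow> c m = (Suc n0, f1))) \<and>
      refines (C * b m) (c (Suc m)) (c m)"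
  proof (rule dependent_nat_choice)
    show "\<exists>c. chain_in S (b 0) x y c \<and> (0 = (0::nat) \<longrightarrow> c = (Suc n0, f1))" using start by blast
    fix c m assume "chain_in S (b m) x y c \<and> (m = 0 \<longrightarrow> c = (Suc n0, f1))"
    then show "\<exists>c'. (chain_in S (b (Suc m)) x y c' \<and> (Suc m = 0 \<longrightarrow> c' = (Suc n0, f1))) \<and> refines (C * b m) c' c"
      using chain_refinement[of "b m" x y "fst c" "snd c" "b (Suc m)"] b by auto
  qed
  then obtain c where c: "\<And>m. chain_in S (b m) x y (c m)" "c 0 = (Suc n0, f1)"
    "\<And>m. refines (C * b m) (c (Suc m)) (c m)" by metis
  define n f where "n m = fst (c m)" and "f m = snd (c m)" for m
  have nf: "0 < n m" "f m 0 = x" "f m (n m) = y" "\<And>i. i \<le> n m \<Longrightarrow> f m i \<in> S"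
    "\<And>i. i < n m \<Longrightarrow> dist (f m i) (f m (Suc i)) < b m" for m
    using c(1)[of m] by (auto simp: chain_in_def n_def f_def case_prod_beta)
  define ix where "ix m t = nat \<lfloor>t * real (n m)\<rfloor>" for m t
  define q where "q m t = f m (ix m t)" for m t
  have ix: "ix m t \<le> n m" if "t \<in> {0..1}" for m t
  proof -
    have "t * real (n m) \<le> 1 * real (n m)" using that by (intro mult_right_mono) auto
    then show ?thesis unfolding ix_def by (simp add: floor_le_iff nat_le_iff)
  qed
  have qS: "q m t \<in> S" if "t \<in> {0..1}" for m t using nf(4) ix[OF that] by (simp add: q_def)
  have step: "dist (q (Suc m) t) (q m t) \<le> C * b m" if t: "t \<in> {0..1}" for m t
  proof -
    obtain k where k: "0 < k" "n (Suc m) = k * n m"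
      "\<And>j. j \<le> n (Suc m) \<Longrightarrow> dist (f (Suc m) j) (f m (j div k)) \<le> C * b m"
      using c(3)[of m] by (auto simp: refines_def n_def f_def case_prod_beta)
    \<comment> \<open>Rounding down commutes with division by a positive integer: the parameter
      \<open>t\<close> falls into the block that refines its own coarse step.\<close>
    have "ix (Suc m) t div k = ix m t"
    proof -
      have "\<lfloor>t * real (n (Suc m))\<rfloor> div int k = \<lfloor>t * real (n (Suc m)) / real k\<rfloor>"
        using floor_divide_real_eq_div[of "int k" "t * real (n (Suc m))"] by simp
      also have "t * real (n (Suc m)) / real k = t * real (n m)" using k by simp
      finally show ?thesis using t unfolding ix_def by (metis nat_div_distrib' nat_int of_nat_0_le_iff)
    qed
    then show ?thesis using k(3)[OF ix[OF t]] by (simp add: q_def)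
  qed
  have tail: "dist (q m t) (q (m + i) t) \<le> 2 * C * b m * (1 - 1 / 2 ^ i)" if t: "t \<in> {0..1}" for m i t
  proof (induction i)
    case (Suc i)
    have "dist (q m t) (q (m + Suc i) t) \<le> dist (q m t) (q (m + i) t) + dist (q (Suc (m + i)) t) (q (m + i) t)"
      using dist_triangle[of "q m t" "q (m + Suc i) t" "q (m + i) t"] by (simp add: dist_commute)
    also have "\<dots> \<le> 2 * C * b m * (1 - 1 / 2 ^ i) + C * b (m + i)" using Suc step[OF t] by (intro add_mono)
    also have "\<dots> = 2 * C * b m * (1 - 1 / 2 ^ Suc i)" by (simp add: b_def power_add field_simps)
    finally show ?case .
  qed simp
  have tail': "dist (q m t) (q (m + i) t) \<le> 2 * C * b m" if t: "t \<in> {0..1}" for m i t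
  proof -
    have "2 * C * b m * (1 - 1 / 2 ^ i) \<le> 2 * C * b m * 1"
      using C b[of m] by (intro mult_left_mono) auto
    then show ?thesis using tail[OF t, of m i] by simp
  qed
  have bl: "(\<lambda>m. B * b m) \<longlonglongrightarrow> 0" for B
  proof -
    have "(\<lambda>m. B * \<eta> * (1 / 2) ^ m) \<longlonglongrightarrow> B * \<eta> * 0" by (intro tendsto_intros) auto
    then show ?thesis by (simp add: b_def power_one_over)
  qed
  have small: "\<exists>m. B * b m < z" if "0 < z" for B z
    using order_tendstoD(2)[OF bl[of B] that] by (auto simp: eventually_sequentially)
  have "\<exists>l\<in>S. (\<lambda>m. q m t) \<longlonglongrightarrow> l" if t: "t \<in> {0..1}" for t
  proof -
    have "Cauchy (\<lambda>m. q m t)"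
    proof (rule metric_CauchyI)
      fix z :: real assume z: "0 < z"
      obtain M where M: "4 * C * b M < z" using small[OF z] by blast
      have "dist (q i t) (q j t) < z" if "M \<le> i" "M \<le> j" for i j
        using tail'[OF t, of M "i - M"] tail'[OF t, of M "j - M"] that M
          dist_triangle3[of "q i t" "q j t" "q M t"] by simp
      then show "\<exists>M. \<forall>i\<ge>M. \<forall>j\<ge>M. dist (q i t) (q j t) < z" by blast
    qed
    then show ?thesis
      using compact_imp_complete[OF S, unfolded complete_def, rule_format, of "\<lambda>m. q m t"] qS[OF t] by blast
  qed
  then obtain p where p: "\<And>t. t \<in> {0..1} \<Longrightarrow> p t \<in> S" "\<And>t. t \<in> {0..1} \<Longrightarrow> (\<lambda>m. q m t) \<longlonglongrightarrow> p t" by metis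
  have pq: "dist (q m t) (p t) \<le> 2 * C * b m" if t: "t \<in> {0..1}" for m t
  proof (rule LIMSEQ_le_const2)
    show "(\<lambda>i. dist (q m t) (q (i + m) t)) \<longlonglongrightarrow> dist (q m t) (p t)"
      using LIMSEQ_ignore_initial_segment[OF p(2)[OF t], of m] by (intro tendsto_intros)
    show "\<exists>N. \<forall>i\<ge>N. dist (q m t) (q (i + m) t) \<le> 2 * C * b m"
      using tail'[OF t, of m] by (auto simp: add.commute)
  qed
  have osc: "dist (q m s) (q m t) \<le> b m"
    if st: "s \<in> {0..1}" "t \<in> {0..1}" "s \<le> t" "t - s < 1 / real (n m)" for m s t
  proof -
    have "(t - s) * real (n m) < 1" using st(4) nf(1)[of m] by (simp add: field_simps)
    then have "t * real (n m) < s * real (n m) + 1" by (simp add: algebra_simps)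
    moreover have "s * real (n m) \<le> t * real (n m)" using st(3) by (intro mult_right_mono) auto
    ultimately have "\<lfloor>t * real (n m)\<rfloor> = \<lfloor>s * real (n m)\<rfloor> \<or> \<lfloor>t * real (n m)\<rfloor> = \<lfloor>s * real (n m)\<rfloor> + 1" by linarith
    moreover have "0 \<le> s * real (n m)" using st(1) by simp
    ultimately have "ix m t = ix m s \<or> ix m t = Suc (ix m s)" unfolding ix_def by (auto simp: nat_add_distrib)
    then show ?thesis
    proof
      assume "ix m t = ix m s" then show ?thesis using b[of m] by (simp add: q_def)
    next
      assume i: "ix m t = Suc (ix m s)"
      then have "ix m s < n m" using ix[OF st(2), of m] by simp
      then show ?thesis using nf(5)[of "ix m s" m] i by (simp add: q_def)
    qed
  qed
  have close: "dist (p s) (p t) \<le> (4 * C + 1) * b m"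
    if st: "s \<in> {0..1}" "t \<in> {0..1}" "dist s t < 1 / real (n m)" for m s t
  proof -
    have "dist (q m s) (q m t) \<le> b m"
      using osc[of s t m] osc[of t s m] st by (cases "s \<le> t") (auto simp: dist_real_def dist_commute)
    moreover have "dist (p s) (p t) \<le> dist (q m s) (p s) + dist (q m s) (q m t) + dist (q m t) (p t)"
      using dist_triangle3[of "p s" "p t" "q m s"] dist_triangle[of "q m s" "p t" "q m t"] by linarith
    ultimately show ?thesis using pq[OF st(1), of m] pq[OF st(2), of m] by (simp add: algebra_simps)
  qed
  have "continuous_on {0..1} p"
    unfolding continuous_on_iff
  proof (intro ballI allI impI)
    fix t z :: real assume t: "t \<in> {0..1}" and z: "0 < z"
    obtain m where m: "(4 * C + 1) * b m < z" using small[OF z] by blast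
    show "\<exists>d>0. \<forall>s\<in>{0..1}. dist s t < d \<longrightarrow> dist (p s) (p t) < z"
    proof (rule exI[of _ "1 / real (n m)"], intro conjI ballI impI)
      fix s :: real assume "s \<in> {0..1}" "dist s t < 1 / real (n m)"
      then show "dist (p s) (p t) < z" using close[of s t m] t m by linarith
    qed (use nf(1)[of m] in simp)
  qed
  then have "path p" by (simp add: path_def)
  moreover have "pathstart p = x"
  proof -
    have "(\<lambda>m. q m 0) \<longlonglongrightarrow> x" by (simp add: q_def ix_def nf)
    then show ?thesis using p(2)[of 0] LIMSEQ_unique unfolding pathstart_def by auto
  qed
  moreover have "pathfinish p = y"
  proof -
    have "(\<lambda>m. q m 1) \<longlonglongrightarrow> y" by (simp add: q_def ix_def nf)
    then show ?thesis using p(2)[of 1] LIMSEQ_unique unfolding pathfinish_def by auto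
  qed
  moreover have "path_image p \<subseteq> S" using p(1) by (auto simp: path_image_def)
  moreover have "\<exists>u\<in>K. dist u (p t) < e" if t: "t \<in> {0..1}" for t
  proof -
    have "q 0 t \<in> K" using c(2) f1K by (simp add: q_def f_def)
    moreover have "dist (q 0 t) (p t) < e" using pq[OF t, of 0] \<eta>(2) by (simp add: b_def)
    ultimately show ?thesis by blast
  qed
  ultimately show ?thesis using that by blast
qed

end

section \<open>Arcs of a bounded turning tree as segments\<close>

locale arc_tree =
  fixes S :: "'e::{complete_space,real_normed_vector} set" and C :: real
  assumes compact_S: "compact S" and S_nonempty: "S \<noteq> {}"
    and arc_exists: "\<lbrakk>x \<in> S; y \<in> S; x \<noteq> y\<rbrakk> \<Longrightarrow>
      \<exists>g. arc g \<and> pathstart g = x \<and> pathfinish g = y \<and> path_image g \<subseteq> S"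
    and arc_unique: "\<lbrakk>arc g; arc h; path_image g \<subseteq> S; path_image h \<subseteq> S;
      pathstart g = pathstart h; pathfinish g = pathfinish h\<rbrakk> \<Longrightarrow> path_image g = path_image h"
    and turning: "\<lbrakk>x \<in> S; y \<in> S\<rbrakk> \<Longrightarrow>
      \<exists>K. K \<subseteq> S \<and> compact K \<and> connected K \<and> x \<in> K \<and> y \<in> K \<and> diameter K \<le> C * dist x y"
begin

text \<open>An arc has distinct ends, hence the separate case. The chosen parametrisation does not
  matter, as its image is unique.\<close>

definition seg :: "'e \<Rightarrow> 'e \<Rightarrow> 'e set" where
  "seg x y = (if x = y then {x} else path_image (SOME g. arc g \<and> pathstart g = x \<and>
     pathfinish g = y \<and> path_image g \<subseteq> S))"

lemma seg_arc:
  assumes "x \<in> S" "y \<in> S" "x \<noteq> y"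
  obtains g where "arc g" "pathstart g = x" "pathfinish g = y" "path_image g = seg x y" "seg x y \<subseteq> S"
proof -
  define G where "G = (SOME g. arc g \<and> pathstart g = x \<and> pathfinish g = y \<and> path_image g \<subseteq> S)"
  have "arc G \<and> pathstart G = x \<and> pathfinish G = y \<and> path_image G \<subseteq> S"
    unfolding G_def by (rule someI_ex[OF arc_exists[OF assms]])
  moreover have "seg x y = path_image G" using assms(3) by (simp add: seg_def G_def)
  ultimately show ?thesis using that[of G] by auto
qed

lemma seg_eq:
  assumes "arc g" "path_image g \<subseteq> S"
  shows "seg (pathstart g) (pathfinish g) = path_image g"
proof -
  have "pathstart g \<in> S" "pathfinish g \<in> S" "pathstart g \<noteq> pathfinish g"
    using assms(2) arc_distinct_ends[OF assms(1)]
    by (auto simp: pathstart_in_path_image pathfinish_in_path_image subset_iff)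
  then obtain h where "arc h" "pathstart h = pathstart g" "pathfinish h = pathfinish g"
    "path_image h = seg (pathstart g) (pathfinish g)" "seg (pathstart g) (pathfinish g) \<subseteq> S"
    using seg_arc by metis
  then show ?thesis using arc_unique[of h g] assms by simp
qed

lemma seg_sub: "\<lbrakk>x \<in> S; y \<in> S\<rbrakk> \<Longrightarrow> seg x y \<subseteq> S"
  by (cases "x = y") (auto simp: seg_def[of y y] elim: seg_arc)

lemma seg_start:
  assumes "x \<in> S" "y \<in> S"
  shows "x \<in> seg x y"
proof (cases "x = y")
  case False
  then obtain g where "pathstart g = x" "path_image g = seg x y" using seg_arc[OF assms] by metis
  then show ?thesis using pathstart_in_path_image[of g] by simp
qed (simp add: seg_def)

lemma seg_sym:
  assumes "x \<in> S" "y \<in> S"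
  shows "seg x y = seg y x"
proof (cases "x = y")
  case False
  then obtain g where g: "arc g" "pathstart g = x" "pathfinish g = y" "path_image g = seg x y" "seg x y \<subseteq> S"
    using seg_arc assms by metis
  then show ?thesis using seg_eq[of "reversepath g"] by (simp add: arc_reversepath)
qed simp

text \<open>A path with distinct ends contains an arc between them, and in \<open>S\<close> this arc
  can only be the segment.\<close>

lemma seg_subset_path:
  assumes "path p" "path_image p \<subseteq> S"
  shows "seg (pathstart p) (pathfinish p) \<subseteq> path_image p"
proof (cases "pathstart p = pathfinish p")
  case True
  then show ?thesis using pathfinish_in_path_image[of p] by (simp add: seg_def)
next
  case False
  then obtain q where q: "arc q" "path_image q \<subseteq> path_image p"
    "pathstart q = pathstart p" "pathfinish q = pathfinish p"
    using path_contains_arc[OF assms(1) refl refl] by metis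
  then have "seg (pathstart p) (pathfinish p) = path_image q"
    using seg_eq[of q] assms(2) by simp
  then show ?thesis using q by simp
qed

lemma seg_path:
  assumes "x \<in> S" "y \<in> S"
  obtains p where "path p" "pathstart p = x" "pathfinish p = y" "path_image p = seg x y"
proof (cases "x = y")
  case True
  then show ?thesis using that[of "linepath x x"] by (simp add: seg_def)
next
  case False
  then show ?thesis using that seg_arc[OF assms] arc_imp_path by metis
qed

lemma seg_tri:
  assumes "x \<in> S" "y \<in> S" "z \<in> S"
  shows "seg x z \<subseteq> seg x y \<union> seg y z"
proof -
  obtain p where p: "path p" "pathstart p = x" "pathfinish p = y" "path_image p = seg x y"
    using seg_path assms by metis
  obtain q where q: "path q" "pathstart q = y" "pathfinish q = z" "path_image q = seg y z"
    using seg_path assms by metis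
  have i: "path_image (p +++ q) = seg x y \<union> seg y z" using p q by (simp add: path_image_join)
  then have "path_image (p +++ q) \<subseteq> S" using seg_sub assms by blast
  then show ?thesis using seg_subset_path[of "p +++ q"] p q i by (simp add: path_join)
qed

lemma seg_subarc:
  assumes g: "arc g" "path_image g \<subseteq> S" and ab: "a \<in> {0..1}" "b \<in> {0..1}"
  shows "seg (g a) (g b) = g ` closed_segment a b"
proof (cases "a = b")
  case True
  then show ?thesis by (simp add: seg_def)
next
  case False
  have "path_image (subpath a b g) \<subseteq> path_image g" using path_image_subpath_subset ab by blast
  then have "seg (pathstart (subpath a b g)) (pathfinish (subpath a b g)) = path_image (subpath a b g)"
    using g False ab by (intro seg_eq arc_subpath_arc) auto
  then show ?thesis by (simp add: path_image_subpath_gen)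
qed

text \<open>No path inside \<open>K\<close> is at hand, but bounded turning of \<open>S\<close>
  gives paths in \<open>S\<close> arbitrarily close to \<open>K\<close>. Each contains the segment,
  so a point of the segment at positive distance from \<open>K\<close> is impossible.\<close>

lemma seg_in_continuum:
  assumes K: "K \<subseteq> S" "compact K" "connected K" "x \<in> K" "y \<in> K"
  shows "seg x y \<subseteq> K"
proof (rule ccontr)
  assume "\<not> ?thesis"
  then obtain z where z: "z \<in> seg x y" "z \<notin> K" by blast
  have "open (- K)" using K(2) compact_imp_closed by blast
  then obtain e where e: "0 < e" "ball z e \<subseteq> - K" using z(2) open_contains_ball by blast
  have tS: "\<exists>K. K \<subseteq> S \<and> connected K \<and> x \<in> K \<and> y \<in> K \<and> (\<forall>u\<in>K. dist x u \<le> \<bar>C\<bar> * dist x y)"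
    if xy: "x \<in> S" "y \<in> S" for x y
  proof -
    obtain K where K: "K \<subseteq> S" "compact K" "connected K" "x \<in> K" "y \<in> K" "diameter K \<le> C * dist x y"
      using turning[OF xy] by blast
    have "dist x u \<le> \<bar>C\<bar> * dist x y" if "u \<in> K" for u
    proof -
      have "dist x u \<le> diameter K" using K that by (intro diameter_bounded_bound compact_imp_bounded)
      also have "\<dots> \<le> C * dist x y" by (rule K(6))
      also have "\<dots> \<le> \<bar>C\<bar> * dist x y" by (intro mult_right_mono) auto
      finally show ?thesis .
    qed
    then show ?thesis using K by blast
  qed
  obtain p where p: "path p" "pathstart p = x" "pathfinish p = y" "path_image p \<subseteq> S"
    "\<And>t. t \<in> {0..1} \<Longrightarrow> \<exists>u\<in>K. dist u (p t) < e"
    using path_near_connected[OF tS abs_ge_zero compact_S K(1,3,4,5) e(1)] by blast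
  have "z \<in> path_image p" using seg_subset_path[OF p(1,4)] z(1) p(2,3) by auto
  then obtain t where t: "t \<in> {0..1}" "z = p t" by (auto simp: path_image_def)
  then obtain u where "u \<in> K" "dist u z < e" using p(5) by blast
  then have "u \<in> ball z e" by (simp add: dist_commute)
  then show False using e(2) \<open>u \<in> K\<close> by blast
qed

lemma seg_tree: "seg_tree S seg C"
proof
  fix x y assume xy: "x \<in> S" "y \<in> S"
  show "connected (seg x y)" using seg_path[OF xy] connected_path_image by metis
  show "diameter (seg x y) \<le> C * dist x y"
  proof -
    obtain K where K: "K \<subseteq> S" "compact K" "connected K" "x \<in> K" "y \<in> K" "diameter K \<le> C * dist x y"
      using turning[OF xy] by blast
    have "diameter (seg x y) \<le> diameter K"
      using seg_in_continuum[OF K(1-5)] compact_imp_bounded[OF K(2)] by (rule diameter_subset)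
    then show ?thesis using K(6) by linarith
  qed
  fix z assume z: "z \<in> seg x y"
  show "seg x z \<inter> seg z y \<subseteq> {z}"
  proof (cases "x = y")
    case True
    then show ?thesis using z by (auto simp: seg_def)
  next
    case False
    then obtain g where g: "arc g" "pathstart g = x" "pathfinish g = y" "path_image g = seg x y" "seg x y \<subseteq> S"
      using seg_arc xy by metis
    then have "z \<in> path_image g" using z by simp
    then obtain t where t: "t \<in> {0..1}" "z = g t" unfolding path_image_def by blast
    have inj: "inj_on g {0..1}" using g(1) by (simp add: arc_def)
    have gS: "path_image g \<subseteq> S" using g by simp
    have "seg x z = g ` {0..t}" "seg z y = g ` {t..1}"
      using seg_subarc[OF g(1) gS, of 0 t] seg_subarc[OF g(1) gS, of t 1] t g(2,3)
      by (auto simp: pathstart_def pathfinish_def closed_segment_eq_real_ivl)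
    moreover have "g a = z" if "a \<in> {0..t}" "b \<in> {t..1}" "g a = g b" for a b
    proof -
      have "a = b" using inj that t(1) by (auto simp: inj_on_def)
      then show ?thesis using that t by auto
    qed
    ultimately show ?thesis by auto
  qed
next
  fix x y u v assume xy: "x \<in> S" "y \<in> S" and uv: "u \<in> seg x y" "v \<in> seg x y"
  show "seg u v \<subseteq> seg x y"
  proof (cases "x = y")
    case True
    then show ?thesis using uv by (auto simp: seg_def)
  next
    case False
    then obtain g where g: "arc g" "pathstart g = x" "pathfinish g = y" "path_image g = seg x y" "seg x y \<subseteq> S"
      using seg_arc xy by metis
    then have "u \<in> path_image g" "v \<in> path_image g" using uv by auto
    then obtain a b where ab: "a \<in> {0..1}" "u = g a" "b \<in> {0..1}" "v = g b"
      unfolding path_image_def by blast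
    have "seg u v = g ` closed_segment a b" unfolding ab using seg_subarc[OF g(1) _ ab(1,3)] g by simp
    moreover have "closed_segment a b \<subseteq> {0..1}" using ab by (intro closed_segment_subset) auto
    ultimately show ?thesis using g(4) by (auto simp: path_image_def)
  qed
qed (use compact_S S_nonempty seg_sub seg_start seg_sym seg_tri in \<open>auto simp: seg_def[of _ x for x]\<close>)

end

text \<open>This tree lends its words to the one-point case. Three balls are used because the open
  balls around \<open>x - r / 2\<close> and \<open>x + r / 2\<close> both miss
  \<open>x\<close>.\<close>

lemma interval_doubling_tree: "doubling_tree {0..1::real} closed_segment 1 3"
proof
  show "diameter (closed_segment x y) \<le> 1 * dist x y" for x y :: real
    by (rule diameter_le) (auto simp: closed_segment_eq_real_ivl dist_real_def split: if_splits)
  show "closed_segment x z \<inter> closed_segment z y \<subseteq> {z}" if "z \<in> closed_segment x y" for x y z :: real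
    using that by (auto simp: closed_segment_eq_real_ivl split: if_splits)
  show "closed_segment x z \<subseteq> closed_segment x y \<union> closed_segment y z" for x y z :: real
    by (auto simp: closed_segment_eq_real_ivl)
  show "closed_segment u v \<subseteq> closed_segment x y"
    if "u \<in> closed_segment x y" "v \<in> closed_segment x y" for x y u v :: real
    using that by (intro closed_segment_subset) auto
  show "closed_segment x y \<subseteq> {0..1}" if "x \<in> {0..1}" "y \<in> {0..1}" for x y :: real
    using that by (intro closed_segment_subset) auto
  show "closed_segment x y = closed_segment y x" for x y :: real by (rule closed_segment_commute)
  fix x r :: real assume x: "x \<in> {0..1}" and r: "0 < r"
  \<comment> \<open>Centres are moved into the interval, which brings them no farther from any of
    its points.\<close>
  define c where "c y = max 0 (min 1 y)" for y :: real
  let ?F = "{c (x - r / 2), c x, c (x + r / 2)}"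
  have "card ?F \<le> Suc (Suc (Suc 0))" by (intro card_insert_le_m1) (auto simp: card_insert_if)
  then have "card ?F \<le> 3" by simp
  moreover have "?F \<subseteq> {0..1}" by (auto simp: c_def)
  moreover have "{0..1} \<inter> ball x r \<subseteq> (\<Union>y\<in>?F. ball y (r / 2))"
  proof
    fix y assume y: "y \<in> {0..1} \<inter> ball x r"
    have cl: "dist (c z) y \<le> dist z y" for z using y by (auto simp: c_def dist_real_def)
    have "dist x y < r" using y by simp
    then have "dist (x - r / 2) y < r / 2 \<or> dist x y < r / 2 \<or> dist (x + r / 2) y < r / 2"
      using r unfolding dist_real_def by linarith
    then show "y \<in> (\<Union>y\<in>?F. ball y (r / 2))"
      using cl[of "x - r / 2"] cl[of x] cl[of "x + r / 2"] by auto
  qed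
  ultimately show "\<exists>F. finite F \<and> card F \<le> 3 \<and> F \<subseteq> {0..1} \<and> {0..1} \<inter> ball x r \<subseteq> (\<Union>y\<in>F. ball y (r / 2))"
    by (intro exI[of _ ?F]) auto
qed auto

section \<open>Metric trees\<close>

text \<open>Kuratowski embedding; the discrete topology on the index type makes every function continuous.\<close>

lemma (in Metric_space) isometric_embedding:
  assumes "compact_space mtopology"
  obtains \<phi> :: "'a \<Rightarrow> ('a discrete \<Rightarrow>\<^sub>C real)" where "\<And>x y. \<lbrakk>x \<in> M; y \<in> M\<rbrakk> \<Longrightarrow> dist (\<phi> x) (\<phi> y) = d x y"
proof -
  have "compactin mtopology M" using assms unfolding compact_space_def topspace_mtopology .
  then have "mbounded M" by (rule compactin_imp_mbounded)
  then obtain B where B: "\<And>x y. \<lbrakk>x \<in> M; y \<in> M\<rbrakk> \<Longrightarrow> d x y \<le> B" unfolding mbounded_alt by blast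
  define h where "h x z = (if of_discrete z \<in> M then d x (of_discrete z) else 0)" for x z
  define \<phi> :: "'a \<Rightarrow> ('a discrete \<Rightarrow>\<^sub>C real)" where "\<phi> x = Bcontfun (h x)" for x
  have ap: "apply_bcontfun (\<phi> x) z = h x z" if "x \<in> M" for x z
  proof -
    have "norm (h x w) \<le> \<bar>B\<bar>" for w
      using B[OF that, of "of_discrete w"] nonneg[of x "of_discrete w"] by (auto simp: h_def)
    then have "bounded (range (h x))" unfolding bounded_iff by blast
    moreover have "continuous_on UNIV (h x)" by (simp add: continuous_on_open_vimage open_discrete)
    ultimately have "h x \<in> bcontfun" by (simp add: bcontfun_def)
    then show ?thesis by (simp add: \<phi>_def Bcontfun_inverse)
  qed
  have "dist (\<phi> x) (\<phi> y) = d x y" if xy: "x \<in> M" "y \<in> M" for x y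
  proof (rule antisym)
    show "dist (\<phi> x) (\<phi> y) \<le> d x y"
    proof (rule dist_bound)
      fix z
      show "dist (apply_bcontfun (\<phi> x) z) (apply_bcontfun (\<phi> y) z) \<le> d x y"
        using triangle[OF xy, of "of_discrete z"] triangle[OF xy(2,1), of "of_discrete z"]
          commute[of x y] nonneg[of x y]
        by (auto simp: ap xy dist_real_def h_def)
    qed
    have "dist (apply_bcontfun (\<phi> x) (discrete y)) (apply_bcontfun (\<phi> y) (discrete y)) = d x y"
      by (simp add: ap xy dist_real_def h_def discrete_inverse)
    then show "d x y \<le> dist (\<phi> x) (\<phi> y)" using dist_bounded by metis
  qed
  then show ?thesis using that by blast
qed

lemma diam_wrt_image:
  assumes "\<And>x y. \<lbrakk>x \<in> S; y \<in> S\<rbrakk> \<Longrightarrow> e (f x) (f y) = d x y"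
  shows "diam_wrt e (f ` S) = diam_wrt d S"
proof -
  have "(\<lambda>(x, y). e x y) ` (f ` S \<times> f ` S) = (\<lambda>(x, y). d x y) ` (S \<times> S)"
    using assms by (force simp: image_iff)
  then show ?thesis unfolding diam_wrt_def by simp
qed

lemma diam_wrt_dist: "diam_wrt dist S = diameter S"
  unfolding diam_wrt_def diameter_def ..

text \<open>Arcs of the abstract space and arcs of the image correspond under the isometry and its
  inverse; existence is carried over by \<open>\<phi>\<close>, uniqueness by
  \<open>\<psi>\<close>.\<close>

lemma metric_tree_arc_tree:
  fixes \<phi> :: "'a \<Rightarrow> 'e::{complete_space,real_normed_vector}"
  assumes tree: "metric_tree X d" and bt: "bounded_turning C X d"
    and iso: "\<And>x y. \<lbrakk>x \<in> X; y \<in> X\<rbrakk> \<Longrightarrow> dist (\<phi> x) (\<phi> y) = d x y"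
  shows "arc_tree (\<phi> ` X) C"
proof -
  interpret Metric_space X d using tree by (simp add: metric_tree_def)
  have X: "X \<noteq> {}" "compact_space mtopology"
    "\<And>x y. \<lbrakk>x \<in> X; y \<in> X; x \<noteq> y\<rbrakk> \<Longrightarrow> \<exists>!A. is_arc mtopology x y A"
    using tree by (auto simp: metric_tree_def)
  have inj: "inj_on \<phi> X"
  proof (rule inj_onI)
    fix x y assume "x \<in> X" "y \<in> X" "\<phi> x = \<phi> y"
    then show "x = y" using iso[of x y] zero[of x y] by simp
  qed
  define \<psi> where "\<psi> = inv_into X \<phi>"
  have \<psi>: "\<psi> (\<phi> x) = x" if "x \<in> X" for x using inv_into_f_f[OF inj that] by (simp add: \<psi>_def)
  have cont: "continuous_map mtopology euclidean \<phi>"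
    unfolding continuous_map_def
  proof (intro conjI allI impI)
    fix U :: "'e set" assume "openin euclidean U"
    then have U: "open U" by simp
    show "openin mtopology {x \<in> topspace mtopology. \<phi> x \<in> U}"
      unfolding openin_mtopology
    proof (intro conjI allI impI)
      fix x assume "x \<in> {x \<in> topspace mtopology. \<phi> x \<in> U}"
      then have x: "x \<in> X" "\<phi> x \<in> U" by auto
      then obtain r where r: "0 < r" "ball (\<phi> x) r \<subseteq> U" using U open_contains_ball by blast
      have "\<phi> y \<in> U" if "y \<in> mball x r" for y
        using that x r(2) iso[of x y] by (auto simp: subset_iff)
      then show "\<exists>r>0. mball x r \<subseteq> {x \<in> topspace mtopology. \<phi> x \<in> U}"
        using r(1) by (intro exI[of _ r]) auto
    qed auto
  qed auto
  have cont': "continuous_map (top_of_set (\<phi> ` X)) mtopology \<psi>"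
    unfolding continuous_map_to_metric
  proof (intro ballI allI impI)
    fix p and e :: real assume "p \<in> topspace (top_of_set (\<phi> ` X))" and e: "0 < e"
    then obtain x where x: "x \<in> X" "p = \<phi> x" by auto
    have "\<psi> q \<in> mball (\<psi> p) e" if "q \<in> \<phi> ` X \<inter> ball p e" for q
      using that x iso \<psi> by auto
    then show "\<exists>U. openin (top_of_set (\<phi> ` X)) U \<and> p \<in> U \<and> (\<forall>y\<in>U. \<psi> y \<in> mball (\<psi> p) e)"
      using x e by (intro exI[of _ "\<phi> ` X \<inter> ball p e"]) auto
  qed
  have to_arc: "is_arc mtopology (\<psi> (pathstart g)) (\<psi> (pathfinish g)) (\<psi> ` path_image g)"
    if g: "arc g" "path_image g \<subseteq> \<phi> ` X" for g
  proof -
    have "continuous_on {0..1} g" using g(1) by (simp add: arc_def path_def)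
    then have "continuous_map (top_of_set {0..1}) (top_of_set (\<phi> ` X)) g"
      using g(2) by (simp add: path_image_def image_subset_iff_funcset)
    then have 1: "continuous_map (top_of_set {0..1}) mtopology (\<psi> \<circ> g)"
      using cont' by (rule continuous_map_compose)
    have "inj_on \<psi> (\<phi> ` X)" unfolding \<psi>_def by (rule inj_on_inv_into) simp
    then have 2: "inj_on (\<psi> \<circ> g) {0..1}"
      using g by (auto simp: arc_def path_image_def intro!: comp_inj_on elim: inj_on_subset)
    \<comment> \<open>An injective continuous map from a compact space to a Hausdorff space is an
      embedding.\<close>
    have "embedding_map (top_of_set {0..1}) mtopology (\<psi> \<circ> g)"
      using 1 2 by (intro continuous_imp_embedding_map Hausdorff_space_mtopology)
        (auto simp: compact_space_subtopology)
    then show ?thesis unfolding is_arc_def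
      by (intro exI[of _ "\<psi> \<circ> g"]) (auto simp: pathstart_def pathfinish_def path_image_def image_image)
  qed
  show ?thesis
  proof
    have "compactin euclidean (\<phi> ` X)"
      using image_compactin[OF _ cont, of X] X(2) by (simp add: compact_space_def)
    then show "compact (\<phi> ` X)" by simp
    show "\<phi> ` X \<noteq> {}" using X(1) by simp
  next
    fix p q assume "p \<in> \<phi> ` X" "q \<in> \<phi> ` X" "p \<noteq> q"
    then obtain x y where xy: "x \<in> X" "y \<in> X" "x \<noteq> y" "p = \<phi> x" "q = \<phi> y" by auto
    then obtain A where "is_arc mtopology x y A" using X(3) by blast
    then obtain g where g: "embedding_map (top_of_set {0..1::real}) mtopology g" "g 0 = x" "g 1 = y"
      unfolding is_arc_def by blast
    have gc: "continuous_map (top_of_set {0..1}) mtopology g"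
      using homeomorphic_imp_continuous_map g(1)[unfolded embedding_map_def]
      by (metis continuous_map_in_subtopology)
    have gi: "inj_on g {0..1}"
      using homeomorphic_imp_injective_map g(1)[unfolded embedding_map_def] by fastforce
    have gX: "g ` {0..1} \<subseteq> X" using continuous_map_image_subset_topspace[OF gc] by simp
    have "continuous_map (top_of_set {0..1}) euclidean (\<phi> \<circ> g)" using gc cont by (rule continuous_map_compose)
    then have "continuous_on {0..1} (\<phi> \<circ> g)" by simp
    moreover have "inj_on (\<phi> \<circ> g) {0..1}" using gi inj_on_subset[OF inj gX] by (rule comp_inj_on)
    ultimately have "arc (\<phi> \<circ> g)" by (simp add: arc_def path_def)
    then show "\<exists>g. arc g \<and> pathstart g = p \<and> pathfinish g = q \<and> path_image g \<subseteq> \<phi> ` X"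
      using g xy gX by (intro exI[of _ "\<phi> \<circ> g"]) (auto simp: pathstart_def pathfinish_def path_image_def)
  next
    fix g h assume gh: "arc g" "arc h" "path_image g \<subseteq> \<phi> ` X" "path_image h \<subseteq> \<phi> ` X"
      "pathstart g = pathstart h" "pathfinish g = pathfinish h"
    have "pathstart g \<in> \<phi> ` X" "pathfinish g \<in> \<phi> ` X"
      using gh(3) pathstart_in_path_image[of g] pathfinish_in_path_image[of g] by blast+
    then obtain x y where xy: "x \<in> X" "y \<in> X" "pathstart g = \<phi> x" "pathfinish g = \<phi> y" by blast
    have "x \<noteq> y" using arc_distinct_ends[OF gh(1)] xy by auto
    moreover have "\<psi> (pathstart g) = x" "\<psi> (pathfinish g) = y" using xy \<psi> by auto
    then have "is_arc mtopology x y (\<psi> ` path_image g)" "is_arc mtopology x y (\<psi> ` path_image h)"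
      using to_arc[OF gh(1,3)] to_arc[OF gh(2,4)] gh(5,6) by auto
    ultimately have "\<psi> ` path_image g = \<psi> ` path_image h" using X(3)[OF xy(1,2)] by metis
    then have "\<phi> ` \<psi> ` path_image g = \<phi> ` \<psi> ` path_image h" by simp
    moreover have "\<phi> ` \<psi> ` A = A" if "A \<subseteq> \<phi> ` X" for A
      unfolding \<psi>_def using that by (rule image_inv_into_cancel[OF refl])
    ultimately show "path_image g = path_image h" using gh(3,4) by simp
  next
    fix p q assume "p \<in> \<phi> ` X" "q \<in> \<phi> ` X"
    then obtain x y where xy: "x \<in> X" "y \<in> X" "p = \<phi> x" "q = \<phi> y" by auto
    then obtain K where K: "x \<in> K" "y \<in> K" "compactin mtopology K" "connectedin mtopology K"
      "diam_wrt d K \<le> C * d x y"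
      using bt unfolding bounded_turning_def by blast
    have KX: "K \<subseteq> X" using compactin_subset_topspace[OF K(3)] by simp
    have "compact (\<phi> ` K)" using image_compactin[OF K(3) cont] by simp
    moreover have "connected (\<phi> ` K)" using connectedin_continuous_map_image[OF cont K(4)] by simp
    moreover have "diameter (\<phi> ` K) = diam_wrt d K"
      unfolding diam_wrt_dist[symmetric] using KX iso by (intro diam_wrt_image) auto
    ultimately show "\<exists>K. K \<subseteq> \<phi> ` X \<and> compact K \<and> connected K \<and> p \<in> K \<and> q \<in> K \<and> diameter K \<le> C * dist p q"
      using K xy KX iso by (intro exI[of _ "\<phi> ` K"]) auto
  qed
qed

lemma doubling_image:
  assumes "Metric_space X d" "doubling N X d"
    and iso: "\<And>x y. \<lbrakk>x \<in> X; y \<in> X\<rbrakk> \<Longrightarrow> dist (\<phi> x) (\<phi> y) = d x y"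
    and p: "p \<in> \<phi> ` X" and r: "0 < r"
  shows "\<exists>F. finite F \<and> card F \<le> N \<and> F \<subseteq> \<phi> ` X \<and> \<phi> ` X \<inter> ball p r \<subseteq> (\<Union>y\<in>F. ball y (r / 2))"
proof -
  interpret Metric_space X d by fact
  obtain x where x: "x \<in> X" "p = \<phi> x" using p by auto
  obtain F where F: "finite F" "card F \<le> N" "F \<subseteq> X" "mball x r \<subseteq> (\<Union>y\<in>F. mball y (r / 2))"
    using assms(2)[unfolded doubling_def, rule_format, OF x(1) r] by blast
  have "\<phi> z \<in> (\<Union>y\<in>\<phi> ` F. ball y (r / 2))" if z: "z \<in> X" "\<phi> z \<in> ball p r" for z
  proof -
    have "z \<in> mball x r" using z x iso[of x z] by auto
    then obtain y where y: "y \<in> F" "z \<in> mball y (r / 2)" using F(4) by blast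
    then have "dist (\<phi> y) (\<phi> z) < r / 2" using F(3) iso[of y z] by auto
    then show ?thesis using y(1) by (intro UN_I[of "\<phi> y"]) auto
  qed
  moreover have "card (\<phi> ` F) \<le> N" using card_image_le[OF F(1), of \<phi>] F(2) by linarith
  ultimately show ?thesis using F(1,3) by (intro exI[of _ "\<phi> ` F"]) auto
qed

lemma (in seg_tree) diameter_le_dm: "diameter X \<le> dm X"
proof -
  have "(case z of (x, y) \<Rightarrow> dist x y) \<le> dm X" if z: "z \<in> X \<times> X" for z
  proof -
    obtain x y where "z = (x, y)" "x \<in> X" "y \<in> X" using z by blast
    then show ?thesis using dist_le_rho[of x y] rho_le_dm[of X x y] by simp
  qed
  then have "(SUP z\<in>X \<times> X. case z of (x, y) \<Rightarrow> dist x y) \<le> dm X"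
    using X_nonempty by (intro cSUP_least) auto
  then show ?thesis using X_nonempty by (simp add: diameter_def)
qed

lemma (in seg_tree) dm_le_diameter:
  assumes "0 \<le> C"
  shows "dm X \<le> C * diameter X"
proof (rule dm_le[OF X_nonempty])
  fix x y assume xy: "x \<in> X" "y \<in> X"
  have "C * dist x y \<le> C * diameter X"
    using diameter_bounded_bound[OF compact_imp_bounded[OF compact_X] xy] assms by (rule mult_left_mono)
  then show "rho x y \<le> C * diameter X" using rho_le_dist[OF xy] by linarith
qed

text \<open>For the diameter \<open>G\<close> with respect to \<open>rho\<close>, the constants
  found are \<open>G / K1\<close> and \<open>8 * C / (K1\<^sup>2 * G)\<close>. Inserting
  \<open>D <= G <= C * D\<close> and \<open>1 / K1 <= 2 * s\<close> gives these two terms;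
  \<open>32\<close> is \<open>8 * 2\<^sup>2\<close>.\<close>

definition lipschitz_const :: "real \<Rightarrow> real \<Rightarrow> real \<Rightarrow> real" where
  "lipschitz_const C s D = max 1 (max (2 * C * D * s) (32 * C * s\<^sup>2 / D))"

lemma has_tree_code_metric_tree:
  assumes tree: "metric_tree X d" and dbl: "doubling N X d" and bt: "bounded_turning C X d"
    and M: "split_threshold N C \<le> M" "split_threshold 3 1 \<le> M"
    and K: "0 < K1" "K1 \<le> sep_const M" "1 / 2 \<le> K2" "K2 < 1"
  shows "has_tree_code M K1 K2 (lipschitz_const C (K2 / K1) (diam_wrt d X)) X d"
proof (cases "\<exists>x\<in>X. \<exists>y\<in>X. x \<noteq> y")
  case False
  interpret Metric_space X d using tree by (simp add: metric_tree_def)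
  obtain y where y: "y \<in> X" using tree by (auto simp: metric_tree_def)
  then have X: "X = {y}" using False by blast
  \<comment> \<open>A single point is coded by the words of the unit interval, collapsed by a small
    weight.\<close>
  interpret I: doubling_tree "{0..1::real}" closed_segment 1 3 by (rule interval_doubling_tree)
  have "(1::real) \<le> I.rho 0 1" using I.dist_le_rho[of 0 1] by simp
  also have "\<dots> \<le> I.dm {0..1}" by (rule I.rho_le_dm) auto
  finally have "tree_code_axioms {0..1::real} closed_segment 1 3 M"
    using M(2) by unfold_locales auto
  then interpret tree_code "{0..1::real}" closed_segment 1 3 M
    using I.doubling_tree_axioms by (simp add: tree_code_def)
  have "d y y = 0" using y by simp
  then show ?thesis unfolding X by (intro has_tree_code_point[OF K]) (simp_all add: lipschitz_const_def)
next
  case True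
  then obtain x y where xy: "x \<in> X" "y \<in> X" "x \<noteq> y" by blast
  interpret Metric_space X d using tree by (simp add: metric_tree_def)
  have X: "compact_space mtopology" "X \<noteq> {}" using tree by (auto simp: metric_tree_def)
  obtain \<phi> :: "'a \<Rightarrow> ('a discrete \<Rightarrow>\<^sub>C real)" where iso: "\<And>x y. \<lbrakk>x \<in> X; y \<in> X\<rbrakk> \<Longrightarrow> dist (\<phi> x) (\<phi> y) = d x y"
    using isometric_embedding[OF X(1)] by blast
  interpret A: arc_tree "\<phi> ` X" C by (rule metric_tree_arc_tree[OF tree bt iso])
  interpret B: seg_tree "\<phi> ` X" A.seg C by (rule A.seg_tree)
  have "\<phi> x \<in> \<phi> ` X" "\<phi> y \<in> \<phi> ` X" using xy by auto
  moreover have "\<phi> x \<noteq> \<phi> y" using iso[OF xy(1,2)] mdist_pos_less[OF xy(3,1,2)] by auto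
  ultimately have C: "1 \<le> C" and pos: "0 < B.rho (\<phi> x) (\<phi> y)" "B.rho (\<phi> x) (\<phi> y) \<le> B.dm (\<phi> ` X)"
    using B.C_ge_1 B.rho_pos B.rho_le_dm[of "\<phi> ` X"] by auto
  have "tree_code (\<phi> ` X) A.seg C N M"
  proof
    show "\<exists>F. finite F \<and> card F \<le> N \<and> F \<subseteq> \<phi> ` X \<and> \<phi> ` X \<inter> ball p r \<subseteq> (\<Union>y\<in>F. ball y (r / 2))"
      if "p \<in> \<phi> ` X" "0 < r" for p r
      using doubling_image[OF Metric_space_axioms dbl iso that] by blast
  qed (use M pos in auto)
  then interpret tree_code "\<phi> ` X" A.seg C N M .
  define G :: real where "G = B.dm (\<phi> ` X)"
  define \<delta> where "\<delta> = diam_wrt d X"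
  define s where "s = K2 / K1"
  have \<delta>: "\<delta> = diameter (\<phi> ` X)"
    unfolding \<delta>_def diam_wrt_dist[symmetric] using iso by (intro diam_wrt_image[symmetric])
  have G: "0 < G" "\<delta> \<le> G" "G \<le> C * \<delta>"
    using pos B.diameter_le_dm B.dm_le_diameter C unfolding G_def \<delta> by auto
  have \<delta>0: "0 < \<delta>" using G C by (smt (verit) mult_nonneg_nonpos)
  have s: "1 / K1 \<le> 2 * s" "0 < s" using K by (auto simp: s_def field_simps)
  have L1: "G / K1 \<le> 2 * C * \<delta> * s"
  proof -
    have "G * (1 / K1) \<le> C * \<delta> * (2 * s)" using G s C \<delta>0 K(1) by (intro mult_mono) auto
    then show ?thesis by (simp add: mult_ac)
  qed
  have L2: "8 * C / (K1\<^sup>2 * G) \<le> 32 * C * s\<^sup>2 / \<delta>"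
  proof -
    have "(1 / K1)\<^sup>2 \<le> (2 * s)\<^sup>2" using s(1) K(1) by (intro power_mono) auto
    moreover have "1 / G \<le> 1 / \<delta>" using G(2) \<delta>0 by (intro divide_left_mono) (auto intro: mult_pos_pos[OF G(1) \<delta>0])
    ultimately have "8 * C * ((1 / K1)\<^sup>2 * (1 / G)) \<le> 8 * C * ((2 * s)\<^sup>2 * (1 / \<delta>))"
      using C G(1) by (intro mult_left_mono mult_mono) auto
    then show ?thesis by (simp add: power_divide power_mult_distrib)
  qed
  define \<psi> where "\<psi> = inv_into X \<phi>"
  have "inj_on \<phi> X"
  proof (rule inj_onI)
    fix x y assume "x \<in> X" "y \<in> X" "\<phi> x = \<phi> y"
    then show "x = y" using iso[of x y] zero[of x y] by simp
  qed
  then have \<psi>: "\<psi> (\<phi> x) = x" if "x \<in> X" for x using that by (simp add: \<psi>_def)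
  have "has_tree_code M K1 K2 (lipschitz_const C s \<delta>) X d"
  proof (rule has_tree_code_nondegenerate[OF K, of \<psi>])
    show "\<psi> ` \<phi> ` X = X" using \<psi> by (force simp: image_iff)
    show "d (\<psi> p) (\<psi> q) = dist p q" if "p \<in> \<phi> ` X" "q \<in> \<phi> ` X" for p q
      using that \<psi> iso by auto
    show "1 \<le> lipschitz_const C s \<delta>" by (simp add: lipschitz_const_def)
    show "B.dm (\<phi> ` X) / K1 \<le> lipschitz_const C s \<delta>" using L1 by (auto simp: lipschitz_const_def G_def)
    show "8 * C / (K1\<^sup>2 * B.dm (\<phi> ` X)) \<le> lipschitz_const C s \<delta>"
      using L2 by (auto simp: lipschitz_const_def G_def)
  qed
  then show ?thesis by (simp add: s_def \<delta>_def)
qed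

theorem theorem5p1:
  shows "\<exists>(M0 :: nat \<Rightarrow> real \<Rightarrow> nat) (\<kappa> :: nat \<Rightarrow> nat \<Rightarrow> real \<Rightarrow> real)
           (L :: nat \<Rightarrow> real \<Rightarrow> real \<Rightarrow> real \<Rightarrow> real).
     (\<forall>M N C. 0 < \<kappa> M N C) \<and>
     (\<forall>(N :: nat) (C :: real) (X :: 'a set) (d :: 'a \<Rightarrow> 'a \<Rightarrow> real) (M :: nat) (K1 :: real) (K2 :: real).
        metric_tree X d \<and> doubling N X d \<and> bounded_turning C X d \<and>
        M0 N C \<le> M \<and> 0 < K1 \<and> K1 \<le> \<kappa> M N C \<and> 1 / 2 \<le> K2 \<and> K2 < 1
        \<longrightarrow> (\<exists>T \<Delta>.
               combinatorial_data M T \<and> (\<forall>k. combinatorial_tree (T k)) \<and>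
               \<Delta> \<in> diameter_functions M K1 K2 \<and>
               bilipschitz_equivalent (L N C (K2 / K1) (diam_wrt d X))
                 (chain_space M T \<Delta>) (chain_dist M T \<Delta>) X d \<and>
               (\<exists>(N' :: nat) (n0 :: nat) (c :: real) (\<delta>1 :: real) (\<delta>2 :: real).
                  1 < c \<and> 0 < \<delta>1 \<and> \<delta>1 < 1 \<and> 0 < \<delta>2 \<and> \<delta>2 < 1 \<and>
                  cond_P1 M N' \<and> cond_P2 T n0 \<and> cond_P3 M \<Delta> \<delta>1 \<delta>2 \<and>
                  ((\<exists>x\<in>X. \<exists>y\<in>X. x \<noteq> y) \<longrightarrow> cond_P4 M T \<Delta> c))))"
  unfolding has_tree_code_def[symmetric]
\<comment> \<open>The second threshold belongs to the interval, with doubling constant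
  \<open>3\<close> and turning constant \<open>1\<close>, which replaces \<open>X\<close> when
  \<open>X\<close> is a point.\<close>
proof (rule exI[of _ "\<lambda>N C. max (split_threshold N C) (split_threshold 3 1)"],
    rule exI[of _ "\<lambda>M N C. sep_const M"], rule exI[of _ "\<lambda>N. lipschitz_const"], intro conjI allI impI)
  show "0 < sep_const M" for M by (rule sep_const_pos)
  fix N :: nat and C :: real and M :: nat and K1 K2 :: real and X :: "'a set" and d :: "'a \<Rightarrow> 'a \<Rightarrow> real"
  assume "metric_tree X d \<and> doubling N X d \<and> bounded_turning C X d \<and>
    max (split_threshold N C) (split_threshold 3 1) \<le> M \<and> 0 < K1 \<and> K1 \<le> sep_const M \<and> 1 / 2 \<le> K2 \<and> K2 < 1"
  then show "has_tree_code M K1 K2 (lipschitz_const C (K2 / K1) (diam_wrt d X)) X d"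
    by (elim conjE, intro has_tree_code_metric_tree[of X d N]) simp_all
qed

end
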